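(* Let $f\in\mathcal{B}$ be a transcendental entire function of finite order, and let $r_0>0$ be such that all singular values of $f$ lie in $D(0,r_0)$. Put $$\theta(r)=\operatorname{meas}\{t\in[0,2\pi]: |f(re^{it})|<r_0\}.$$ Suppose that $\theta(r)\geq\theta_0(r)$ for all sufficiently large $r>0$, where $\theta_0$ is a decreasing function satisfying $$\sum_{k=1}^{\infty}\theta_0\left(E^k(0)\right)=\infty.$$ Then the escaping set $\mathcal{I}(f)$ has Lebesgue measure zero. If, in addition, $f$ is of disjoint type, then the Julia set $\mathcal{J}(f)$ has Lebesgue measure zero.
   Context: $\operatorname{meas}$ is one-dimensional Lebesgue measure; $E(x)=e^x$ and $E^k$ is its $k$-th iterate. The order of $f$ is $\limsup_{r\to\infty}\log\log M(r,f)/\log r$ with $M(r,f)=\max_{|z|=r}|f(z)|$. $\mathcal{B}$ is the class of transcendental entire functions whose set $S(f)$ of singular values (closure in $\mathbb{C}$ of the critical and asymptotic values) is bounded. $\mathcal{I}(f)=\{z: f^n(z)\to\infty\}$; $\mathcal{J}(f)$ is the set where the iterates do not form a normal family, $\mathcal{F}(f)$ its complement. $f$ is hyperbolic if $f\in\mathcal{B}$ and every element of $S(f)$ lies in the basin of an attracting periodic cycle; $f$ is of disjoint type if it is hyperbolic and $\mathcal{F}(f)$ is connected. *)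

theory Defs
  imports "HOL-Analysis.Analysis"
begin

definition transcendental_entire :: "(complex \<Rightarrow> complex) \<Rightarrow> bool" where
  "transcendental_entire f \<longleftrightarrow> f holomorphic_on UNIV \<and>
     \<not> (\<exists>(n::nat) (c::nat \<Rightarrow> complex). \<forall>z. f z = (\<Sum>k\<le>n. c k * z ^ k))"

definition critical_values :: "(complex \<Rightarrow> complex) \<Rightarrow> complex set" where
  "critical_values f = {f z | z. deriv f z = 0}"

definition asymptotic_values :: "(complex \<Rightarrow> complex) \<Rightarrow> complex set" where
  "asymptotic_values f = {a. \<exists>\<gamma>::real \<Rightarrow> complex. continuous_on {0..<1} \<gamma> \<and>
       filterlim \<gamma> at_infinity (at_left 1) \<and> ((\<lambda>t. f (\<gamma> t)) \<longlongrightarrow> a) (at_left 1)}"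

definition singular_values :: "(complex \<Rightarrow> complex) \<Rightarrow> complex set" where
  "singular_values f = closure (critical_values f \<union> asymptotic_values f)"

definition class_B :: "(complex \<Rightarrow> complex) \<Rightarrow> bool" where
  "class_B f \<longleftrightarrow> transcendental_entire f \<and> bounded (singular_values f)"

definition max_modulus :: "(complex \<Rightarrow> complex) \<Rightarrow> real \<Rightarrow> real" where
  "max_modulus f r = Sup {norm (f z) | z. norm z = r}"

definition order_of :: "(complex \<Rightarrow> complex) \<Rightarrow> ereal" where
  "order_of f = Limsup at_top (\<lambda>r. ereal (ln (ln (max_modulus f r)) / ln r))"

definition finite_order :: "(complex \<Rightarrow> complex) \<Rightarrow> bool" where
  "finite_order f \<longleftrightarrow> order_of f < \<infinity>"

definition escaping_set :: "(complex \<Rightarrow> complex) \<Rightarrow> complex set" where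
  "escaping_set f = {z. filterlim (\<lambda>n. (f ^^ n) z) at_infinity sequentially}"

definition normal_family_on :: "complex set \<Rightarrow> (complex \<Rightarrow> complex) set \<Rightarrow> bool" where
  "normal_family_on U F \<longleftrightarrow>
     (\<forall>s::nat \<Rightarrow> (complex \<Rightarrow> complex). range s \<subseteq> F \<longrightarrow>
        (\<exists>r. strict_mono r \<and>
           ((\<exists>g. \<forall>K. compact K \<and> K \<subseteq> U \<longrightarrow> uniform_limit K (\<lambda>j. s (r j)) g sequentially) \<or>
            (\<forall>K. compact K \<and> K \<subseteq> U \<longrightarrow>
               (\<forall>B. eventually (\<lambda>j. \<forall>z\<in>K. B < norm (s (r j) z)) sequentially)))))"

definition fatou_set :: "(complex \<Rightarrow> complex) \<Rightarrow> complex set" where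
  "fatou_set f = {z. \<exists>U. open U \<and> z \<in> U \<and> normal_family_on U (range (\<lambda>n. f ^^ n))}"

definition julia_set :: "(complex \<Rightarrow> complex) \<Rightarrow> complex set" where
  "julia_set f = - fatou_set f"

definition attracting_periodic :: "(complex \<Rightarrow> complex) \<Rightarrow> complex \<Rightarrow> nat \<Rightarrow> bool" where
  "attracting_periodic f z0 p \<longleftrightarrow> p \<ge> 1 \<and> (f ^^ p) z0 = z0 \<and> norm (deriv (f ^^ p) z0) < 1"

definition cycle_of :: "(complex \<Rightarrow> complex) \<Rightarrow> complex \<Rightarrow> nat \<Rightarrow> complex set" where
  "cycle_of f z0 p = {(f ^^ j) z0 | j. j < p}"

definition basin :: "(complex \<Rightarrow> complex) \<Rightarrow> complex \<Rightarrow> nat \<Rightarrow> complex set" where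
  "basin f z0 p = {z. (\<lambda>n. infdist ((f ^^ n) z) (cycle_of f z0 p)) \<longlonglongrightarrow> 0}"

definition hyperbolic :: "(complex \<Rightarrow> complex) \<Rightarrow> bool" where
  "hyperbolic f \<longleftrightarrow> class_B f \<and>
     (\<forall>s \<in> singular_values f. \<exists>z0 p. attracting_periodic f z0 p \<and> s \<in> basin f z0 p)"

definition disjoint_type :: "(complex \<Rightarrow> complex) \<Rightarrow> bool" where
  "disjoint_type f \<longleftrightarrow> hyperbolic f \<and> connected (fatou_set f)"

definition theta :: "(complex \<Rightarrow> complex) \<Rightarrow> real \<Rightarrow> real \<Rightarrow> real" where
  "theta f r0 r = measure lebesgue {t \<in> {0..2*pi}. norm (f (of_real r * exp (\<i> * of_real t))) < r0}"

end

theory Submission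
  imports Defs "HOL-Complex_Analysis.Complex_Analysis"
begin

text \<open>
  Let \<open>A\<close> be the set of points whose orbits stay outside a large disc. For \<open>z \<in> A\<close>, logarithmic
  inverse branches of \<open>f\<close> along the orbit are contractions defined on discs of a fixed large
  radius, so the rectangle of height \<open>2 * \<pi>\<close> around \<open>log (f\<^sup>n z)\<close> is pulled back to \<open>z\<close> with
  bounded distortion. By hypothesis a proportion at least \<open>\<theta>\<^sub>0\<close>, evaluated near
  \<open>norm (f\<^sup>n z)\<close>, of this rectangle is mapped into the disc of radius \<open>r\<^sub>0\<close> in the next step.
  Hence the set \<open>G\<^sub>n\<close> of points that leave the outer region exactly at time \<open>n + 1\<close> fills a
  proportion at least \<open>c * \<theta>\<^sub>0\<close> of some disc around \<open>z\<close>, and a Vitali covering gives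
  \<open>\<theta>\<^sub>0 * meas A \<le> C * meas G\<^sub>n\<close>, locally. Finite order bounds \<open>norm (f\<^sup>n z)\<close> by an iterated
  exponential; since the sets \<open>G\<^sub>n\<close> are pairwise disjoint, divergence of the series forces
  \<open>meas A = 0\<close>. The escaping set consists of preimages of points of \<open>A\<close>.

  If \<open>f\<close> is hyperbolic, a non-escaping Julia point returns infinitely often to a bounded part of
  the Julia set, which has positive distance to the postsingular set. There the inverse branches
  of all iterates exist on discs of fixed size, and a fixed proportion of such a disc is captured
  by an attracting cycle within a bounded time. The same covering argument and the
  Borel-Cantelli lemma show that these points form a null set.
\<close>

section \<open>Lifting along entire functions\<close>

text \<open>Monotonicity and divergence of the series make \<open>\<theta>0\<close> positive, so
  every large circle contains a point where \<open>f\<close> is small. Tracts therefore cannot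
  surround the origin, and Bloch's theorem bounds the derivative of a logarithmic inverse branch; it
  is at most 1 once a margin of 12 \<pi> to the boundary of its disc is left.

  A disc containing a rectangle of height 2 \<pi> is too large for \<open>exp\<close> to be
  injective on it, so the branch \<open>exp o \<phi>\<close> of the inverse of an iterate is
  injective only on discs of radius below \<pi>. Distortion is therefore derived from local
  injectivity: the quotient of second and first derivative is bounded on small discs and integrated.
  Areas of images are compared by Vitali coverings as well, on finitely many small pieces; each
  comparison costs a constant factor that depends neither on the point nor on the time.

  The rectangle reaches 1 to either side in the logarithm of the modulus, so \<open>theta\<close> is
  used on circles within a factor e of the orbit point. This is the source of the factors
  \<open>exp 1\<close> in the constants.

  In the hyperbolic case the radii of the pulled-back discs stay bounded because the inverse
  branches omit a disc around an attracting point.\<close>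

lemma lift_unique:
  assumes "open U" "connected U" and k: "k holomorphic_on U" and l: "l holomorphic_on U"
    and f: "f holomorphic_on UNIV" and a: "a \<in> U" and eq: "k a = l a" and "deriv f (k a) \<noteq> 0"
    and fk: "\<And>w. w \<in> U \<Longrightarrow> f (k w) = f (l w)" and w: "w \<in> U"
  shows "k w = l w"
proof -
  obtain r where r: "r > 0" "inj_on f (ball (k a) r)"
    using has_complex_derivative_locally_injective[OF f _ _ assms(8)] by auto
  define N where "N = (U \<inter> k -` ball (k a) r) \<inter> (U \<inter> l -` ball (k a) r)"
  have "open N" unfolding N_def
    by (intro open_Int continuous_open_preimage holomorphic_on_imp_continuous_on k l assms(1)) auto
  moreover have "a \<in> N" using a r eq by (auto simp: N_def)
  moreover have "k x = l x" if "x \<in> N" for x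
    using that r(2) fk by (auto simp: N_def inj_on_def)
  ultimately show ?thesis
    using analytic_continuation_open[of N U k l w] assms(1,2) k l w unfolding N_def by blast
qed

text \<open>The local extensions agree wherever their discs overlap, so they glue to a function on a
  neighbourhood of the closed disc; by compactness this contains a larger concentric disc.\<close>

lemma holomorphic_extend_beyond_ball:
  fixes g :: "complex \<Rightarrow> complex"
  assumes R: "0 < R" and g: "g holomorphic_on ball a R"
    and loc: "\<And>b. b \<in> sphere a R \<Longrightarrow>
      \<exists>e h. e > 0 \<and> h holomorphic_on ball b e \<and> (\<forall>w\<in>ball b e \<inter> ball a R. h w = g w)"
  obtains R' G where "R' > R" "G holomorphic_on ball a R'" "\<And>w. w \<in> ball a R \<Longrightarrow> G w = g w"
proof -
  obtain e h where e: "\<And>b. b \<in> sphere a R \<Longrightarrow> e b > 0"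
    and h: "\<And>b. b \<in> sphere a R \<Longrightarrow> h b holomorphic_on ball b (e b)"
    and hg: "\<And>b w. b \<in> sphere a R \<Longrightarrow> w \<in> ball b (e b) \<Longrightarrow> w \<in> ball a R \<Longrightarrow> h b w = g w"
    using loc by (metis IntI)
  have coh: "h b w = h c w"
    if b: "b \<in> sphere a R" "w \<in> ball b (e b)" and c: "c \<in> sphere a R" "w \<in> ball c (e c)" for b c w
  proof -
    define U where "U = ball b (e b) \<inter> ball c (e c)"
    have U: "open U" "connected U" unfolding U_def
      by (auto intro: convex_connected convex_Int)
    \<comment> \<open>The projection onto the closed disc is 1-Lipschitz and fixes \<open>b\<close>
      and \<open>c\<close>, so it moves \<open>w\<close> to a point of the closed disc that still
      lies in both extension discs. The open overlap then meets the open disc, where both extensions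
      equal \<open>g\<close>.\<close>
    obtain y where y: "y \<in> U" "y \<in> cball a R"
    proof -
      define y where "y = closest_point (cball a R) w"
      have cl: "closest_point (cball a R) x = x" if "x \<in> cball a R" for x
        using that by (rule closest_point_self)
      have "dist y b \<le> dist w b" if "b \<in> sphere a R" for b
        using closest_point_lipschitz[of "cball a R" w b] cl[of b] that R unfolding y_def
        by (auto simp: less_imp_le)
      hence "y \<in> U" using b c unfolding U_def by (force simp: dist_commute)
      moreover have "y \<in> cball a R" unfolding y_def using R by (intro closest_point_in_set) auto
      ultimately show ?thesis using that by blast
    qed
    hence "U \<inter> closure (ball a R) \<noteq> {}" using R by auto
    hence ne: "U \<inter> ball a R \<noteq> {}" using U(1) open_Int_closure_eq_empty by blast
    show ?thesis
    proof (rule analytic_continuation_open[of "U \<inter> ball a R" U "h b" "h c"])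
      show "h b holomorphic_on U" "h c holomorphic_on U" unfolding U_def
        using h b c holomorphic_on_subset by blast+
    qed (use U ne hg b c U_def in auto)
  qed
  define W where "W = ball a R \<union> (\<Union>b\<in>sphere a R. ball b (e b))"
  have "open W" unfolding W_def by auto
  moreover have "cball a R \<subseteq> W" using e unfolding W_def by (force simp: le_less)
  ultimately obtain \<epsilon> where \<epsilon>: "\<epsilon> > 0" "(\<Union>x\<in>cball a R. ball x \<epsilon>) \<subseteq> W"
    using compact_subset_open_imp_ball_epsilon_subset[OF compact_cball] by blast
  define G where "G w = (if w \<in> ball a R then g w else
      h (SOME b. b \<in> sphere a R \<and> w \<in> ball b (e b)) w)" for w
  have Gh: "G w = h b w" if "b \<in> sphere a R" "w \<in> ball b (e b)" for b w
  proof (cases "w \<in> ball a R")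
    case True thus ?thesis using hg that G_def by auto
  next
    case False
    define c where "c = (SOME b. b \<in> sphere a R \<and> w \<in> ball b (e b))"
    have "c \<in> sphere a R \<and> w \<in> ball c (e c)" unfolding c_def by (rule someI[of _ b]) (use that in auto)
    thus ?thesis using coh[of b w c] that False unfolding G_def c_def by auto
  qed
  have "G holomorphic_on W" unfolding W_def
  proof (rule holomorphic_on_Un)
    show "G holomorphic_on ball a R" by (rule holomorphic_transform[OF g]) (simp add: G_def)
    show "G holomorphic_on (\<Union>b\<in>sphere a R. ball b (e b))"
    proof (rule holomorphic_on_UN_open)
      show "G holomorphic_on ball b (e b)" if "b \<in> sphere a R" for b
        by (rule holomorphic_transform[OF h[OF that]]) (use Gh that in auto)
    qed auto
  qed auto
  moreover have "ball a (R + \<epsilon>) \<subseteq> W"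
  proof
    fix w assume w: "w \<in> ball a (R + \<epsilon>)"
    show "w \<in> W"
    proof (cases "w \<in> cball a R")
      case True thus ?thesis using \<open>cball a R \<subseteq> W\<close> by auto
    next
      case False
      define n where "n = norm (w - a)"
      have n: "n > R" "n < R + \<epsilon>" using w False by (auto simp: n_def dist_norm norm_minus_commute)
      define p where "p = a + of_real (R / n) * (w - a)"
      have "p \<in> cball a R" using n(1) R unfolding p_def n_def
        by (simp add: dist_norm norm_mult norm_divide)
      moreover have "dist p w < \<epsilon>"
      proof -
        have "w - p = of_real (1 - R / n) * (w - a)" by (simp add: p_def algebra_simps)
        hence "norm (w - p) = (1 - R/n) * n" using n R unfolding n_def
          by (simp only: norm_mult norm_of_real) (simp add: divide_simps)
        also have "\<dots> = n - R" using n R by (simp add: field_simps)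
        finally show ?thesis using n by (simp add: dist_norm norm_minus_commute)
      qed
      ultimately show ?thesis using \<epsilon>(2) unfolding subset_iff UN_iff mem_ball by blast
    qed
  qed
  ultimately show ?thesis using \<epsilon> that[of "R + \<epsilon>" G] holomorphic_on_subset
    by (simp add: G_def)
qed

text \<open>Otherwise finitely many neighbourhoods that are eventually avoided would cover
  \<open>K\<close>. This provides a finite accumulation point for a path that does not tend to
  infinity.\<close>

lemma frequently_compact_cluster_point:
  fixes \<gamma> :: "'a \<Rightarrow> 'b::metric_space"
  assumes "frequently (\<lambda>t. \<gamma> t \<in> K) F" "compact K"
  obtains p where "\<And>e. e > 0 \<Longrightarrow> frequently (\<lambda>t. dist p (\<gamma> t) < e) F"
proof -
  have "\<exists>p. \<forall>e>0. frequently (\<lambda>t. dist p (\<gamma> t) < e) F"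
  proof (rule ccontr)
    assume "\<not> ?thesis"
    hence "\<forall>p. \<exists>e>0. eventually (\<lambda>t. \<not> dist p (\<gamma> t) < e) F"
      by (simp add: not_frequently)
    then obtain e where e: "\<And>p. e p > 0" "\<And>p. eventually (\<lambda>t. \<not> dist p (\<gamma> t) < e p) F"
      by metis
    have cov: "K \<subseteq> (\<Union>p\<in>K. ball p (e p))" using e by auto
    obtain C where C: "finite C" "C \<subseteq> K" "K \<subseteq> (\<Union>p\<in>C. ball p (e p))"
      by (rule compactE_image[OF assms(2) open_ball cov])
    have "eventually (\<lambda>t. \<forall>p\<in>C. \<not> dist p (\<gamma> t) < e p) F"
      using C(1) e(2) by (simp add: eventually_ball_finite)
    hence "eventually (\<lambda>t. \<gamma> t \<notin> K) F" by (rule eventually_mono) (use C(3) in force)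
    thus False using assms(1) by (simp add: frequently_def)
  qed
  then obtain p where "\<forall>e>0. frequently (\<lambda>t. dist p (\<gamma> t) < e) F" ..
  thus thesis by (intro that[of p]) simp
qed

lemma deriv_nonzero_off_singular_values: "f z \<notin> singular_values f \<Longrightarrow> deriv f z \<noteq> 0"
  using closure_subset[of "critical_values f \<union> asymptotic_values f"]
  unfolding singular_values_def critical_values_def by blast

lemma local_inverse:
  assumes f: "f holomorphic_on UNIV" and "deriv f p \<noteq> 0"
  obtains r \<phi> where "r > 0" "open (f ` ball p r)" "inj_on f (ball p r)"
    "\<phi> holomorphic_on f ` ball p r" "\<And>z. z \<in> ball p r \<Longrightarrow> \<phi> (f z) = z"
proof -
  obtain r where r: "r > 0" "open (f ` ball p r)" "inj_on f (ball p r)"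
    using has_complex_derivative_locally_invertible[OF f UNIV_I open_UNIV assms(2)] by auto
  obtain \<phi> where "\<phi> holomorphic_on f ` ball p r" "\<And>z. z \<in> ball p r \<Longrightarrow> \<phi> (f z) = z"
    using holomorphic_has_inverse[OF holomorphic_on_subset[OF f subset_UNIV] open_ball r(3)] by metis
  thus ?thesis using r that by metis
qed

text \<open>Along the radius ending at \<open>b\<close>, the lift is a path whose image under
  \<open>f\<close> tends to \<open>h b\<close>. As \<open>h b\<close> is not an asymptotic value,
  the path does not tend to infinity and has an accumulation point \<open>p\<close> with
  \<open>f p = h b\<close>. As \<open>h b\<close> is not a critical value, the local inverse of
  \<open>f\<close> at \<open>p\<close> supplies the extension.\<close>

lemma lift_extends_at_boundary:
  assumes f: "f holomorphic_on UNIV" and R: "0 < R" "R < d"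
    and g: "g holomorphic_on ball a R" and h: "h holomorphic_on ball a d"
    and fg: "\<And>w. w \<in> ball a R \<Longrightarrow> f (g w) = h w"
    and b: "b \<in> sphere a R" and nb: "h b \<notin> singular_values f"
  shows "\<exists>e k. e > 0 \<and> k holomorphic_on ball b e \<and> (\<forall>w\<in>ball b e \<inter> ball a R. k w = g w)"
proof -
  define L where "L t = a + of_real t * (b - a)" for t :: real
  define \<gamma> where "\<gamma> t = g (L t)" for t
  have L: "L t \<in> ball a R" if "0 \<le> t" "t < 1" for t
    using that b R by (auto simp: L_def dist_norm norm_mult norm_minus_commute)
  have bd: "b \<in> ball a d" using b R by auto
  have contL: "continuous_on S L" for S unfolding L_def by (intro continuous_intros)
  have c\<gamma>: "continuous_on {0..<1} \<gamma>" unfolding \<gamma>_def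
    by (rule continuous_on_compose2[OF holomorphic_on_imp_continuous_on[OF g] contL]) (use L in auto)
  have hc: "isCont h b"
    using h bd by (meson holomorphic_on_imp_continuous_on continuous_on_eq_continuous_at open_ball)
  have Ll: "(L \<longlongrightarrow> b) (at_left 1)"
  proof -
    have "isCont L 1" unfolding L_def by (intro continuous_intros)
    hence "(L \<longlongrightarrow> L 1) (at_left 1)" unfolding isCont_def by (rule tendsto_within_subset) simp
    thus ?thesis by (simp add: L_def)
  qed
  have ev01: "eventually (\<lambda>t. t \<in> {0..<1}) (at_left (1::real))"
    using eventually_at_left_real[of 0 1] by (auto elim: eventually_mono)
  have hL: "((\<lambda>t. h (L t)) \<longlongrightarrow> h b) (at_left 1)"
    using isCont_tendsto_compose[OF hc Ll] .
  have fl: "((\<lambda>t. f (\<gamma> t)) \<longlongrightarrow> h b) (at_left 1)"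
    by (rule Lim_transform_eventually[OF hL])
      (use ev01 fg L in \<open>auto simp: \<gamma>_def elim!: eventually_mono\<close>)
  have "\<not> filterlim \<gamma> at_infinity (at_left 1)"
  proof
    assume "filterlim \<gamma> at_infinity (at_left 1)"
    hence "h b \<in> asymptotic_values f" using c\<gamma> fl unfolding asymptotic_values_def by auto
    thus False using nb closure_subset unfolding singular_values_def by auto
  qed
  then obtain B where "frequently (\<lambda>t. \<not> B \<le> norm (\<gamma> t)) (at_left 1)"
    unfolding filterlim_at_infinity[OF order_refl] not_eventually[symmetric] by blast
  hence B: "frequently (\<lambda>t. \<gamma> t \<in> cball 0 B) (at_left 1)"
    by (rule frequently_elim1) simp
  obtain p where p: "\<And>e. e > 0 \<Longrightarrow> frequently (\<lambda>t. dist p (\<gamma> t) < e) (at_left 1)"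
    using frequently_compact_cluster_point[OF B compact_cball] by metis
  have fp: "f p = h b"
  proof (rule ccontr)
    assume "f p \<noteq> h b"
    define e where "e = dist (f p) (h b) / 2"
    have e: "e > 0" using \<open>f p \<noteq> h b\<close> by (simp add: e_def)
    have "isCont f p" using f by (meson UNIV_I continuous_on_eq_continuous_at holomorphic_on_imp_continuous_on open_UNIV)
    then obtain d where d: "d > 0" "\<And>x. dist x p < d \<Longrightarrow> dist (f x) (f p) < e"
      using e unfolding continuous_at_eps_delta by metis
    have "eventually (\<lambda>t. dist (f (\<gamma> t)) (h b) < e) (at_left 1)" using fl e by (rule tendstoD)
    with p[OF d(1)] have "frequently (\<lambda>t. dist p (\<gamma> t) < d \<and> dist (f (\<gamma> t)) (h b) < e) (at_left 1)"
      by (rule frequently_eventually_frequently)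
    then obtain t where t: "dist p (\<gamma> t) < d" "dist (f (\<gamma> t)) (h b) < e"
      by (auto dest: frequently_ex)
    have "dist (f p) (h b) < e + e"
      using d(2)[of "\<gamma> t"] t by (smt (verit) dist_commute dist_triangle)
    thus False by (simp add: e_def)
  qed
  have "deriv f p \<noteq> 0" using deriv_nonzero_off_singular_values nb fp by metis
  then obtain r \<phi> where r: "r > 0" "open (f ` ball p r)" "inj_on f (ball p r)"
    and \<phi>: "\<phi> holomorphic_on f ` ball p r" "\<And>z. z \<in> ball p r \<Longrightarrow> \<phi> (f z) = z"
    using local_inverse[OF f] by metis
  have "open (ball a d \<inter> h -` (f ` ball p r))"
    by (intro continuous_open_preimage holomorphic_on_imp_continuous_on h r) auto
  moreover have "b \<in> ball a d \<inter> h -` (f ` ball p r)"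
    using bd fp r(1) by (metis IntI centre_in_ball imageI vimageI)
  ultimately obtain e where e: "e > 0" "ball b e \<subseteq> ball a d \<inter> h -` (f ` ball p r)"
    using openE by blast
  define k where "k w = \<phi> (h w)" for w
  have k: "k holomorphic_on ball b e" unfolding k_def
    by (rule holomorphic_on_compose_gen[OF holomorphic_on_subset[OF h] \<phi>(1), unfolded o_def]) (use e in auto)
  have fk: "f (k w) = h w" "k w \<in> ball p r" if "w \<in> ball b e" for w
    using that e \<phi>(2) unfolding k_def by fastforce+
  \<comment> \<open>The path is known to be near \<open>p\<close> only frequently. A single such
    parameter is enough: it identifies \<open>g\<close> with the local inverse branch at one point,
    and \<open>lift_unique\<close> spreads this over the convex overlap.\<close>
  have "eventually (\<lambda>t. t \<in> {0..<1} \<and> dist (L t) b < e) (at_left 1)"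
    using ev01 tendstoD[OF Ll e(1)] by eventually_elim auto
  with p[OF r(1)] have "frequently (\<lambda>t. dist p (\<gamma> t) < r \<and> t \<in> {0..<1} \<and> dist (L t) b < e) (at_left 1)"
    by (rule frequently_eventually_frequently)
  then obtain t where t: "dist p (\<gamma> t) < r" "t \<in> {0..<1}" "dist (L t) b < e"
    by (auto dest: frequently_ex)
  have Lt: "L t \<in> ball b e \<inter> ball a R" using t L by (auto simp: dist_commute)
  have "k (L t) = g (L t)"
    using \<phi>(2)[of "\<gamma> t"] t fg[of "L t"] Lt unfolding k_def \<gamma>_def by auto
  moreover have "deriv f (k (L t)) \<noteq> 0"
    using holomorphic_injective_imp_regular[OF holomorphic_on_subset[OF f] open_ball r(3)] fk(2) Lt by auto
  moreover have "open (ball b e \<inter> ball a R)" "connected (ball b e \<inter> ball a R)"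
    by (auto intro: convex_connected convex_Int)
  moreover have "k holomorphic_on ball b e \<inter> ball a R" "g holomorphic_on ball b e \<inter> ball a R"
    using k g holomorphic_on_subset by blast+
  moreover have "f (k w) = f (g w)" if "w \<in> ball b e \<inter> ball a R" for w
    using fk(1) fg that by auto
  ultimately have "k w = g w" if "w \<in> ball b e \<inter> ball a R" for w
    using that lift_unique[OF _ _ _ _ f Lt] by blast
  thus ?thesis using e k by blast
qed

text \<open>Continuation in the radius: by uniqueness the lifts on smaller discs are compatible and
  glue on the disc of supremal radius, and if that radius were below \<open>d\<close> the lift would
  extend at every boundary point.\<close>

lemma lift_on_ball:
  assumes f: "f holomorphic_on UNIV" and h: "h holomorphic_on ball a d" and d: "0 < d"
    and ns: "\<And>w. w \<in> ball a d \<Longrightarrow> h w \<notin> singular_values f" and z0: "f z0 = h a"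
  obtains g where "g holomorphic_on ball a d" "g a = z0" "\<And>w. w \<in> ball a d \<Longrightarrow> f (g w) = h w"
proof -
  define P where "P R g \<longleftrightarrow> g holomorphic_on ball a R \<and> g a = z0 \<and> (\<forall>w\<in>ball a R. f (g w) = h w)" for R g
  define A where "A = {R. 0 < R \<and> R \<le> d \<and> (\<exists>g. P R g)}"
  have dz: "deriv f z0 \<noteq> 0" using ns[of a] z0 d deriv_nonzero_off_singular_values by auto
  have ne: "\<exists>R. R \<in> A"
  proof -
    obtain r \<phi> where r: "r > 0" "open (f ` ball z0 r)" "inj_on f (ball z0 r)"
      and \<phi>: "\<phi> holomorphic_on f ` ball z0 r" "\<And>z. z \<in> ball z0 r \<Longrightarrow> \<phi> (f z) = z"
      using local_inverse[OF f dz] by metis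
    have "open (ball a d \<inter> h -` (f ` ball z0 r))"
      by (intro continuous_open_preimage holomorphic_on_imp_continuous_on h r) auto
    moreover have "a \<in> ball a d \<inter> h -` (f ` ball z0 r)" using z0 r(1) d by (metis IntI centre_in_ball imageI vimageI)
    ultimately obtain e where e: "e > 0" "ball a e \<subseteq> ball a d \<inter> h -` (f ` ball z0 r)"
      using openE by blast
    define k where "k w = \<phi> (h w)" for w
    have k: "k holomorphic_on ball a e" unfolding k_def
      by (rule holomorphic_on_compose_gen[OF holomorphic_on_subset[OF h] \<phi>(1), unfolded o_def]) (use e in auto)
    have fk: "f (k w) = h w" if "w \<in> ball a e" for w
      using that e \<phi>(2) unfolding k_def by fastforce+
    have "k a = z0" unfolding k_def using z0 \<phi>(2)[of z0] r by simp
    moreover have "ball a (min e d) \<subseteq> ball a e" by (intro subset_ball) auto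
    ultimately have "P (min e d) k" unfolding P_def using k fk holomorphic_on_subset by blast
    thus ?thesis using e d unfolding A_def by (intro exI[of _ "min e d"]) auto
  qed
  have bdd: "bdd_above A" unfolding A_def by (rule bdd_aboveI[of _ d]) auto
  define S where "S = Sup A"
  have S: "0 < S" "S \<le> d"
  proof -
    obtain R where R: "R \<in> A" using ne by blast
    thus "0 < S" using cSup_upper[OF R bdd] unfolding S_def A_def by auto
    show "S \<le> d" unfolding S_def by (rule cSup_least) (use R in \<open>auto simp: A_def\<close>)
  qed
  have PS: "\<exists>g. P R g" if "R < S" for R
  proof -
    obtain R' where R': "R' \<in> A" "R < R'"
      using \<open>R < S\<close> ne less_cSup_iff[OF _ bdd, of R] unfolding S_def by blast
    then obtain g where "P R' g" unfolding A_def by auto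
    moreover have "ball a R \<subseteq> ball a R'" using R' by (intro subset_ball) auto
    ultimately have "P R g" unfolding P_def using holomorphic_on_subset by blast
    thus ?thesis by blast
  qed
  define G where "G R = (SOME g. P R g)" for R
  have G: "P R (G R)" if "R < S" for R
    unfolding G_def using someI_ex[OF PS[OF that]] .
  have coh: "G R w = G R' w" if "R \<le> R'" "R' < S" "w \<in> ball a R" for R R' w
  proof (rule lift_unique[of "ball a R" "G R" "G R'" f a])
    have "0 < R" using that(3) by (metis centre_in_ball ball_eq_empty empty_iff not_le)
    show "G R holomorphic_on ball a R" using G[of R] that P_def by auto
    show "G R' holomorphic_on ball a R"
      using G[OF that(2)] subset_ball[OF that(1), of a] holomorphic_on_subset unfolding P_def by blast
    show "G R a = G R' a" "deriv f (G R a) \<noteq> 0" using G[of R] G[of R'] that dz P_def by auto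
    show "f (G R w) = f (G R' w)" if "w \<in> ball a R" for w
      using G[of R] G[of R'] \<open>R \<le> R'\<close> \<open>R' < S\<close> that P_def by auto
    show "a \<in> ball a R" using \<open>0 < R\<close> by auto
  qed (use that(3) f in auto)
  \<comment> \<open>Any radius strictly between \<open>dist a w\<close> and \<open>S\<close> would
    do; the midpoint makes the choice explicit.\<close>
  define g where "g w = G ((dist a w + S) / 2) w" for w
  have gG: "g w = G R w" if "R < S" "w \<in> ball a R" for w R
  proof (cases "R \<le> (dist a w + S) / 2")
    case True thus ?thesis using coh[of R "(dist a w + S) / 2" w] that unfolding g_def by simp
  next
    case False thus ?thesis using coh[of "(dist a w + S) / 2" R w] that unfolding g_def by simp
  qed
  have PSg: "P S g"
  proof -
    have "g holomorphic_on (\<Union>R\<in>{..<S}. ball a R)"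
    proof (rule holomorphic_on_UN_open)
      fix R assume "R \<in> {..<S}"
      hence "R < S" by simp
      hence "G R holomorphic_on ball a R" using G P_def by auto
      thus "g holomorphic_on ball a R"
        by (rule holomorphic_transform) (use gG \<open>R < S\<close> in auto)
    qed auto
    moreover have "ball a S \<subseteq> (\<Union>R\<in>{..<S}. ball a R)"
    proof
      fix w assume "w \<in> ball a S"
      then obtain R where "dist a w < R" "R < S" using dense[of "dist a w" S] by auto
      thus "w \<in> (\<Union>R\<in>{..<S}. ball a R)" by auto
    qed
    ultimately have "g holomorphic_on ball a S" using holomorphic_on_subset by blast
    moreover have "g a = z0" using G[of "S/2"] S unfolding g_def P_def by auto
    moreover have "f (g w) = h w" if "w \<in> ball a S" for w
      using that G[of "(dist a w + S) / 2"] unfolding g_def P_def by auto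
    ultimately show ?thesis unfolding P_def by auto
  qed
  have "S = d"
  proof (rule ccontr)
    assume "S \<noteq> d"
    hence Sd: "S < d" using S by auto
    have gS: "g holomorphic_on ball a S" using PSg P_def by auto
    have loc: "\<exists>e h. e > 0 \<and> h holomorphic_on ball b e \<and> (\<forall>w\<in>ball b e \<inter> ball a S. h w = g w)"
      if "b \<in> sphere a S" for b
      by (rule lift_extends_at_boundary[OF f S(1) Sd gS h _ that]) (use PSg P_def that ns Sd in auto)
    obtain R' k where k: "R' > S" "k holomorphic_on ball a R'" "\<And>w. w \<in> ball a S \<Longrightarrow> k w = g w"
      using holomorphic_extend_beyond_ball[OF S(1) gS loc] by metis
    define T where "T = min R' d"
    have "f (k w) = h w" if "w \<in> ball a T" for w
    proof (rule analytic_continuation_open[of "ball a S" "ball a T" "\<lambda>w. f (k w)" h])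
      show "(\<lambda>w. f (k w)) holomorphic_on ball a T"
        by (rule holomorphic_on_compose_gen[OF _ f, unfolded o_def])
           (auto intro!: holomorphic_on_subset[OF k(2)] simp: T_def)
      show "h holomorphic_on ball a T" using h by (rule holomorphic_on_subset) (auto simp: T_def)
      show "f (k z) = h z" if "z \<in> ball a S" for z using that k PSg P_def by auto
      show "ball a S \<noteq> {}" "ball a S \<subseteq> ball a T" "w \<in> ball a T"
        using that S k T_def Sd by (auto intro!: subset_ball)
    qed auto
    moreover have "k holomorphic_on ball a T"
      by (rule holomorphic_on_subset[OF k(2)]) (simp add: T_def subset_ball)
    ultimately have "P T k" using k(3)[of a] S(1) PSg unfolding P_def by simp
    hence "T \<in> A" using S k Sd unfolding A_def T_def by auto
    hence "T \<le> S" unfolding S_def using bdd by (rule cSup_upper)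
    thus False using k Sd unfolding T_def by auto
  qed
  thus ?thesis using PSg that unfolding P_def by auto
qed

section \<open>Distortion of injective functions\<close>

text \<open>If the image contained the disc of radius 2, the inverse of \<open>g\<close> precomposed
  with doubling would map the unit disc to itself, fix 0 and have derivative 2 there, against the
  Schwarz lemma.\<close>

lemma injective_omits_value:
  assumes g: "g holomorphic_on ball 0 1" and inj: "inj_on g (ball 0 1)"
    and g0: "g 0 = 0" and g1: "deriv g 0 = 1"
  obtains w where "norm w < 2" "w \<noteq> 0" "w \<notin> g ` ball 0 (1::real)"
proof -
  have "\<not> ball 0 2 \<subseteq> g ` ball 0 1"
  proof
    assume sub: "ball 0 2 \<subseteq> g ` ball 0 1"
    obtain \<psi> where \<psi>: "\<psi> holomorphic_on g ` ball 0 1"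
      "\<And>z. z \<in> ball 0 1 \<Longrightarrow> deriv g z * deriv \<psi> (g z) = 1" "\<And>z. z \<in> ball 0 1 \<Longrightarrow> \<psi> (g z) = z"
      by (rule holomorphic_has_inverse[OF g open_ball inj]) blast
    have \<psi>2: "\<psi> holomorphic_on ball 0 2" using \<psi>(1) sub by (rule holomorphic_on_subset)
    define \<phi> where "\<phi> = (\<lambda>z. \<psi> (2 * z))"
    have "\<phi> holomorphic_on ball 0 1" unfolding \<phi>_def
      by (rule holomorphic_on_compose_gen[OF _ \<psi>2, unfolded o_def])
         (auto intro!: holomorphic_intros simp: norm_mult)
    moreover have "\<phi> 0 = 0" using \<psi>(3)[of 0] g0 by (simp add: \<phi>_def)
    moreover have "norm (\<phi> z) < 1" if "norm z < 1" for z
    proof -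
      have "2 * z \<in> g ` ball 0 1" using sub that by (auto simp: norm_mult)
      then obtain x where "x \<in> ball 0 1" "2 * z = g x" by auto
      thus ?thesis using \<psi>(3)[of x] by (simp add: \<phi>_def)
    qed
    ultimately have "norm (deriv \<phi> 0) \<le> 1" using Schwarz_Lemma(2)[of \<phi> 0] by simp
    moreover have "(\<phi> has_field_derivative deriv \<psi> (2 * 0) * 2) (at 0)" unfolding \<phi>_def
      by (rule DERIV_chain2[of \<psi>])
         (auto intro!: derivative_eq_intros holomorphic_derivI[OF \<psi>2])
    hence "deriv \<phi> 0 = deriv \<psi> 0 * 2" using DERIV_imp_deriv by fastforce
    moreover have "deriv \<psi> 0 = 1" using \<psi>(2)[of 0] g0 g1 by simp
    ultimately show False by simp
  qed
  then obtain w where "w \<in> ball 0 2" "w \<notin> g ` ball 0 1" by blast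
  moreover have "0 \<in> g ` ball 0 1" using g0 by (metis centre_in_ball imageI zero_less_one)
  ultimately show thesis using that[of w] by auto
qed

text \<open>An explicit, far from sharp substitute for the constant in Koebe's theorem. Schottky's
  bound for radius 1/2 and central value at most 1 has the inner exponent 2 + 2 + 12 = 16, which
  gives \<open>M = exp (pi * exp (pi * 16))\<close>. Then \<open>g\<close> is at most
  \<open>2 * (1 + M ^ 2)\<close> on the disc of radius 1/4, and Cauchy's estimate multiplies this by
  2! and by 16.\<close>

definition koebe_const :: real where
  "koebe_const = 64 * (1 + (exp (pi * exp (pi * 16)))\<^sup>2)"

lemma koebe_const_ge: "koebe_const \<ge> 1"
  unfolding koebe_const_def by (simp add: distrib_left add_increasing2)

text \<open>If \<open>g\<close> omits \<open>w\<close>, the square root of \<open>1 - g / w\<close> with value \<open>1\<close> at the centre omits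
  \<open>0\<close> and, by injectivity of \<open>g\<close>, also \<open>- 1\<close>, so Schottky's theorem bounds it.\<close>

lemma second_deriv_bound_normalized:
  assumes g: "g holomorphic_on ball 0 1" and inj: "inj_on g (ball 0 1)"
    and g0: "g 0 = 0" and g1: "deriv g 0 = 1"
  shows "norm (deriv (deriv g) 0) \<le> koebe_const"
proof -
  obtain w where w: "norm w < 2" "w \<noteq> 0" "w \<notin> g ` ball 0 1"
    using injective_omits_value[OF assms] by blast
  have nz: "1 - g z / w \<noteq> 0" if "z \<in> ball 0 1" for z
    using w that by (auto simp: field_simps)
  have "(\<lambda>z. 1 - g z / w) holomorphic_on ball 0 1"
    using g w by (intro holomorphic_intros) auto
  then obtain L where L: "L holomorphic_on ball 0 1" "\<And>z. z \<in> ball 0 1 \<Longrightarrow> exp (L z) = 1 - g z / w"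
    using holomorphic_logarithm_exists[of "ball 0 1" "\<lambda>z. 1 - g z / w" 0] nz by auto
  define h where "h z = exp ((L z - L 0) / 2)" for z
  have h0: "h 0 = 1" by (simp add: h_def)
  have h2: "(h z)\<^sup>2 = 1 - g z / w" if "z \<in> ball 0 1" for z
  proof -
    have "(h z)\<^sup>2 = exp (L z) / exp (L 0)"
      unfolding h_def by (simp add: power2_eq_square flip: exp_add exp_diff)
    also have "exp (L 0) = 1" using L(2)[of 0] g0 by simp
    finally show ?thesis using L(2)[OF that] by simp
  qed
  \<comment> \<open>The sign turns the omitted value -1 into 1, as Schottky's theorem requires; the
    factor 1/2 makes the function holomorphic on the closed unit disc.\<close>
  define p where "p z = - h (z / 2)" for z
  define M where "M = exp (pi * exp (pi * 16))"
  have half: "z / 2 \<in> ball 0 1" if "z \<in> cball 0 1" for z :: complex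
    using that by (auto simp: norm_divide)
  have p: "p holomorphic_on cball 0 1" unfolding p_def h_def
    by (intro holomorphic_intros holomorphic_on_compose_gen[OF _ L(1), unfolded o_def])
       (use half in auto)
  have bound: "norm (p z) \<le> M" if "norm z \<le> 1/2" for z
  proof -
    have "norm (p z) \<le> exp (pi * exp (pi * (2 + 2 * 1 + 12 * (1/2) / (1 - 1/2))))"
    proof (rule Schottky[OF p])
      show "norm (p 0) \<le> 1" using h0 by (simp add: p_def)
      show "\<not> (p z = 0 \<or> p z = 1)" if "z \<in> cball 0 1" for z
      proof -
        have False if "p z = 1"
        proof -
          have "h (z / 2) = -1" using \<open>p z = 1\<close> by (simp add: p_def minus_equation_iff)
          hence "g (z / 2) = g 0" using h2[OF half[OF \<open>z \<in> cball 0 1\<close>]] w g0 by auto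
          hence "z / 2 = 0" using inj half[OF \<open>z \<in> cball 0 1\<close>] by (auto dest: inj_onD)
          hence "p z = -1" using h0 by (simp add: p_def)
          thus False using \<open>p z = 1\<close> by simp
        qed
        thus ?thesis by (auto simp: p_def h_def)
      qed
    qed (use that in auto)
    thus ?thesis by (simp add: M_def)
  qed
  have gb: "norm (g z) \<le> 2 * (1 + M\<^sup>2)" if "norm z \<le> 1/4" for z
  proof -
    have "norm (h z) \<le> M" using bound[of "2 * z"] that by (simp add: p_def norm_mult)
    hence "norm ((h z)\<^sup>2) \<le> M\<^sup>2" by (simp add: norm_power power_mono)
    moreover have "g z = w * (1 - (h z)\<^sup>2)" using h2[of z] w that by (simp add: field_simps)
    moreover have "norm (1 - (h z)\<^sup>2) \<le> 1 + norm ((h z)\<^sup>2)" by (metis norm_one norm_triangle_ineq4)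
    ultimately have "norm (1 - (h z)\<^sup>2) \<le> 1 + M\<^sup>2" by linarith
    hence "norm w * norm (1 - (h z)\<^sup>2) \<le> 2 * (1 + M\<^sup>2)" using w(1) by (intro mult_mono) auto
    thus ?thesis using \<open>g z = w * (1 - (h z)\<^sup>2)\<close> by (simp add: norm_mult)
  qed
  have "norm ((deriv ^^ 2) g 0) \<le> fact 2 * (2 * (1 + M\<^sup>2)) / (1/4)^2"
  proof (rule Cauchy_inequality)
    show "g holomorphic_on ball 0 (1/4)" using g by (rule holomorphic_on_subset) auto
    show "continuous_on (cball 0 (1/4)) g"
      using g by (rule holomorphic_on_imp_continuous_on[OF holomorphic_on_subset]) auto
  qed (use gb in auto)
  thus ?thesis by (simp add: eval_nat_numeral koebe_const_def M_def)
qed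

lemma second_deriv_bound:
  assumes g: "g holomorphic_on ball c r" and r: "r > 0" and inj: "inj_on g (ball c r)"
  shows "norm (deriv (deriv g) c) \<le> koebe_const / r * norm (deriv g c)"
proof -
  have g1: "deriv g c \<noteq> 0"
    using holomorphic_injective_imp_regular[OF g open_ball inj, of c] r by simp
  define D where "D = of_real r * deriv g c"
  have D: "D \<noteq> 0" using g1 r by (simp add: D_def)
  define s where "s z = c + of_real r * z" for z
  have s: "s z \<in> ball c r" if "z \<in> ball 0 1" for z
    using that r by (auto simp: s_def dist_norm norm_mult)
  have hs: "s holomorphic_on S" for S unfolding s_def by (intro holomorphic_intros)
  define G where "G z = (g (s z) - g c) / D" for z
  have gs: "(\<lambda>z. g (s z)) holomorphic_on ball 0 1"
    by (rule holomorphic_on_compose_gen[OF hs g, unfolded o_def]) (use s in auto)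
  have hG: "G holomorphic_on ball 0 1" unfolding G_def
    using D by (intro holomorphic_intros gs) auto
  have ds: "(s has_field_derivative of_real r) (at z)" for z
    unfolding s_def by (auto intro!: derivative_eq_intros)
  have dG: "(G has_field_derivative deriv g (s z) / deriv g c) (at z)" if "z \<in> ball 0 1" for z
  proof -
    have "((\<lambda>z. g (s z)) has_field_derivative deriv g (s z) * of_real r) (at z)"
      by (rule DERIV_chain2[OF holomorphic_derivI[OF g open_ball s[OF that]] ds])
    hence "(G has_field_derivative (deriv g (s z) * of_real r) / D) (at z)"
      unfolding G_def using D by (auto intro!: derivative_eq_intros)
    thus ?thesis using r by (simp add: D_def)
  qed
  have "norm (deriv (deriv G) 0) \<le> koebe_const"
  proof (rule second_deriv_bound_normalized[OF hG])
    show "inj_on G (ball 0 1)"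
    proof (rule inj_onI)
      fix x y assume xy: "x \<in> ball 0 1" "y \<in> ball 0 1" "G x = G y"
      hence "g (s x) = g (s y)" using D by (simp add: G_def)
      hence "s x = s y" using inj s xy by (auto dest: inj_onD)
      thus "x = y" using r by (simp add: s_def)
    qed
    show "G 0 = 0" by (simp add: G_def s_def)
    show "deriv G 0 = 1" using DERIV_imp_deriv[OF dG[of 0]] g1 by (simp add: s_def)
  qed
  moreover have "deriv (deriv G) 0 = deriv (deriv g) c * of_real r / deriv g c"
  proof -
    have g': "deriv g holomorphic_on ball c r" using g by (intro holomorphic_deriv) auto
    have "((\<lambda>z. deriv g (s z)) has_field_derivative deriv (deriv g) (s 0) * of_real r) (at 0)"
      by (rule DERIV_chain2[OF holomorphic_derivI[OF g' open_ball s] ds]) simp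
    hence "((\<lambda>z. deriv g (s z) / deriv g c) has_field_derivative deriv (deriv g) c * of_real r / deriv g c) (at 0)"
      using g1 by (auto intro!: derivative_eq_intros simp: s_def)
    hence "(deriv G has_field_derivative deriv (deriv g) c * of_real r / deriv g c) (at 0)"
      by (rule has_field_derivative_transform_within_open[of _ _ _ "ball 0 1"])
         (use DERIV_imp_deriv[OF dG] in auto)
    thus ?thesis by (rule DERIV_imp_deriv)
  qed
  ultimately show ?thesis using r g1 by (simp add: norm_mult norm_divide field_simps)
qed

text \<open>The quotient of the second and the first derivative is the derivative of
  \<open>log g'\<close>, and injectivity on discs of radius \<eta> bounds it, so it can be
  integrated along segments even where \<open>g\<close> is not globally injective. Writing the ratio
  of derivatives as \<open>exp u\<close> controls its modulus from both sides and its argument at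
  once.\<close>

lemma locally_injective_distortion:
  assumes g: "g holomorphic_on ball c d" and \<eta>: "0 < \<eta>" "\<eta> < d"
    and inj: "\<And>w. w \<in> ball c (d - \<eta>) \<Longrightarrow> inj_on g (ball w \<eta>)"
    and w: "w \<in> ball c (d - \<eta>)" and v: "v \<in> ball c (d - \<eta>)"
  shows "deriv g v \<noteq> 0 \<and> (\<exists>u. deriv g w = deriv g v * exp u \<and> norm u \<le> koebe_const / \<eta> * dist w v)"
proof -
  let ?B = "ball c (d - \<eta>)"
  have sub: "ball w \<eta> \<subseteq> ball c d" if "w \<in> ?B" for w
  proof
    fix x assume "x \<in> ball w \<eta>"
    thus "x \<in> ball c d" using that dist_triangle[of c x w] by auto
  qed
  have nz: "deriv g w \<noteq> 0" if "w \<in> ?B" for w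
    using holomorphic_injective_imp_regular[OF holomorphic_on_subset[OF g sub[OF that]] open_ball inj[OF that], of w] \<eta>
    by simp
  have Bd: "?B \<subseteq> ball c d" using \<eta> by (intro subset_ball) auto
  have g': "deriv g holomorphic_on ?B"
    using holomorphic_deriv[OF g open_ball] Bd by (rule holomorphic_on_subset)
  obtain L where L: "L holomorphic_on ?B" "\<And>z. z \<in> ?B \<Longrightarrow> exp (L z) = deriv g z"
    using holomorphic_logarithm_exists[OF convex_ball open_ball g' nz v] by metis
  have dL: "(L has_field_derivative deriv (deriv g) z / deriv g z) (at z)" if z: "z \<in> ?B" for z
  proof -
    have "(L has_field_derivative deriv L z) (at z)" by (rule holomorphic_derivI[OF L(1) open_ball z])
    moreover from this have "((\<lambda>z. exp (L z)) has_field_derivative exp (L z) * deriv L z) (at z)"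
      by (auto intro!: derivative_eq_intros)
    hence "(deriv g has_field_derivative exp (L z) * deriv L z) (at z)"
      by (rule has_field_derivative_transform_within_open[of _ _ _ ?B]) (use L z in auto)
    hence "deriv (deriv g) z = deriv g z * deriv L z" using L(2)[OF z] DERIV_imp_deriv by metis
    ultimately show ?thesis using nz[OF z] by simp
  qed
  have "norm (L w - L v) \<le> koebe_const / \<eta> * norm (w - v)"
  proof (rule field_differentiable_bound[of ?B])
    show "(L has_field_derivative deriv (deriv g) z / deriv g z) (at z within ?B)" if "z \<in> ?B" for z
      using dL[OF that] by (rule has_field_derivative_at_within)
    show "norm (deriv (deriv g) z / deriv g z) \<le> koebe_const / \<eta>" if "z \<in> ?B" for z
      using second_deriv_bound[OF holomorphic_on_subset[OF g sub[OF that]] \<eta>(1) inj[OF that]] nz[OF that]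
      using \<eta>(1) by (simp add: norm_divide divide_simps)
  qed (use w v in auto)
  moreover have "deriv g w = deriv g v * exp (L w - L v)"
    using L(2)[OF w] L(2)[OF v] nz[OF v] by (simp add: exp_diff)
  ultimately show ?thesis using nz[OF v] by (auto simp: dist_norm)
qed

lemma norm_exp_minus_one_le:
  fixes u :: complex assumes "norm u \<le> 1/4" shows "norm (exp u - 1) \<le> 1/2"
proof -
  have "norm (exp u - exp 0) \<le> 2 * norm (u - 0)"
  proof (rule field_differentiable_bound[of "cball 0 (1/4)"])
    show "norm (exp z) \<le> 2" if "z \<in> cball 0 (1/4)" for z :: complex
      using that exp_bound_lemma[of z] by auto
  qed (use assms in \<open>auto intro!: derivative_eq_intros\<close>)
  thus ?thesis using assms by simp
qed

text \<open>On \<open>T\<close> the distortion exponent is at most 1/4; this fixes the radius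
  \<open>\<eta> / (4 * koebe_const)\<close>. Then \<open>g'\<close> differs from
  \<open>deriv g b\<close> by at most half of its size, and subtracting the linear map leaves a
  perturbation with half its Lipschitz constant.\<close>

lemma locally_injective_expansion:
  assumes g: "g holomorphic_on ball c d" and \<eta>: "0 < \<eta>" "\<eta> < d"
    and inj: "\<And>w. w \<in> ball c (d - \<eta>) \<Longrightarrow> inj_on g (ball w \<eta>)"
    and b: "b \<in> ball c (d - \<eta>)"
    and T: "convex T" "T \<subseteq> ball c (d - \<eta>)" "T \<subseteq> cball b (\<eta> / (4 * koebe_const))"
    and x: "x \<in> T" and y: "y \<in> T"
  shows "norm (g x - g y) \<ge> norm (deriv g b) / 2 * norm (x - y)"
proof -
  let ?h = "\<lambda>z. g z - deriv g b * z"
  have "norm (?h x - ?h y) \<le> norm (deriv g b) / 2 * norm (x - y)"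
  proof (rule field_differentiable_bound[OF T(1)])
    fix z assume z: "z \<in> T"
    have zd: "z \<in> ball c d" using z T \<eta> subset_ball[of "d - \<eta>" d c] by auto
    show "(?h has_field_derivative deriv g z - deriv g b) (at z within T)"
      by (rule has_field_derivative_at_within)
        (auto intro!: derivative_eq_intros holomorphic_derivI[OF g open_ball zd])
    obtain u where u: "deriv g z = deriv g b * exp u" "norm u \<le> koebe_const / \<eta> * dist z b"
      using locally_injective_distortion[OF g \<eta> inj _ b, of z] z T by blast
    have "dist z b \<le> \<eta> / (4 * koebe_const)" using z T(3) by (auto simp: dist_commute)
    hence "koebe_const / \<eta> * dist z b \<le> koebe_const / \<eta> * (\<eta> / (4 * koebe_const))"
      using \<eta> koebe_const_ge by (intro mult_left_mono) auto
    also have "\<dots> = 1/4" using \<eta> koebe_const_ge by simp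
    finally have "norm (exp u - 1) \<le> 1/2" using u(2) norm_exp_minus_one_le[of u] by linarith
    moreover have "deriv g z - deriv g b = deriv g b * (exp u - 1)" using u(1) by (simp add: algebra_simps)
    ultimately show "norm (deriv g z - deriv g b) \<le> norm (deriv g b) / 2"
      using mult_left_mono[of "norm (exp u - 1)" "1/2" "norm (deriv g b)"] by (simp add: norm_mult)
  qed (use x y in auto)
  moreover have "norm (deriv g b * (x - y)) \<le> norm (g x - g y) + norm (?h x - ?h y)"
  proof -
    have "deriv g b * (x - y) = (g x - g y) - (?h x - ?h y)" by (simp add: algebra_simps)
    thus ?thesis by (metis norm_triangle_ineq4)
  qed
  ultimately show ?thesis by (simp add: norm_mult)
qed

section \<open>Covering arguments\<close>

lemma emeasure_lebesgue_cball_complex: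
  "r \<ge> 0 \<Longrightarrow> emeasure lebesgue (cball (c::complex) r) = ennreal (pi * r\<^sup>2)"
  by (simp add: emeasure_cball unit_ball_vol_2)

text \<open>The summation common to both Vitali arguments below. By convention
  \<open>emeasure\<close> is 0 on a non-measurable \<open>S\<close>, so the bound carries
  information only for measurable sets.\<close>

lemma emeasure_countable_cover_le:
  assumes C: "countable C" and A: "\<And>i. i \<in> C \<Longrightarrow> A i \<in> sets M" and B: "\<And>i. i \<in> C \<Longrightarrow> B i \<in> sets M"
    and Y: "Y \<in> sets M" and disj: "disjoint_family_on B C"
    and S: "S \<subseteq> (\<Union>i\<in>C. A i)" and BY: "\<And>i. i \<in> C \<Longrightarrow> B i \<subseteq> Y"
    and le: "\<And>i. i \<in> C \<Longrightarrow> emeasure M (A i) \<le> ennreal k * emeasure M (B i)"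
  shows "emeasure M S \<le> ennreal k * emeasure M Y"
proof (cases "C = {}")
  case True thus ?thesis using S by simp
next
  case False
  \<comment> \<open>For finite \<open>C\<close> the enumeration \<open>from_nat_into\<close> repeats
    elements; assigning the empty set to the surplus indices preserves disjointness.\<close>
  define A' where "A' n = (if n \<in> to_nat_on C ` C then A (from_nat_into C n) else {})" for n
  define B' where "B' n = (if n \<in> to_nat_on C ` C then B (from_nat_into C n) else {})" for n
  have fi: "from_nat_into C n \<in> C" for n using False by (rule from_nat_into)
  have S': "S \<subseteq> (\<Union>n. A' n)"
  proof
    fix x assume "x \<in> S"
    then obtain i where "i \<in> C" "x \<in> A i" using S by auto
    hence "x \<in> A' (to_nat_on C i)" using C by (auto simp: A'_def)
    thus "x \<in> (\<Union>n. A' n)" by blast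
  qed
  have A': "A' n \<in> sets M" "B' n \<in> sets M" "B' n \<subseteq> Y" for n
    using A B BY fi by (auto simp: A'_def B'_def)
  have le': "emeasure M (A' n) \<le> ennreal k * emeasure M (B' n)" for n
    using le fi by (auto simp: A'_def B'_def)
  have disj': "disjoint_family B'"
    unfolding disjoint_family_on_def
  proof (intro ballI impI)
    fix m n :: nat assume "m \<noteq> n"
    thus "B' m \<inter> B' n = {}"
      using disj C unfolding B'_def disjoint_family_on_def by (auto simp: image_iff) blast
  qed
  have "emeasure M S \<le> emeasure M (\<Union>n. A' n)" using S' A' by (intro emeasure_mono) auto
  also have "\<dots> \<le> (\<Sum>n. emeasure M (A' n))" using A' by (intro emeasure_subadditive_countably) auto
  also have "\<dots> \<le> (\<Sum>n. ennreal k * emeasure M (B' n))" using le' by (intro suminf_le) auto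
  also have "\<dots> = ennreal k * (\<Sum>n. emeasure M (B' n))" by simp
  also have "(\<Sum>n. emeasure M (B' n)) = emeasure M (\<Union>n. B' n)"
    using A' disj' by (intro suminf_emeasure) auto
  also have "ennreal k * \<dots> \<le> ennreal k * emeasure M Y"
    using A' Y by (intro mult_left_mono emeasure_mono) auto
  finally show ?thesis .
qed

text \<open>A disjoint Vitali subfamily whose fivefold enlargements cover \<open>A\<close>: the
  enlarged discs have total area at most \<open>25 * pi / c\<close> times the mass of
  \<open>G\<close> in the disjoint ones. The common bound \<open>K\<close> on the radii is needed
  for Vitali's lemma and confines everything to one disc.\<close>

lemma emeasure_le_of_proportional_balls:
  fixes A G :: "complex set"
  assumes A: "A \<subseteq> cball 0 M" and G: "G \<in> sets lebesgue" and c: "c > 0"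
    and dense: "\<And>z. z \<in> A \<Longrightarrow> \<exists>\<rho>. 0 < \<rho> \<and> \<rho> \<le> K \<and> c * \<rho>\<^sup>2 \<le> measure lebesgue (G \<inter> cball z \<rho>)"
  shows "emeasure lebesgue A \<le> ennreal (25 * pi / c) * emeasure lebesgue (G \<inter> cball 0 (M + K))"
proof -
  obtain \<rho> where \<rho>: "\<And>z. z \<in> A \<Longrightarrow> 0 < \<rho> z \<and> \<rho> z \<le> K"
    and big: "\<And>z. z \<in> A \<Longrightarrow> c * (\<rho> z)\<^sup>2 \<le> measure lebesgue (G \<inter> cball z (\<rho> z))"
    using dense by metis
  have cov: "A \<subseteq> (\<Union>i\<in>A. cball i (\<rho> i))" using \<rho> by (force simp: less_imp_le)
  obtain C where C: "countable C" "C \<subseteq> A"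
    "pairwise (\<lambda>i j. disjnt (cball i (\<rho> i)) (cball j (\<rho> j))) C" "A \<subseteq> (\<Union>i\<in>C. cball i (5 * \<rho> i))"
    by (rule Vitali_covering_lemma_cballs[OF cov \<rho>]) blast
  show ?thesis
  proof (rule emeasure_countable_cover_le[OF C(1), where A="\<lambda>i. cball i (5 * \<rho> i)" and B="\<lambda>i. G \<inter> cball i (\<rho> i)"])
    show "disjoint_family_on (\<lambda>i. G \<inter> cball i (\<rho> i)) C"
      using C(3) unfolding disjoint_family_on_def pairwise_def disjnt_def by blast
    fix i assume i: "i \<in> C"
    hence iA: "i \<in> A" using C by auto
    show "G \<inter> cball i (\<rho> i) \<subseteq> G \<inter> cball 0 (M + K)"
    proof -
      have "norm i \<le> M" using A iA by auto
      hence "cball i (\<rho> i) \<subseteq> cball 0 (M + K)" using \<rho>[OF iA] by (intro cball_subset_cball_iff[THEN iffD2]) auto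
      thus ?thesis by blast
    qed
    have fin: "emeasure lebesgue (G \<inter> cball i (\<rho> i)) < \<infinity>"
    proof -
      have "emeasure lebesgue (G \<inter> cball i (\<rho> i)) \<le> emeasure lebesgue (cball i (\<rho> i))"
        by (intro emeasure_mono) auto
      also have "\<dots> < \<infinity>" using \<rho>[OF iA] by (subst emeasure_lebesgue_cball_complex) auto
      finally show ?thesis .
    qed
    have "emeasure lebesgue (cball i (5 * \<rho> i)) = ennreal (pi * (5 * \<rho> i)\<^sup>2)"
      using \<rho>[OF iA] by (intro emeasure_lebesgue_cball_complex) auto
    also have "\<dots> = ennreal (25 * pi / c * (c * (\<rho> i)\<^sup>2))"
      using c by (simp add: power_mult_distrib)
    also have "\<dots> \<le> ennreal (25 * pi / c * measure lebesgue (G \<inter> cball i (\<rho> i)))"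
      using c big[OF iA] by (intro ennreal_leI mult_left_mono) auto
    also have "\<dots> = ennreal (25 * pi / c) * emeasure lebesgue (G \<inter> cball i (\<rho> i))"
      using c fin by (subst ennreal_mult') (auto simp: emeasure_eq_ennreal_measure)
    finally show "emeasure lebesgue (cball i (5 * \<rho> i)) \<le> \<dots>" .
  qed (use G C in auto)
qed

text \<open>Replaces the change of variables formula. The open image is covered by small discs
  inside it; as \<open>g\<close> expands distances by at least \<mu>, the preimage of a fivefold
  enlarged disc of radius \<open>r\<close> lies in a disc of radius
  \<open>5 * r / \<mu>\<close>.\<close>

lemma emeasure_expanding_image:
  fixes S :: "complex set" and g :: "complex \<Rightarrow> complex"
  assumes gS: "open (g ` S)" and lam: "\<mu> > 0"
    and ex: "\<And>x y. x \<in> S \<Longrightarrow> y \<in> S \<Longrightarrow> \<mu> * norm (x - y) \<le> norm (g x - g y)"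
  shows "emeasure lebesgue S \<le> ennreal (25 / \<mu>\<^sup>2) * emeasure lebesgue (g ` S)"
proof -
  have "\<exists>r. 0 < r \<and> r \<le> 1 \<and> cball (g x) r \<subseteq> g ` S" if x: "x \<in> S" for x
  proof -
    obtain e where e: "e > 0" "cball (g x) e \<subseteq> g ` S"
      using gS x open_contains_cball by blast
    have "cball (g x) (min e 1) \<subseteq> cball (g x) e" by (rule subset_cball) simp
    thus ?thesis using e by (intro exI[of _ "min e 1"]) auto
  qed
  then obtain r where r: "\<And>x. x \<in> S \<Longrightarrow> 0 < r x \<and> r x \<le> 1" and rg: "\<And>x. x \<in> S \<Longrightarrow> cball (g x) (r x) \<subseteq> g ` S"
    by metis
  have cov: "g ` S \<subseteq> (\<Union>x\<in>S. cball (g x) (r x))" using r by (force simp: less_imp_le)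
  obtain C where C: "countable C" "C \<subseteq> S"
    "pairwise (\<lambda>i j. disjnt (cball (g i) (r i)) (cball (g j) (r j))) C" "g ` S \<subseteq> (\<Union>i\<in>C. cball (g i) (5 * r i))"
    by (rule Vitali_covering_lemma_cballs[OF cov r]) blast
  show ?thesis
  proof (rule emeasure_countable_cover_le[OF C(1), where A="\<lambda>i. cball i (5 * r i / \<mu>)" and B="\<lambda>i. cball (g i) (r i)"])
    show "disjoint_family_on (\<lambda>i. cball (g i) (r i)) C"
      using C(3) unfolding disjoint_family_on_def pairwise_def disjnt_def by blast
    show "S \<subseteq> (\<Union>i\<in>C. cball i (5 * r i / \<mu>))"
    proof
      fix x assume x: "x \<in> S"
      then obtain i where i: "i \<in> C" "g x \<in> cball (g i) (5 * r i)" using C(4) by blast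
      hence "\<mu> * norm (i - x) \<le> 5 * r i" using ex[of i x] x C(2) by (auto simp: dist_norm)
      hence "x \<in> cball i (5 * r i / \<mu>)" using lam by (simp add: dist_norm field_simps)
      thus "x \<in> (\<Union>i\<in>C. cball i (5 * r i / \<mu>))" using i by blast
    qed
    fix i assume "i \<in> C"
    hence i: "0 < r i" using r C by auto
    show "emeasure lebesgue (cball i (5 * r i / \<mu>)) \<le> ennreal (25 / \<mu>\<^sup>2) * emeasure lebesgue (cball (g i) (r i))"
      using i lam by (subst (1 2) emeasure_lebesgue_cball_complex)
        (auto simp: power_mult_distrib power_divide mult_ac simp flip: ennreal_mult')
  qed (use gS rg C in auto)
qed

text \<open>Fubini in the coordinates Re and Im: the image of the product measure is recognised as
  \<open>lborel\<close> by its values on boxes.\<close>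

lemma emeasure_lborel_complex:
  assumes [measurable]: "A \<in> sets borel"
  shows "emeasure lborel A = (\<integral>\<^sup>+x. emeasure lborel {y. Complex x y \<in> A} \<partial>lborel)"
proof -
  have m [measurable]: "(\<lambda>p::real \<times> real. Complex (fst p) (snd p)) \<in> borel_measurable borel"
    unfolding Complex_eq by (intro borel_measurable_continuous_onI continuous_intros)
  have eq: "lborel = distr (lborel \<Otimes>\<^sub>M lborel) borel (\<lambda>p. Complex (fst p) (snd p))"
  proof (rule lborel_eqI)
    fix l u :: complex assume le: "\<And>b. b \<in> Basis \<Longrightarrow> l \<bullet> b \<le> u \<bullet> b"
    have "Re l \<le> Re u" "Im l \<le> Im u" using le[of 1] le[of \<i>] by (auto simp: Basis_complex_def)
    moreover have "(\<lambda>p. Complex (fst p) (snd p)) -` box l u \<inter> space (lborel \<Otimes>\<^sub>M lborel) =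
        {Re l<..<Re u} \<times> {Im l<..<Im u}"
      by (auto simp: box_def Basis_complex_def space_pair_measure)
    moreover have "emeasure (lborel \<Otimes>\<^sub>M lborel) ({Re l<..<Re u} \<times> {Im l<..<Im u}) =
        emeasure lborel {Re l<..<Re u} * emeasure lborel {Im l<..<Im u}"
      by (rule lborel.emeasure_pair_measure_Times) auto
    ultimately show "emeasure (distr (lborel \<Otimes>\<^sub>M lborel) borel (\<lambda>p. Complex (fst p) (snd p))) (box l u)
        = ennreal (\<Prod>b\<in>Basis. (u - l) \<bullet> b)"
      by (subst emeasure_distr)
         (auto simp: Basis_complex_def ennreal_mult' lborel_prod intro!: measurable_lborel1 m)
  qed simp
  let ?D = "{p. Complex (fst p) (snd p) \<in> A}"
  have m2: "(\<lambda>p. Complex (fst p) (snd p)) \<in> borel_measurable (lborel \<Otimes>\<^sub>M lborel)"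
    using m by (simp add: lborel_prod)
  have "?D \<in> sets (lborel \<Otimes>\<^sub>M lborel)"
    using measurable_sets[OF m2 assms] by (simp add: vimage_def space_pair_measure)
  hence "emeasure (lborel \<Otimes>\<^sub>M lborel) ?D = (\<integral>\<^sup>+x. emeasure lborel (Pair x -` ?D) \<partial>lborel)"
    by (rule lborel.emeasure_pair_measure_alt)
  thus ?thesis using emeasure_distr[OF m2 assms]
    by (subst eq) (simp add: vimage_def space_pair_measure)
qed

text \<open>The disc is cut into finitely many pieces on each of which \<open>g\<close> expands at a
  rate comparable to \<open>deriv g c\<close>. The cover is chosen around 0 and translated by
  \<open>c\<close>, so that \<open>K\<close> depends on \<eta> and \<open>d\<close> only. Images of
  different pieces may overlap, which costs at most the number of pieces.\<close>

lemma locally_injective_image_measure: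
  assumes \<eta>: "0 < \<eta>" "\<eta> < d"
  shows "\<exists>K\<ge>1. \<forall>c g S G. g holomorphic_on ball c d \<longrightarrow>
      (\<forall>w\<in>ball c (d - \<eta>). inj_on g (ball w \<eta>)) \<longrightarrow> open S \<longrightarrow> S \<subseteq> ball c (d - \<eta>) \<longrightarrow>
      G \<in> sets lebesgue \<longrightarrow> g ` S \<subseteq> G \<longrightarrow>
      (norm (deriv g c))\<^sup>2 * measure lebesgue S
        \<le> K * measure lebesgue (G \<inter> cball (g c) (K * norm (deriv g c)))"
proof -
  define k where "k = koebe_const"
  have k: "k \<ge> 1" using koebe_const_ge by (simp add: k_def)
  \<comment> \<open>Two points of a disc of radius \<open>e\<close> are at most
    \<open>\<eta> / (4 * k)\<close> apart, the range of
    \<open>locally_injective_expansion\<close>.\<close>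
  define e where "e = \<eta> / (8 * k)"
  have e: "e > 0" using \<eta> k by (simp add: e_def)
  define E where "E = exp (k / \<eta> * d)"
  have E: "E \<ge> 1" using \<eta> k by (simp add: E_def)
  have "cball 0 (d - \<eta>) \<subseteq> (\<Union>b\<in>cball (0::complex) (d - \<eta>). ball b e)" using e by force
  then obtain B where B: "finite B" "cball 0 (d - \<eta>) \<subseteq> (\<Union>b\<in>B. ball (b::complex) e)"
    by (rule compactE_image[OF compact_cball open_ball]) blast
  \<comment> \<open>The first entry bounds the displacement \<open>norm (g w - g c)\<close> in units
    of \<open>norm (deriv g c)\<close>. The second is the number of pieces times
    \<open>25 / \<mu> ^ 2\<close> in the same units, where the expansion rate is
    \<open>norm (deriv g c) / (2 * E)\<close>.\<close>
  define K where "K = max (d * E) (real (card B) * (100 * E\<^sup>2)) + 1"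
  have "0 \<le> d * E" using \<eta> E by auto
  hence K: "K \<ge> 1" "K \<ge> d * E" "K \<ge> real (card B) * (100 * E\<^sup>2)"
    unfolding K_def by (auto simp: max.coboundedI1)
  show ?thesis
  proof (intro exI[of _ K] conjI K(1) allI impI)
    fix c g S G
    assume g: "g holomorphic_on ball c d"
      and inj': "\<forall>w\<in>ball c (d - \<eta>). inj_on g (ball w \<eta>)"
      and S: "open S" "S \<subseteq> ball c (d - \<eta>)" and G: "G \<in> sets lebesgue" "g ` S \<subseteq> G"
    note inj = inj'[rule_format]
    let ?B = "ball c (d - \<eta>)" and ?D = "norm (deriv g c)"
    define Y where "Y = G \<inter> cball (g c) (K * ?D)"
    have c: "c \<in> ?B" using \<eta> by simp
    have Bd: "?B \<subseteq> ball c d" using \<eta> by (intro subset_ball) auto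
    have bounds: "norm (deriv g w) \<le> E * ?D" "?D / E \<le> norm (deriv g w)" if w: "w \<in> ?B" for w
    proof -
      obtain u where u: "deriv g w = deriv g c * exp u" "norm u \<le> k / \<eta> * dist w c"
        using locally_injective_distortion[OF g \<eta> inj w c] unfolding k_def by blast
      have "dist w c \<le> d" using w \<eta> by (auto simp: dist_commute)
      hence "k / \<eta> * dist w c \<le> k / \<eta> * d" using \<eta> k by (intro mult_left_mono) auto
      hence nu: "norm u \<le> k / \<eta> * d" using u(2) by linarith
      have "Re u \<le> k / \<eta> * d" "- (k / \<eta> * d) \<le> Re u" using abs_Re_le_cmod[of u] nu by linarith+
      hence ex: "norm (exp u) \<le> E" "1 / E \<le> norm (exp u)"
        by (auto simp: E_def exp_minus inverse_eq_divide[symmetric] simp flip: exp_minus)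
      show "norm (deriv g w) \<le> E * ?D" "?D / E \<le> norm (deriv g w)"
        using mult_left_mono[OF ex(1), of ?D] mult_left_mono[OF ex(2), of ?D] u(1)
        by (simp_all add: norm_mult mult.commute)
    qed
    have D: "?D > 0" using locally_injective_distortion[OF g \<eta> inj c c] by simp
    have im: "g ` S \<subseteq> Y"
    proof
      fix y assume "y \<in> g ` S"
      then obtain w where w: "w \<in> S" "y = g w" by auto
      hence wB: "w \<in> ?B" using S by auto
      have "norm (g w - g c) \<le> E * ?D * norm (w - c)"
      proof (rule field_differentiable_bound[of ?B])
        show "(g has_field_derivative deriv g z) (at z within ?B)" if "z \<in> ?B" for z
          using holomorphic_derivI[OF g open_ball] that Bd by (auto intro: has_field_derivative_at_within)
      qed (use bounds wB c in auto)
      also have "\<dots> \<le> E * ?D * d" using wB \<eta> E by (intro mult_left_mono) (auto simp: dist_norm norm_minus_commute)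
      also have "\<dots> = d * E * ?D" by simp
      also have "\<dots> \<le> K * ?D" using K by (intro mult_right_mono) auto
      finally show "y \<in> Y" using w G by (auto simp: Y_def dist_norm norm_minus_commute)
    qed
    define \<mu> where "\<mu> = ?D / (2 * E)"
    have \<mu>: "\<mu> > 0" using D E by (simp add: \<mu>_def)
    have Yl: "Y \<in> sets lebesgue" using G by (auto simp: Y_def)
    have part: "emeasure lebesgue (S \<inter> ball (c + b) e) \<le> ennreal (25 / \<mu>\<^sup>2) * emeasure lebesgue Y" for b
    proof (cases "S \<inter> ball (c + b) e = {}")
      case True thus ?thesis by simp
    next
      case False
      then obtain x0 where x0: "x0 \<in> S" "x0 \<in> ball (c + b) e" by auto
      define T where "T = ?B \<inter> ball (c + b) e"
      have x0B: "x0 \<in> ?B" using x0 S by auto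
      have T: "convex T" "T \<subseteq> ?B" by (auto simp: T_def convex_Int)
      have T2: "T \<subseteq> cball x0 (\<eta> / (4 * koebe_const))"
      proof
        fix x assume "x \<in> T"
        hence "dist x0 x \<le> 2 * e" using x0 dist_triangle[of x0 x "c + b"] by (auto simp: T_def dist_commute)
        thus "x \<in> cball x0 (\<eta> / (4 * koebe_const))" by (simp add: e_def k_def)
      qed
      have ex: "\<mu> * norm (x - y) \<le> norm (g x - g y)"
        if "x \<in> S \<inter> ball (c + b) e" "y \<in> S \<inter> ball (c + b) e" for x y
      proof -
        have "\<mu> * norm (x - y) \<le> norm (deriv g x0) / 2 * norm (x - y)"
          using bounds(2)[OF x0B] by (intro mult_right_mono) (auto simp: \<mu>_def)
        also have "\<dots> \<le> norm (g x - g y)"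
          by (rule locally_injective_expansion[OF g \<eta> inj x0B T T2]) (use that S in \<open>auto simp: T_def\<close>)
        finally show ?thesis .
      qed
      have "inj_on g (S \<inter> ball (c + b) e)"
      proof (rule inj_onI)
        fix x y assume xy: "x \<in> S \<inter> ball (c + b) e" "y \<in> S \<inter> ball (c + b) e" "g x = g y"
        hence "\<mu> * norm (x - y) \<le> 0" using ex[OF xy(1,2)] by simp
        hence "norm (x - y) \<le> 0" using \<mu> by (simp add: mult_le_0_iff)
        thus "x = y" by simp
      qed
      hence op: "open (g ` (S \<inter> ball (c + b) e))"
        using S Bd by (intro open_mapping_thm3 holomorphic_on_subset[OF g]) auto
      have "emeasure lebesgue (S \<inter> ball (c + b) e) \<le> ennreal (25 / \<mu>\<^sup>2) * emeasure lebesgue (g ` (S \<inter> ball (c + b) e))"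
        by (rule emeasure_expanding_image[OF op \<mu> ex])
      also have "\<dots> \<le> ennreal (25 / \<mu>\<^sup>2) * emeasure lebesgue Y"
        using im Yl by (intro mult_left_mono emeasure_mono) auto
      finally show ?thesis .
    qed
    have cov: "S \<subseteq> (\<Union>b\<in>B. S \<inter> ball (c + b) e)"
    proof
      fix x assume x: "x \<in> S"
      hence "x - c \<in> cball 0 (d - \<eta>)" using S by (auto simp: dist_norm norm_minus_commute)
      then obtain b where "b \<in> B" "x - c \<in> ball b e" using B by blast
      thus "x \<in> (\<Union>b\<in>B. S \<inter> ball (c + b) e)" using x by (auto simp: dist_norm algebra_simps)
    qed
    have "emeasure lebesgue S \<le> emeasure lebesgue (\<Union>b\<in>B. S \<inter> ball (c + b) e)"
      using cov S B by (intro emeasure_mono sets.finite_UN) auto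
    also have "\<dots> \<le> (\<Sum>b\<in>B. emeasure lebesgue (S \<inter> ball (c + b) e))"
      using S B by (intro emeasure_subadditive_finite) auto
    also have "\<dots> \<le> (\<Sum>b\<in>B. ennreal (25 / \<mu>\<^sup>2) * emeasure lebesgue Y)" by (intro sum_mono part)
    also have "\<dots> = ennreal (real (card B) * (25 / \<mu>\<^sup>2)) * emeasure lebesgue Y"
      by (subst ennreal_mult) (auto simp: mult.assoc ennreal_of_nat_eq_real_of_nat)
    finally have em: "emeasure lebesgue S \<le> \<dots>" .
    have "emeasure lebesgue Y \<le> emeasure lebesgue (cball (g c) (K * ?D))"
      unfolding Y_def by (intro emeasure_mono) auto
    also have "\<dots> < \<infinity>" using K D by (subst emeasure_lebesgue_cball_complex) auto
    finally have Yfin: "emeasure lebesgue Y = ennreal (measure lebesgue Y)"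
      by (intro emeasure_eq_ennreal_measure) auto
    have "emeasure lebesgue S \<le> ennreal (real (card B) * (25 / \<mu>\<^sup>2) * measure lebesgue Y)"
      using em by (simp only: Yfin) (subst ennreal_mult, auto)
    hence "measure lebesgue S \<le> real (card B) * (25 / \<mu>\<^sup>2) * measure lebesgue Y"
      unfolding measure_def by (rule enn2real_leI[rotated]) (auto intro: mult_nonneg_nonneg)
    hence "?D\<^sup>2 * measure lebesgue S \<le> ?D\<^sup>2 * (real (card B) * (25 / \<mu>\<^sup>2) * measure lebesgue Y)"
      by (intro mult_left_mono) auto
    also have "\<dots> = real (card B) * (100 * E\<^sup>2) * measure lebesgue Y"
      using D E by (simp add: \<mu>_def power_divide power_mult_distrib)
    also have "\<dots> \<le> K * measure lebesgue Y" using K by (intro mult_right_mono) auto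
    finally show "?D\<^sup>2 * measure lebesgue S \<le> K * measure lebesgue (G \<inter> cball (g c) (K * ?D))"
      unfolding Y_def .
  qed
qed

section \<open>Logarithmic inverse branches\<close>

text \<open>\<open>small_value\<close> is the geometric form of the positivity of
  \<open>theta\<close>: no circle of radius at least \<open>R0\<close> lies in a tract.
  \<open>inner\<close> keeps preimages of values beyond \<open>r1\<close> away from 0, so that their
  logarithms can be taken.\<close>

locale thin_tracts =
  fixes f :: "complex \<Rightarrow> complex" and r0 R0 r1 :: real
  assumes f: "f holomorphic_on UNIV" and r0: "0 < r0" and sing: "singular_values f \<subseteq> ball 0 r0"
    and R0: "0 < R0" and small_value: "\<And>r. r \<ge> R0 \<Longrightarrow> \<exists>z. norm z = r \<and> norm (f z) < r0"
    and r1: "r0 \<le> r1" and inner: "\<And>z. norm z \<le> R0 \<Longrightarrow> norm (f z) \<le> r1"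
begin

text \<open>A disc of radius greater than \<open>\<pi>\<close> in the image of a logarithmic inverse branch would contain
  a vertical segment of length \<open>2 * \<pi>\<close>, hence produce a circle on which \<open>f\<close> stays large.\<close>

lemma logarithmic_lift:
  assumes z: "norm (f (exp \<omega>)) > r1" and \<zeta>: "exp \<zeta> = f (exp \<omega>)" and d: "d = Re \<zeta> - ln r1"
  obtains \<psi> where "\<psi> holomorphic_on ball \<zeta> d" "\<psi> \<zeta> = \<omega>"
    "\<And>w. w \<in> ball \<zeta> d \<Longrightarrow> f (exp (\<psi> w)) = exp w"
    "\<And>w. w \<in> ball \<zeta> d \<Longrightarrow> (d - dist \<zeta> w) * norm (deriv \<psi> w) \<le> 12 * pi"
proof -
  have r1p: "r1 > 0" using r0 r1 by simp
  have "norm (exp \<zeta>) > r1" using z \<zeta> by simp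
  hence "exp (Re \<zeta>) > exp (ln r1)" using r1p by simp
  hence dp: "d > 0" by (simp add: d)
  have big: "norm (exp w) > r1" if "w \<in> ball \<zeta> d" for w
  proof -
    have "\<bar>Re (\<zeta> - w)\<bar> < d" using that abs_Re_le_cmod[of "\<zeta> - w"] by (simp add: dist_norm)
    hence "Re w > ln r1" unfolding d by auto
    hence "exp (Re w) > exp (ln r1)" by simp
    thus ?thesis using r1p by simp
  qed
  obtain g where g: "g holomorphic_on ball \<zeta> d" "g \<zeta> = exp \<omega>" "\<And>w. w \<in> ball \<zeta> d \<Longrightarrow> f (g w) = exp w"
  proof (rule lift_on_ball[OF f, of exp \<zeta> d "exp \<omega>"])
    show "exp w \<notin> singular_values f" if "w \<in> ball \<zeta> d" for w
      using big[OF that] sing r1 by force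
  qed (use dp \<zeta> in \<open>auto intro: holomorphic_intros\<close>)
  have gR: "norm (g w) > R0" if "w \<in> ball \<zeta> d" for w
    using inner[of "g w"] g(3)[OF that] big[OF that] by fastforce
  have gnz: "g w \<noteq> 0" if "w \<in> ball \<zeta> d" for w using gR[OF that] R0 by auto
  obtain L where L: "L holomorphic_on ball \<zeta> d" "\<And>w. w \<in> ball \<zeta> d \<Longrightarrow> exp (L w) = g w"
    using holomorphic_logarithm_exists[OF convex_ball open_ball g(1) gnz, of \<zeta>] dp by auto
  define \<psi> where "\<psi> w = L w - L \<zeta> + \<omega>" for w
  have \<psi>: "\<psi> holomorphic_on ball \<zeta> d" unfolding \<psi>_def using L by (intro holomorphic_intros)
  have e\<psi>: "exp (\<psi> w) = g w" if "w \<in> ball \<zeta> d" for w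
  proof -
    have "exp (L \<zeta>) = exp \<omega>" using L(2)[of \<zeta>] g(2) dp by simp
    thus ?thesis using L(2)[OF that] by (simp add: \<psi>_def exp_add exp_diff)
  qed
  have bl: "(d - dist \<zeta> w) * norm (deriv \<psi> w) \<le> 12 * pi" if w: "w \<in> ball \<zeta> d" for w
  proof (rule ccontr)
    assume neg: "\<not> ?thesis"
    define r where "r = d - dist \<zeta> w"
    have r: "r > 0" using w by (simp add: r_def)
    have sub: "ball w r \<subseteq> ball \<zeta> d"
    proof
      fix x assume "x \<in> ball w r"
      thus "x \<in> ball \<zeta> d" using dist_triangle[of \<zeta> x w] by (auto simp: r_def)
    qed
    \<comment> \<open>Bloch's theorem with constant 1/12 turns a failure of the bound into a disc of
      radius larger than \<pi> in the image; this is where 12 \<pi> comes from.\<close>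
    obtain b where b: "ball b (r * norm (deriv \<psi> w) / 12) \<subseteq> \<psi> ` ball w r"
      by (rule Bloch[OF holomorphic_on_subset[OF \<psi> sub] r order_refl])
    have rad: "r * norm (deriv \<psi> w) / 12 > pi" using neg by (simp add: r_def)
    have "b \<in> ball b (r * norm (deriv \<psi> w) / 12)" using rad pi_gt_zero by (simp only: centre_in_ball)
    then obtain x where "x \<in> ball \<zeta> d" "b = \<psi> x" using b sub by blast
    hence "norm (exp b) \<ge> R0" using gR[of x] e\<psi>[of x] by simp
    then obtain y where y: "norm y = norm (exp b)" "norm (f y) < r0" using small_value by blast
    \<comment> \<open>Since \<open>y\<close> lies on the circle through \<open>exp b\<close>,
      \<open>q\<close> is purely imaginary of modulus at most \<pi>. So \<open>b + q\<close> is
      still in the disc and \<open>y = exp (b + q)\<close> is a value of \<open>g\<close>.\<close>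
    define q where "q = Ln (y / exp b)"
    have ynz: "y \<noteq> 0" using y(1) by (metis exp_not_eq_zero norm_eq_zero)
    have n1: "norm (y / exp b) = 1" using y(1) by (simp add: norm_divide)
    have eq: "exp q = y / exp b" unfolding q_def using ynz by (intro exp_Ln) simp
    have "Re q = 0" unfolding q_def using n1 ynz by (simp add: Re_Ln)
    hence "norm q = \<bar>Im q\<bar>" by (simp add: cmod_def)
    also have "\<dots> \<le> pi" unfolding q_def using mpi_less_Im_Ln[of "y / exp b"] Im_Ln_le_pi[of "y / exp b"] ynz by simp
    finally have "b + q \<in> ball b (r * norm (deriv \<psi> w) / 12)" using rad by (simp add: dist_norm)
    then obtain x' where x': "x' \<in> ball \<zeta> d" "b + q = \<psi> x'" using b sub by blast
    have "y = exp (b + q)" using eq by (simp add: exp_add)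
    also have "\<dots> = g x'" using x' e\<psi> by simp
    finally have "norm (f y) > r1" using g(3) big x' by simp
    thus False using y(2) r1 by simp
  qed
  show thesis
  proof (rule that[OF \<psi>])
    show "\<psi> \<zeta> = \<omega>" by (simp add: \<psi>_def)
    show "f (exp (\<psi> w)) = exp w" if "w \<in> ball \<zeta> d" for w using g(3) e\<psi> that by simp
  qed (use bl in auto)
qed

text \<open>Beyond \<open>R\<close> a logarithmic lift lives on a disc of radius above
  \<open>20 + 12 * pi\<close>: on the concentric disc of radius 20 the remaining margin is 12 \<pi>,
  which makes the derivative at most 1. The second entry ensures that radii within a factor e of a
  modulus above \<open>R\<close> still exceed \<open>R0\<close>.\<close>

definition R where "R = max (r1 * exp (20 + 12 * pi)) (R0 * exp 1)"

lemma R: "R > 0" "R0 * exp 1 \<le> R" "ln R \<ge> ln r1 + 20 + 12 * pi"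
proof -
  have "r1 > 0" using r0 r1 by simp
  show "R > 0" "R0 * exp 1 \<le> R" using R0 by (auto simp: R_def less_max_iff_disj)
  have "ln (r1 * exp (20 + 12 * pi)) \<le> ln R"
    using \<open>r1 > 0\<close> by (intro ln_mono) (auto simp: R_def)
  thus "ln R \<ge> ln r1 + 20 + 12 * pi" using \<open>r1 > 0\<close> by (simp add: ln_mult)
qed

lemma norm_exp_nearby:
  fixes u v :: complex
  assumes "norm (exp u) > R" "norm (v - u) \<le> 20" shows "norm (exp v) > r1"
proof -
  have r1p: "r1 > 0" using r0 r1 by simp
  have "Re u > ln R" using assms(1) R(1) by (metis norm_exp_eq_Re exp_less_cancel_iff exp_ln)
  moreover have "\<bar>Re (v - u)\<bar> \<le> 20" using assms(2) abs_Re_le_cmod[of "v - u"] by linarith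
  ultimately have "Re v > ln r1" using R(3) pi_gt_zero unfolding minus_complex.sel by linarith
  thus ?thesis using r1p by (metis norm_exp_eq_Re exp_less_cancel_iff exp_ln)
qed

text \<open>The lift through the first step is composed with the branch for the remaining orbit.
  That branch has derivative at most 1, so it moves the disc of radius 20 by less than 20 and lands
  where the next lift contracts as well; the radius does not shrink with \<open>n\<close>. The
  intermediate points stay beyond \<open>r1\<close> because each is within logarithmic distance 20
  of an orbit point beyond \<open>R\<close>.\<close>

lemma orbit_branch:
  assumes "\<forall>k\<le>n. norm ((f ^^ k) z) > R" "exp \<zeta> = (f ^^ n) z"
  shows "\<exists>\<phi>. \<phi> holomorphic_on ball \<zeta> 20 \<and> exp (\<phi> \<zeta>) = z \<and>
    (\<forall>w\<in>ball \<zeta> 20. (f ^^ n) (exp (\<phi> w)) = exp w \<and> norm (deriv \<phi> w) \<le> 1 \<and>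
      (\<forall>k\<le>n. norm ((f ^^ k) (exp (\<phi> w))) > r1))"
  using assms
proof (induction n arbitrary: z)
  case 0
  have "norm (exp w) > r1" if "w \<in> ball \<zeta> 20" for w
    using norm_exp_nearby[of \<zeta> w] that 0 by (auto simp: dist_norm norm_minus_commute)
  thus ?case using 0 by (intro exI[of _ "\<lambda>w. w"]) (auto intro: holomorphic_intros)
next
  case (Suc n)
  have orb: "norm ((f ^^ k) (f z)) > R" if "k \<le> n" for k
    using Suc.prems(1)[rule_format, of "Suc k"] that by (simp add: funpow_Suc_right del: funpow.simps)
  have "exp \<zeta> = (f ^^ n) (f z)" using Suc.prems(2) by (simp add: funpow_Suc_right del: funpow.simps)
  then obtain \<phi>' where \<phi>': "\<phi>' holomorphic_on ball \<zeta> 20" "exp (\<phi>' \<zeta>) = f z"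
    and \<phi>'p: "\<And>w. w \<in> ball \<zeta> 20 \<Longrightarrow> (f ^^ n) (exp (\<phi>' w)) = exp w"
      "\<And>w. w \<in> ball \<zeta> 20 \<Longrightarrow> norm (deriv \<phi>' w) \<le> 1"
      "\<And>w k. w \<in> ball \<zeta> 20 \<Longrightarrow> k \<le> n \<Longrightarrow> norm ((f ^^ k) (exp (\<phi>' w))) > r1"
    using Suc.IH[of "f z"] orb by blast
  have zR: "norm z > R" "norm (f z) > R" using Suc.prems(1)[rule_format, of 0] orb[of 0] by auto
  define \<omega> where "\<omega> = Ln z"
  have \<omega>: "exp \<omega> = z" using zR R by (auto simp: \<omega>_def intro!: exp_Ln)
  define d where "d = Re (\<phi>' \<zeta>) - ln r1"
  have Re_ln: "Re (\<phi>' \<zeta>) = ln (norm (f z))" using \<phi>'(2) by (metis norm_exp_eq_Re ln_exp)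
  have "Re (\<phi>' \<zeta>) > ln R" using zR(2) R(1) unfolding Re_ln by (subst ln_less_cancel_iff) linarith+
  hence d: "d > 20 + 12 * pi" using R(3) by (simp add: d_def)
  have "r1 > 0" using r0 r1 by simp
  have R1: "R \<ge> r1" using R(3) pi_gt_zero \<open>r1 > 0\<close> R(1)
    by (smt (verit, ccfv_SIG) ln_le_cancel_iff)
  obtain \<psi> where \<psi>: "\<psi> holomorphic_on ball (\<phi>' \<zeta>) d" "\<psi> (\<phi>' \<zeta>) = \<omega>"
    and \<psi>p: "\<And>w. w \<in> ball (\<phi>' \<zeta>) d \<Longrightarrow> f (exp (\<psi> w)) = exp w"
      "\<And>w. w \<in> ball (\<phi>' \<zeta>) d \<Longrightarrow> (d - dist (\<phi>' \<zeta>) w) * norm (deriv \<psi> w) \<le> 12 * pi"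
    by (rule logarithmic_lift[of \<omega> "\<phi>' \<zeta>" d]) (use \<omega> zR R1 \<phi>'(2) d_def in auto)
  have contr: "norm (h w - h \<zeta>) < 20"
    if "w \<in> ball \<zeta> 20" "h holomorphic_on ball \<zeta> 20" "\<And>w. w \<in> ball \<zeta> 20 \<Longrightarrow> norm (deriv h w) \<le> 1" for h w
  proof -
    have "norm (h w - h \<zeta>) \<le> 1 * norm (w - \<zeta>)"
    proof (rule field_differentiable_bound[of "ball \<zeta> 20"])
      show "(h has_field_derivative deriv h z) (at z within ball \<zeta> 20)" if "z \<in> ball \<zeta> 20" for z
        using holomorphic_derivI[OF \<open>h holomorphic_on _\<close> open_ball that] by (rule has_field_derivative_at_within)
    qed (use that in auto)
    thus ?thesis using that(1) by (simp add: dist_norm norm_minus_commute)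
  qed
  have im: "dist (\<phi>' \<zeta>) (\<phi>' w) < 20" if "w \<in> ball \<zeta> 20" for w
    using contr[OF that \<phi>'(1) \<phi>'p(2)] by (simp add: dist_norm norm_minus_commute)
  have imd: "\<phi>' w \<in> ball (\<phi>' \<zeta>) d" if "w \<in> ball \<zeta> 20" for w
    using im[OF that] d pi_gt_zero by (simp del: pi_gt_zero)
  define \<phi> where "\<phi> w = \<psi> (\<phi>' w)" for w
  have \<phi>: "\<phi> holomorphic_on ball \<zeta> 20" unfolding \<phi>_def
    by (rule holomorphic_on_compose_gen[OF \<phi>'(1) \<psi>(1), unfolded o_def]) (use imd in auto)
  have d\<phi>: "norm (deriv \<phi> w) \<le> 1" if w: "w \<in> ball \<zeta> 20" for w
  proof -
    have "(\<phi> has_field_derivative deriv \<psi> (\<phi>' w) * deriv \<phi>' w) (at w)" unfolding \<phi>_def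
      by (rule DERIV_chain2[OF holomorphic_derivI[OF \<psi>(1) open_ball imd[OF w]] holomorphic_derivI[OF \<phi>'(1) open_ball w]])
    hence eq: "deriv \<phi> w = deriv \<psi> (\<phi>' w) * deriv \<phi>' w" by (rule DERIV_imp_deriv)
    have "12 * pi * norm (deriv \<psi> (\<phi>' w)) \<le> (d - dist (\<phi>' \<zeta>) (\<phi>' w)) * norm (deriv \<psi> (\<phi>' w))"
      using im[OF w] d by (intro mult_right_mono) auto
    also have "\<dots> \<le> 12 * pi" by (rule \<psi>p(2)[OF imd[OF w]])
    finally have "norm (deriv \<psi> (\<phi>' w)) \<le> 1" by simp
    hence "norm (deriv \<psi> (\<phi>' w)) * norm (deriv \<phi>' w) \<le> 1 * 1"
      using \<phi>'p(2)[OF w] by (intro mult_mono) auto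
    thus ?thesis by (simp add: eq norm_mult)
  qed
  have "norm ((f ^^ k) (exp (\<phi> w))) > r1" if w: "w \<in> ball \<zeta> 20" and k: "k \<le> Suc n" for k w
  proof (cases k)
    case 0
    have "norm (\<phi> w - \<omega>) \<le> 20" using contr[OF w \<phi> d\<phi>] \<psi>(2) by (simp add: \<phi>_def)
    thus ?thesis using norm_exp_nearby[of \<omega> "\<phi> w"] \<omega> zR 0 by simp
  next
    case (Suc j)
    hence "(f ^^ k) (exp (\<phi> w)) = (f ^^ j) (exp (\<phi>' w))"
      using \<psi>p(1)[OF imd[OF w]] by (simp add: \<phi>_def funpow_Suc_right del: funpow.simps)
    thus ?thesis using \<phi>'p(3)[OF w, of j] k Suc by simp
  qed
  moreover have "(f ^^ Suc n) (exp (\<phi> w)) = exp w" if w: "w \<in> ball \<zeta> 20" for w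
    using \<psi>p(1)[OF imd[OF w]] \<phi>'p(1)[OF w] by (simp add: \<phi>_def funpow_Suc_right del: funpow.simps)
  moreover have "exp (\<phi> \<zeta>) = z" using \<psi>(2) \<omega> by (simp add: \<phi>_def)
  ultimately show ?case using \<phi> d\<phi> by blast
qed

end

text \<open>Fubini over vertical slices: the slice at real part \<open>t\<close> is, up to
  endpoints, the angular set measured by \<open>theta\<close> on the circle of radius
  \<open>exp t\<close>, and the rectangle has width 2.\<close>

lemma measure_log_rectangle:
  fixes f :: "complex \<Rightarrow> complex"
  assumes f: "continuous_on UNIV f" and \<tau>: "\<tau> \<ge> 0"
    and th: "\<And>t. x - 1 < t \<Longrightarrow> t < x + 1 \<Longrightarrow> theta f r0 (exp t) \<ge> \<tau>"
    and S: "S = {w. x - 1 < Re w \<and> Re w < x + 1 \<and> 0 < Im w \<and> Im w < 2 * pi \<and> norm (f (exp w)) < r0}"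
  shows "open S" and "measure lebesgue S \<ge> 2 * \<tau>"
proof -
  have fc: "continuous_on UNIV (\<lambda>w. f (h w))" if "continuous_on UNIV h" for h :: "complex \<Rightarrow> complex"
    by (rule continuous_on_compose2[OF f that]) auto
  have fc2: "continuous_on UNIV (\<lambda>w. f (h w))" if "continuous_on UNIV h" for h :: "real \<Rightarrow> complex"
    by (rule continuous_on_compose2[OF f that]) auto
  show op: "open S" unfolding S
    by (intro open_Collect_conj open_Collect_less continuous_intros fc)
  have sl: "ennreal (\<tau> * indicator {x-1<..<x+1} t) \<le> emeasure lborel {y. Complex t y \<in> S}" for t
  proof (cases "t \<in> {x-1<..<x+1}")
    case True
    define P where "P y \<longleftrightarrow> norm (f (of_real (exp t) * exp (\<i> * of_real y))) < r0" for y
    have eq: "exp (Complex t y) = of_real (exp t) * exp (\<i> * of_real y)" for y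
      by (simp only: Complex_eq exp_add exp_of_real)
    have sub: "{y. Complex t y \<in> S} = {y. 0 < y \<and> y < 2 * pi \<and> P y}"
      using True unfolding S P_def by (simp add: eq)
    have oP: "open {y. P y}"
      unfolding P_def by (intro open_Collect_less continuous_intros fc2)
    have cl: "{y \<in> {0..2*pi}. P y} = {0..2*pi} \<inter> {y. P y}" by auto
    have oS: "open {y. 0 < y \<and> y < 2 * pi \<and> P y}"
    proof -
      have "{y. 0 < y \<and> y < 2 * pi \<and> P y} = {0<..<2 * pi} \<inter> {y. P y}" by auto
      thus ?thesis using oP by (simp add: open_Int)
    qed
    have "\<tau> \<le> measure lebesgue {y \<in> {0..2*pi}. P y}"
    proof -
      have "theta f r0 (exp t) = measure lebesgue {y \<in> {0..2*pi}. P y}" by (simp only: theta_def P_def)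
      thus ?thesis using th[of t] True by simp
    qed
    \<comment> \<open>\<open>theta\<close> uses the closed interval of angles, whereas
      \<open>S\<close> has to be open for the area comparison; the difference consists of two
      endpoints.\<close>
    also have "\<dots> = measure lebesgue {y. 0 < y \<and> y < 2 * pi \<and> P y}"
    proof (rule measure_negligible_symdiff)
      have "{y. 0 < y \<and> y < 2 * pi \<and> P y} \<subseteq> {0..2*pi}" by auto
      thus "{y. 0 < y \<and> y < 2 * pi \<and> P y} \<in> lmeasurable"
        using oS bounded_subset bounded_closed_interval by (blast intro: lmeasurable_open)
      have "negligible {0, 2 * pi}" by (simp add: negligible_insert)
      thus "negligible ({y. 0 < y \<and> y < 2 * pi \<and> P y} - {y \<in> {0..2*pi}. P y} \<union>
          ({y \<in> {0..2*pi}. P y} - {y. 0 < y \<and> y < 2 * pi \<and> P y}))"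
        by (rule negligible_subset) auto
    qed
    also have "\<dots> = measure lborel {y. 0 < y \<and> y < 2 * pi \<and> P y}"
      using oS by (intro measure_completion) auto
    finally have "ennreal \<tau> \<le> ennreal (measure lborel {y. 0 < y \<and> y < 2 * pi \<and> P y})"
      by (rule ennreal_leI)
    also have "\<dots> \<le> emeasure lborel {y. 0 < y \<and> y < 2 * pi \<and> P y}"
      by (cases "emeasure lborel {y. 0 < y \<and> y < 2 * pi \<and> P y}") (simp_all add: measure_def)
    finally show ?thesis using True sub by simp
  qed simp
  have "ennreal (2 * \<tau>) = (\<integral>\<^sup>+t. ennreal (\<tau> * indicator {x-1<..<x+1} t) \<partial>lborel)"
  proof -
    have "(\<integral>\<^sup>+t. ennreal (\<tau> * indicator {x-1<..<x+1} t) \<partial>lborel) =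
        (\<integral>\<^sup>+t. ennreal \<tau> * indicator {x-1<..<x+1} t \<partial>lborel)"
      by (intro nn_integral_cong) (auto simp: indicator_def)
    also have "\<dots> = ennreal \<tau> * emeasure lborel {x-1<..<x+1}"
      by (rule nn_integral_cmult_indicator) simp
    also have "\<dots> = ennreal \<tau> * ennreal 2" by simp
    also have "\<dots> = ennreal (2 * \<tau>)" using \<tau> by (subst ennreal_mult[symmetric]) (auto simp: mult.commute)
    finally show ?thesis by simp
  qed
  also have "\<dots> \<le> (\<integral>\<^sup>+t. emeasure lborel {y. Complex t y \<in> S} \<partial>lborel)"
    using sl by (intro nn_integral_mono) auto
  also have "\<dots> = emeasure lborel S" using op by (intro emeasure_lborel_complex[symmetric]) auto
  also have "\<dots> = emeasure lebesgue S" using op by simp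
  finally have le: "ennreal (2 * \<tau>) \<le> emeasure lebesgue S" .
  have "S \<subseteq> cball (of_real x) (1 + 2 * pi)"
  proof
    fix w assume "w \<in> S"
    hence "\<bar>Re (of_real x - w)\<bar> \<le> 1" "\<bar>Im (of_real x - w)\<bar> \<le> 2 * pi" by (auto simp: S)
    thus "w \<in> cball (of_real x) (1 + 2 * pi)"
      using cmod_le[of "of_real x - w"] by (simp add: dist_norm)
  qed
  hence "emeasure lebesgue S \<le> emeasure lebesgue (cball (complex_of_real x) (1 + 2 * pi))"
    by (intro emeasure_mono) auto
  also have "\<dots> < \<infinity>" by (subst emeasure_lebesgue_cball_complex) auto
  finally have "emeasure lebesgue S = ennreal (measure lebesgue S)"
    by (intro emeasure_eq_ennreal_measure) auto
  thus "measure lebesgue S \<ge> 2 * \<tau>" using le by simp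
qed

lemma continuous_on_funpow:
  fixes f :: "'a::topological_space \<Rightarrow> 'a"
  assumes "continuous_on UNIV f" shows "continuous_on UNIV (f ^^ n)"
proof (induction n)
  case (Suc n)
  show ?case using continuous_on_compose2[OF assms Suc] by (simp add: o_def)
qed (simp add: id_def)

lemma holomorphic_on_funpow:
  assumes "f holomorphic_on UNIV" shows "(f ^^ n) holomorphic_on UNIV"
proof (induction n)
  case (Suc n)
  show ?case using holomorphic_on_compose_gen[OF Suc assms] by (simp add: o_def)
qed (simp add: id_def)

section \<open>Exit sets and the proportion they fill near surviving points\<close>

context thin_tracts
begin

text \<open>The threshold is \<open>r1\<close> and not \<open>R\<close>, because along an inverse
  branch only the orbit of the central point is known to stay beyond \<open>R\<close>. As
  \<open>r0 \<le> r1\<close>, exits at different times exclude each other.\<close>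

definition exit_set :: "nat \<Rightarrow> complex set" where
  "exit_set n = {v. (\<forall>k\<le>n. norm ((f ^^ k) v) > r1) \<and> norm ((f ^^ Suc n) v) < r0}"

lemma open_exit_set: "open (exit_set n)"
proof -
  have c: "continuous_on UNIV (f ^^ k)" for k
    by (rule continuous_on_funpow[OF holomorphic_on_imp_continuous_on[OF f]])
  have "exit_set n = (\<Inter>k\<in>{..n}. {v. norm ((f ^^ k) v) > r1}) \<inter> {v. norm ((f ^^ Suc n) v) < r0}"
    by (auto simp: exit_set_def)
  thus ?thesis
    by (simp only:) (intro open_Int open_INT finite_atMost ballI open_Collect_less continuous_intros c)
qed

lemma disjoint_exit_set: "disjoint_family exit_set"
  unfolding disjoint_family_on_def
proof (intro ballI impI)
  have "exit_set m \<inter> exit_set n = {}" if "m < n" for m n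
  proof -
    have "norm ((f ^^ Suc m) v) > r1" if "v \<in> exit_set n" for v
      using that \<open>m < n\<close> unfolding exit_set_def by (auto simp del: funpow.simps)
    thus ?thesis using r1 unfolding exit_set_def by fastforce
  qed
  thus "exit_set m \<inter> exit_set n = {}" if "m \<noteq> n" for m n
    using that by (metis Int_commute linorder_neqE_nat)
qed

text \<open>The part of the logarithmic rectangle at time \<open>n\<close> that
  \<open>f o exp\<close> sends into the disc of radius \<open>r0\<close> is pulled back by
  \<open>exp o \<phi>\<close>. The constant \<open>K\<close> is independent of \<open>z\<close>,
  \<open>n\<close> and \<tau>. The third power arises since the area comparison costs one factor
  \<open>K\<close> and the radius \<rho> contributes two.\<close>

lemma exit_set_proportion:
  obtains K where "K \<ge> 1"
    "\<And>z n \<tau>. (\<forall>k\<le>n. norm ((f ^^ k) z) > R) \<Longrightarrow> \<tau> \<ge> 0 \<Longrightarrow>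
      (\<And>r. norm ((f ^^ n) z) < r * exp 1 \<Longrightarrow> r < norm ((f ^^ n) z) * exp 1 \<Longrightarrow> theta f r0 r \<ge> \<tau>) \<Longrightarrow>
      \<exists>\<rho>. 0 < \<rho> \<and> \<rho> \<le> K * norm z \<and> 2 * \<tau> / K ^ 3 * \<rho>\<^sup>2 \<le> measure lebesgue (exit_set n \<inter> cball z \<rho>)"
proof -
  \<comment> \<open>Radius 3 is below \<pi>, so \<open>exp\<close> is injective on such discs, and
    17 exceeds the distance \<open>1 + 2 * \<pi>\<close> that bounds how far the rectangle extends
    from its reference point.\<close>
  obtain K :: real where K: "K \<ge> 1" and im': "\<forall>c g S G. g holomorphic_on ball c 20 \<longrightarrow>
      (\<forall>w\<in>ball c (20 - 3). inj_on g (ball w 3)) \<longrightarrow> open S \<longrightarrow> S \<subseteq> ball c (20 - 3) \<longrightarrow>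
      G \<in> sets lebesgue \<longrightarrow> g ` S \<subseteq> G \<longrightarrow>
      (norm (deriv g c))\<^sup>2 * measure lebesgue S
        \<le> K * measure lebesgue (G \<inter> cball (g c) (K * norm (deriv g c)))"
    using locally_injective_image_measure[of 3 20] by auto
  note im = im'[rule_format]
  show thesis
  proof (rule that[OF K])
    fix z n \<tau>
    assume orb: "\<forall>k\<le>n. norm ((f ^^ k) z) > R" and \<tau>: "\<tau> \<ge> 0"
      and th: "\<And>r. norm ((f ^^ n) z) < r * exp 1 \<Longrightarrow> r < norm ((f ^^ n) z) * exp 1 \<Longrightarrow> theta f r0 r \<ge> \<tau>"
    define v where "v = (f ^^ n) z"
    have vR: "norm v > R" using orb by (simp add: v_def)
    hence v0: "v \<noteq> 0" using R(1) by auto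
    define x where "x = ln (norm v)"
    \<comment> \<open>The argument is taken from 0 to 2 \<pi> to match the strip of the rectangle,
      so \<zeta> is close to all of \<open>S\<close>.\<close>
    define \<zeta> where "\<zeta> = Complex x (Arg2pi v)"
    have ex: "exp x = norm v" using v0 by (simp add: x_def)
    have "exp \<zeta> = of_real (exp x) * exp (\<i> * of_real (Arg2pi v))"
      by (simp only: \<zeta>_def Complex_eq exp_add exp_of_real)
    also have "\<dots> = v" unfolding ex using Arg2pi_eq[of v] by simp
    finally have e\<zeta>: "exp \<zeta> = (f ^^ n) z" by (simp add: v_def)
    obtain \<phi> where \<phi>: "\<phi> holomorphic_on ball \<zeta> 20" "exp (\<phi> \<zeta>) = z"
      and \<phi>p: "\<And>w. w \<in> ball \<zeta> 20 \<Longrightarrow> (f ^^ n) (exp (\<phi> w)) = exp w"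
        "\<And>w. w \<in> ball \<zeta> 20 \<Longrightarrow> norm (deriv \<phi> w) \<le> 1"
        "\<And>w k. w \<in> ball \<zeta> 20 \<Longrightarrow> k \<le> n \<Longrightarrow> norm ((f ^^ k) (exp (\<phi> w))) > r1"
      using orbit_branch[OF orb e\<zeta>] by blast
    define g where "g w = exp (\<phi> w)" for w
    have g: "g holomorphic_on ball \<zeta> 20" unfolding g_def using \<phi> by (intro holomorphic_intros)
    have inj: "inj_on g (ball w 3)" if "w \<in> ball \<zeta> (20 - 3)" for w
    proof (rule inj_onI)
      fix a b assume ab: "a \<in> ball w 3" "b \<in> ball w 3" "g a = g b"
      have "a \<in> ball \<zeta> 20" "b \<in> ball \<zeta> 20"
        using ab that dist_triangle[of \<zeta> a w] dist_triangle[of \<zeta> b w] by auto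
      hence "exp a = exp b" using \<phi>p(1) ab(3) unfolding g_def by metis
      moreover have "a \<in> ball w pi" "b \<in> ball w pi" using ab pi_gt3 by auto
      ultimately show "a = b" using inj_on_exp_pi[of w] by (auto dest: inj_onD)
    qed
    define S where "S = {w. x - 1 < Re w \<and> Re w < x + 1 \<and> 0 < Im w \<and> Im w < 2 * pi \<and> norm (f (exp w)) < r0}"
    have thx: "theta f r0 (exp t) \<ge> \<tau>" if "x - 1 < t" "t < x + 1" for t
    proof (rule th)
      have "exp x < exp (t + 1)" "exp t < exp (x + 1)" using that by auto
      thus "norm ((f ^^ n) z) < exp t * exp 1" "exp t < norm ((f ^^ n) z) * exp 1"
        using ex by (simp_all add: exp_add v_def)
    qed
    have S: "open S" "measure lebesgue S \<ge> 2 * \<tau>"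
      using measure_log_rectangle[OF holomorphic_on_imp_continuous_on[OF f] \<tau> thx S_def] by auto
    have S17: "S \<subseteq> ball \<zeta> (20 - 3)"
    proof
      fix w assume w: "w \<in> S"
      have "0 \<le> Arg2pi v" "Arg2pi v < 2 * pi" using Arg2pi_ge_0 Arg2pi_lt_2pi by auto
      hence "\<bar>Re (\<zeta> - w)\<bar> \<le> 1" "\<bar>Im (\<zeta> - w)\<bar> \<le> 2 * pi" using w by (auto simp: S_def \<zeta>_def)
      hence "norm (\<zeta> - w) \<le> 1 + 2 * pi" using cmod_le[of "\<zeta> - w"] by linarith
      thus "w \<in> ball \<zeta> (20 - 3)" using pi_less_4 by (simp add: dist_norm)
    qed
    have gS: "g ` S \<subseteq> exit_set n"
    proof
      fix y assume "y \<in> g ` S"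
      then obtain w where w: "w \<in> S" "y = g w" by auto
      have wb: "w \<in> ball \<zeta> 20" using w S17 subset_ball[of 17 20 \<zeta>] by auto
      have "(f ^^ Suc n) y = f (exp w)" using \<phi>p(1)[OF wb] w by (simp add: g_def)
      thus "y \<in> exit_set n" using \<phi>p(3)[OF wb] w by (simp add: exit_set_def g_def S_def del: funpow.simps)
    qed
    have g\<zeta>: "g \<zeta> = z" using \<phi> by (simp add: g_def)
    define \<rho> where "\<rho> = K * norm (deriv g \<zeta>)"
    have d0: "deriv g \<zeta> \<noteq> 0"
      using holomorphic_injective_imp_regular[OF holomorphic_on_subset[OF g] open_ball inj[of \<zeta>]] by (simp add: subset_ball)
    have "(g has_field_derivative exp (\<phi> \<zeta>) * deriv \<phi> \<zeta>) (at \<zeta>)" unfolding g_def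
      using holomorphic_derivI[OF \<phi>(1) open_ball, of \<zeta>] by (auto intro!: derivative_eq_intros)
    \<comment> \<open>As \<phi> has derivative at most 1, the radius \<rho> is at most
      \<open>K * norm z\<close> for every \<open>n\<close>, as the covering argument
      requires.\<close>
    hence "deriv g \<zeta> = z * deriv \<phi> \<zeta>" using \<phi>(2) by (simp add: DERIV_imp_deriv)
    hence "norm (deriv g \<zeta>) \<le> norm z * 1" using \<phi>p(2)[of \<zeta>] by (simp add: norm_mult mult_left_le)
    hence "\<rho> \<le> K * norm z" using K unfolding \<rho>_def by (intro mult_left_mono) auto
    moreover have "\<rho> > 0" using d0 K by (simp add: \<rho>_def)
    moreover have "2 * \<tau> / K ^ 3 * \<rho>\<^sup>2 \<le> measure lebesgue (exit_set n \<inter> cball z \<rho>)"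
    proof -
      have "(norm (deriv g \<zeta>))\<^sup>2 * (2 * \<tau>) \<le> (norm (deriv g \<zeta>))\<^sup>2 * measure lebesgue S"
        using S by (intro mult_left_mono) auto
      also have "\<dots> \<le> K * measure lebesgue (exit_set n \<inter> cball z \<rho>)"
        using im[OF g inj S(1) S17 _ gS] open_exit_set by (auto simp: g\<zeta> \<rho>_def)
      finally have "(norm (deriv g \<zeta>))\<^sup>2 * (2 * \<tau>) / K \<le> measure lebesgue (exit_set n \<inter> cball z \<rho>)"
        using K by (simp add: field_simps)
      moreover have "2 * \<tau> / K ^ 3 * \<rho>\<^sup>2 = (norm (deriv g \<zeta>))\<^sup>2 * (2 * \<tau>) / K"
        using K by (simp add: \<rho>_def power_mult_distrib field_simps eval_nat_numeral)
      ultimately show ?thesis by simp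
    qed
    ultimately show "\<exists>\<rho>. 0 < \<rho> \<and> \<rho> \<le> K * norm z \<and> 2 * \<tau> / K ^ 3 * \<rho>\<^sup>2 \<le> measure lebesgue (exit_set n \<inter> cball z \<rho>)"
      by blast
  qed
qed

end

section \<open>Growth of orbits and the escaping set\<close>

text \<open>Critical points are countable, and near any other point the preimage is the image of a
  null set under a differentiable local inverse. The point \<open>z0\<close> excludes constant
  functions.\<close>

lemma negligible_vimage_holomorphic:
  assumes f: "f holomorphic_on UNIV" and "deriv f z0 \<noteq> 0" and A: "negligible A"
  shows "negligible (f -` A)"
proof -
  define Z where "Z = {z. deriv f z = 0}"
  have "countable Z"
  proof (cases "deriv f constant_on UNIV")
    case True
    hence "Z = {}" using assms(2) by (auto simp: Z_def constant_on_def)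
    thus ?thesis by simp
  next
    case False
    thus ?thesis
      using holomorphic_countable_zeros[of "deriv f" UNIV] holomorphic_deriv[OF f] convex_connected[OF convex_UNIV]
      by (simp add: Z_def fsigma_UNIV)
  qed
  hence "negligible Z"
    by (simp add: negligible_iff_null_sets null_sets_completionI countable_imp_null_set_lborel)
  moreover have "negligible (f -` A - Z)"
  proof (subst locally_negligible_alt, rule ballI)
    fix z assume z: "z \<in> f -` A - Z"
    then obtain r \<phi> where r: "r > 0" "open (f ` ball z r)"
      and \<phi>: "\<phi> holomorphic_on f ` ball z r" "\<And>x. x \<in> ball z r \<Longrightarrow> \<phi> (f x) = x"
      using local_inverse[OF f, of z] unfolding Z_def by blast
    define U where "U = (f -` A - Z) \<inter> ball z r"
    have "negligible (\<phi> ` (A \<inter> f ` ball z r))"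
    proof (rule negligible_differentiable_image_negligible)
      show "negligible (A \<inter> f ` ball z r)" using A by (rule negligible_subset) auto
      have "\<phi> differentiable_on f ` ball z r"
        unfolding differentiable_on_def
      proof
        fix x assume "x \<in> f ` ball z r"
        from holomorphic_derivI[OF \<phi>(1) r(2) this]
        show "\<phi> differentiable (at x within f ` ball z r)"
          unfolding has_field_derivative_def differentiable_def by (blast intro: has_derivative_at_withinI)
      qed
      thus "\<phi> differentiable_on A \<inter> f ` ball z r" by (rule differentiable_on_subset) auto
    qed simp
    hence "negligible U"
    proof (rule negligible_subset)
      show "U \<subseteq> \<phi> ` (A \<inter> f ` ball z r)"
      proof
        fix x assume "x \<in> U"
        hence "\<phi> (f x) = x" "f x \<in> A \<inter> f ` ball z r" using \<phi>(2) by (auto simp: U_def)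
        thus "x \<in> \<phi> ` (A \<inter> f ` ball z r)" by (metis imageI)
      qed
    qed
    moreover have "openin (top_of_set (f -` A - Z)) U" unfolding U_def by (rule openin_open_Int) simp
    moreover have "z \<in> U" using z r by (simp add: U_def)
    ultimately show "\<exists>U. openin (top_of_set (f -` A - Z)) U \<and> z \<in> U \<and> negligible U" by blast
  qed
  ultimately have "negligible (Z \<union> (f -` A - Z))" by (rule negligible_Un)
  thus ?thesis by (rule negligible_subset) auto
qed

section \<open>Growth of orbits for functions of finite order\<close>

lemma norm_le_max_modulus:
  assumes "f holomorphic_on UNIV" shows "norm (f z) \<le> max_modulus f (norm z)"
  unfolding max_modulus_def
proof (rule cSup_upper)
  have "compact (sphere (0::complex) (norm z))" by simp
  moreover have "continuous_on (sphere 0 (norm z)) (\<lambda>z. norm (f z))"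
    by (intro continuous_intros holomorphic_on_imp_continuous_on holomorphic_on_subset[OF assms]) auto
  ultimately have "bounded ((\<lambda>z. norm (f z)) ` sphere 0 (norm z))"
    by (intro compact_imp_bounded compact_continuous_image)
  hence "bdd_above ((\<lambda>z. norm (f z)) ` sphere 0 (norm z))" by (rule bounded_imp_bdd_above)
  moreover have "{norm (f z') |z'. norm z' = norm z} = (\<lambda>z. norm (f z)) ` sphere 0 (norm z)"
    by (auto simp: image_iff)
  ultimately show "bdd_above {norm (f z') |z'. norm z' = norm z}" by simp
qed auto

text \<open>The order gives a bound for large radii only; the additive constant \<open>c\<close>
  absorbs the remaining disc, so the estimate holds everywhere and can be iterated.\<close>

lemma finite_order_bound:
  assumes f: "f holomorphic_on UNIV" and fo: "finite_order f"
  obtains q :: nat and c :: real where "q \<ge> 2" "c \<ge> 1" "\<And>z. norm (f z) \<le> exp ((norm z + c) ^ q)"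
proof -
  obtain p :: nat where p: "order_of f < ereal (real p)"
    using fo less_PInf_Ex_of_nat[of "order_of f"] unfolding finite_order_def by auto
  have "eventually (\<lambda>r. ereal (ln (ln (max_modulus f r)) / ln r) < ereal (real p)) at_top"
    using p unfolding order_of_def by (rule Limsup_lessD)
  then obtain r2' where r2': "\<And>r. r \<ge> r2' \<Longrightarrow> ln (ln (max_modulus f r)) / ln r < real p"
    unfolding eventually_at_top_linorder by auto
  define r2 where "r2 = max r2' 2"
  have "bounded (f ` cball 0 r2)"
    by (intro compact_imp_bounded compact_continuous_image holomorphic_on_imp_continuous_on
        holomorphic_on_subset[OF f]) auto
  then obtain B where B: "\<And>z. norm z \<le> r2 \<Longrightarrow> norm (f z) \<le> B" unfolding bounded_iff by (metis imageI mem_cball_0)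
  define c where "c = max 1 B"
  define q where "q = max 2 p"
  have c: "c \<ge> 1" "c \<ge> B" and q: "q \<ge> 2" "q \<ge> p" by (auto simp: c_def q_def)
  have "norm (f z) \<le> exp ((norm z + c) ^ q)" for z
  proof (cases "norm z \<le> r2")
    case True
    have "norm (f z) \<le> (norm z + c) ^ 1" using B[OF True] c(2) norm_ge_zero[of z] by (simp only: power_one_right)
    also have "\<dots> \<le> (norm z + c) ^ q" using c q by (intro power_increasing add_increasing) auto
    also have "\<dots> \<le> exp ((norm z + c) ^ q)" using exp_ge_add_one_self[of "(norm z + c) ^ q"] by linarith
    finally show ?thesis .
  next
    case False
    define r where "r = norm z"
    have r: "r \<ge> r2'" "r \<ge> 2" using False by (auto simp: r2_def r_def)
    show ?thesis
    proof (cases "norm (f z) \<le> 1")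
      case True
      have "(1::real) \<le> exp ((norm z + c) ^ q)" using c by simp
      thus ?thesis using True by linarith
    next
      case False
      define m where "m = max_modulus f r"
      have fm: "norm (f z) \<le> m" using norm_le_max_modulus[OF f, of z] by (simp add: r_def m_def)
      \<comment> \<open>Only for \<open>m > 1\<close> can the iterated logarithm in the order be
        inverted.\<close>
      hence m: "m > 1" using False by simp
      hence lm: "ln m > 0" by simp
      have "ln (ln m) / ln r < real p" using r2'[OF r(1)] by (simp add: m_def)
      hence "ln (ln m) < real p * ln r" using r(2) by (simp add: divide_less_eq)
      also have "\<dots> = ln (r ^ p)" using r(2) by (simp add: ln_realpow)
      finally have "ln m < r ^ p" using lm r(2) by (subst (asm) ln_less_cancel_iff) auto
      also have "\<dots> \<le> r ^ q" using r(2) q by (intro power_increasing) auto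
      also have "\<dots> \<le> (norm z + c) ^ q" using r(2) c by (intro power_mono) (auto simp: r_def)
      finally have "exp (ln m) \<le> exp ((norm z + c) ^ q)" by simp
      thus ?thesis using m fm by simp
    qed
  qed
  thus ?thesis using that[of q c] q c by blast
qed

lemma exp_tower_ge: "real n \<le> (exp ^^ n) (0::real)"
proof (induction n)
  case (Suc n)
  have "1 + (exp ^^ n) 0 \<le> (exp ^^ Suc n) (0::real)"
    using exp_ge_add_one_self[of "(exp ^^ n) (0::real)"] by (simp only: funpow.simps comp_apply)
  thus ?case using Suc by linarith
qed simp

lemma exp_tower_mono: "m \<le> n \<Longrightarrow> (exp ^^ m) (0::real) \<le> (exp ^^ n) 0"
proof (induction n rule: dec_induct)
  case (step n)
  have "1 + (exp ^^ n) 0 \<le> (exp ^^ Suc n) (0::real)"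
    using exp_ge_add_one_self[of "(exp ^^ n) (0::real)"] by (simp only: funpow.simps comp_apply)
  thus ?case using step by linarith
qed simp

text \<open>The induction runs on \<open>2 * q * (norm ((f ^^ n) z) + c) ^ q\<close>, which already
  contains the power occurring in the next exponent. With the factor \<open>2 * q\<close>, raising
  the next value to the power \<open>q\<close> gives only \<open>exp (T n / 2)\<close>; the other
  half of the exponent absorbs the constant \<open>D\<close>, provided that the tower starts at a
  large level \<open>L\<close>.\<close>

lemma finite_order_orbit_bound:
  assumes f: "f holomorphic_on UNIV" and fo: "finite_order f"
  obtains L where "L \<ge> 1" "\<And>z n. norm z \<le> M \<Longrightarrow> norm ((f ^^ n) z) * exp 1 \<le> (exp ^^ (n + L)) (0::real)"
proof -
  obtain q :: nat and c where q: "q \<ge> 2" and c: "c \<ge> 1" and b: "\<And>z. norm (f z) \<le> exp ((norm z + c) ^ q)"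
    using finite_order_bound[OF f fo] by blast
  define D where "D = 2 * real q * (1 + c) ^ q"
  have D: "D \<ge> 1"
  proof -
    have "1 * 1 \<le> 2 * real q * (1 + c) ^ q" using q c by (intro mult_mono) auto
    thus ?thesis by (simp add: D_def)
  qed
  define M' where "M' = max M 0"
  obtain L where L: "real L \<ge> max 1 (max (2 * real q * (M' + c) ^ q) (2 * ln D))"
    using real_arch_simple by blast
  define T where "T n = (exp ^^ (n + L)) (0::real)" for n
  have TL: "T n \<ge> real L" for n
    using exp_tower_ge[of L] exp_tower_mono[of L "n + L"] by (simp add: T_def)
  have inv: "2 * real q * (norm ((f ^^ n) z) + c) ^ q \<le> T n" if z: "norm z \<le> M" for n z
  proof (induction n)
    case 0
    have "2 * real q * (norm z + c) ^ q \<le> 2 * real q * (M' + c) ^ q"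
      using z c by (intro mult_left_mono power_mono) (auto simp: M'_def)
    thus ?case using TL[of 0] L by simp
  next
    case (Suc n)
    define a where "a = norm ((f ^^ n) z)"
    have "norm ((f ^^ Suc n) z) \<le> exp ((a + c) ^ q)" using b by (simp add: a_def)
    also have "\<dots> \<le> exp (T n / (2 * real q))" using Suc q by (simp add: a_def field_simps)
    finally have 1: "norm ((f ^^ Suc n) z) \<le> exp (T n / (2 * real q))" .
    have "1 \<le> exp (T n / (2 * real q))" using TL[of n] by simp
    hence "c \<le> c * exp (T n / (2 * real q))" using c by simp
    with 1 have "norm ((f ^^ Suc n) z) + c \<le> (1 + c) * exp (T n / (2 * real q))"
      by (simp add: distrib_right)
    hence "(norm ((f ^^ Suc n) z) + c) ^ q \<le> ((1 + c) * exp (T n / (2 * real q))) ^ q"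
      using c by (intro power_mono) auto
    also have "\<dots> = (1 + c) ^ q * exp (T n / 2)"
      using q by (simp add: power_mult_distrib flip: exp_of_nat_mult)
    finally have "2 * real q * (norm ((f ^^ Suc n) z) + c) ^ q \<le> D * exp (T n / 2)"
      unfolding D_def using q by simp
    also have "D \<le> exp (T n / 2)"
    proof -
      have "ln D \<le> T n / 2" using L TL[of n] by simp
      hence "exp (ln D) \<le> exp (T n / 2)" by (simp only: exp_le_cancel_iff)
      thus ?thesis using D by simp
    qed
    hence "D * exp (T n / 2) \<le> exp (T n / 2) * exp (T n / 2)" by simp
    also have "\<dots> = T (Suc n)" by (simp add: T_def flip: exp_add)
    finally show ?case .
  qed
  have "norm ((f ^^ n) z) * exp 1 \<le> T n" if z: "norm z \<le> M" for n z
  proof -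
    let ?a = "norm ((f ^^ n) z)"
    have "?a * exp 1 \<le> ?a * 4" using exp_le by (intro mult_left_mono) auto
    also have "\<dots> \<le> 2 * real q * ?a" using q mult_right_mono[of 2 "real q" ?a] by simp
    also have "\<dots> \<le> 2 * real q * (?a + c) ^ 1" using c q by simp
    also have "\<dots> \<le> 2 * real q * (?a + c) ^ q"
      using c q by (intro mult_left_mono power_increasing add_increasing) auto
    finally show ?thesis using inv[OF z, of n] by linarith
  qed
  moreover have "L \<ge> 1" using L by simp
  ultimately show thesis using that[of L] unfolding T_def by blast
qed

lemma sum_shift_unbounded:
  fixes h :: "nat \<Rightarrow> real"
  assumes "filterlim (\<lambda>n. \<Sum>k=1..n. h k) at_top sequentially" and L: "L \<ge> 1"
  obtains N where "(\<Sum>n<N. h (n + L)) > B"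
proof -
  let ?C = "\<Sum>k=1..L-1. h k"
  have "eventually (\<lambda>n. (\<Sum>k=1..n. h k) > B + ?C) sequentially"
    using assms(1) unfolding filterlim_at_top_dense by blast
  then obtain N where N: "\<And>n. n \<ge> N \<Longrightarrow> (\<Sum>k=1..n. h k) > B + ?C"
    unfolding eventually_sequentially by auto
  have "(\<Sum>k=1..N+L-1. h k) = ?C + (\<Sum>n<N. h (n + L))"
  proof -
    have "{1..N+L-1} = {1..L-1} \<union> {L..<N+L}" using L by auto
    hence "(\<Sum>k=1..N+L-1. h k) = ?C + (\<Sum>k=L..<N+L. h k)"
      using L by (simp only:) (subst sum.union_disjoint, auto)
    also have "(\<Sum>k=L..<N+L. h k) = (\<Sum>n<N. h (n + L))"
      using sum.shift_bounds_nat_ivl[of h 0 L N] by (simp add: lessThan_atLeast0)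
    finally show ?thesis .
  qed
  thus thesis using N[of "N + L - 1"] L that[of N] by simp
qed

lemma sum_measure_disjoint_le:
  assumes G: "\<And>n. G n \<in> sets lebesgue" "disjoint_family (G :: nat \<Rightarrow> complex set)"
  shows "(\<Sum>n<N. measure lebesgue (G n \<inter> cball 0 r)) \<le> measure lebesgue (cball (0::complex) r)"
proof -
  have lm: "G n \<inter> cball 0 r \<in> lmeasurable" for n
    by (rule fmeasurable_Int_fmeasurable[of "cball 0 r", simplified Int_commute]) (use G in auto)
  have "(\<Sum>n<N. measure lebesgue (G n \<inter> cball 0 r)) = measure lebesgue (\<Union>n<N. G n \<inter> cball 0 r)"
    using G lm by (intro measure_UNION'[symmetric]) 
      (auto simp: pairwise_def disjnt_def disjoint_family_on_def)
  also have "\<dots> \<le> measure lebesgue (cball (0::complex) r)"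
  proof (rule measure_mono_fmeasurable)
    show "(\<Union>n<N. G n \<inter> cball 0 r) \<in> sets lebesgue" using lm by (intro sets.finite_UN) auto
  qed auto
  finally show ?thesis .
qed

section \<open>Surviving and escaping points form null sets\<close>

context thin_tracts
begin

lemma surviving_set_null:
  assumes fo: "finite_order f" and ev: "\<And>r. r \<ge> R0 \<Longrightarrow> \<theta>0 r \<le> theta f r0 r"
    and mono: "\<And>x y. 0 < x \<Longrightarrow> x \<le> y \<Longrightarrow> \<theta>0 y \<le> \<theta>0 x" and pos: "\<And>x. 0 < x \<Longrightarrow> 0 < \<theta>0 x"
    and div: "filterlim (\<lambda>n. \<Sum>k=1..n. \<theta>0 ((exp ^^ k) 0)) at_top sequentially"
  shows "negligible {z. \<forall>k. norm ((f ^^ k) z) > R}"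
proof -
  define A where "A M = {z. \<forall>k. norm ((f ^^ k) z) > R} \<inter> cball 0 (real M)" for M
  obtain K where K: "K \<ge> 1" and prt: "\<And>z n \<tau>. (\<forall>k\<le>n. norm ((f ^^ k) z) > R) \<Longrightarrow> \<tau> \<ge> 0 \<Longrightarrow>
      (\<And>r. norm ((f ^^ n) z) < r * exp 1 \<Longrightarrow> r < norm ((f ^^ n) z) * exp 1 \<Longrightarrow> theta f r0 r \<ge> \<tau>) \<Longrightarrow>
      \<exists>\<rho>. 0 < \<rho> \<and> \<rho> \<le> K * norm z \<and> 2 * \<tau> / K ^ 3 * \<rho>\<^sup>2 \<le> measure lebesgue (exit_set n \<inter> cball z \<rho>)"
    using exit_set_proportion by metis
  have "negligible (A M)" for M
  proof -
    obtain L where L: "L \<ge> 1" and gr: "\<And>z n. norm z \<le> real M \<Longrightarrow> norm ((f ^^ n) z) * exp 1 \<le> (exp ^^ (n + L)) (0::real)"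
      using finite_order_orbit_bound[OF f fo] by metis
    define T where "T n = (exp ^^ (n + L)) (0::real)" for n
    have T: "T n > 0" for n using exp_tower_ge[of "n + L"] L by (simp add: T_def)
    define \<tau> where "\<tau> n = \<theta>0 (T n)" for n
    have \<tau>: "\<tau> n > 0" for n using pos T by (simp add: \<tau>_def)
    define B where "B = cball (0::complex) (real M + K * real M)"
    have key: "emeasure lebesgue (A M) \<le> ennreal (25 * pi / (2 * \<tau> n / K ^ 3)) * emeasure lebesgue (exit_set n \<inter> B)" for n
      unfolding B_def
    proof (rule emeasure_le_of_proportional_balls)
      show "0 < 2 * \<tau> n / K ^ 3" using \<tau>[of n] K by simp
      fix z assume z: "z \<in> A M"
      \<comment> \<open>The lower side of the factor e is covered by
        \<open>R0 * exp 1 \<le> R\<close>, the upper side by the factor \<open>exp 1\<close> in the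
        orbit bound; monotonicity then replaces \<open>\<theta>0 r\<close> by its value at the
        tower.\<close>
      have "theta f r0 r \<ge> \<tau> n" if r: "norm ((f ^^ n) z) < r * exp 1" "r < norm ((f ^^ n) z) * exp 1" for r
      proof -
        have "R < norm ((f ^^ n) z)" using z by (simp add: A_def)
        hence "R0 * exp 1 < r * exp 1" using r(1) R(2) by linarith
        hence rR: "r > R0" by simp
        have "r \<le> T n" using r(2) gr[of z n] z by (simp add: A_def T_def)
        hence "\<tau> n \<le> \<theta>0 r" unfolding \<tau>_def using rR R0 by (intro mono) auto
        thus ?thesis using ev[of r] rR by simp
      qed
      then obtain \<rho> where \<rho>: "0 < \<rho>" "\<rho> \<le> K * norm z" "2 * \<tau> n / K ^ 3 * \<rho>\<^sup>2 \<le> measure lebesgue (exit_set n \<inter> cball z \<rho>)"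
        using prt[of n z "\<tau> n"] z \<tau>[of n] by (force simp: A_def)
      have "K * norm z \<le> K * real M" using z K by (intro mult_left_mono) (auto simp: A_def)
      thus "\<exists>\<rho>. 0 < \<rho> \<and> \<rho> \<le> K * real M \<and> 2 * \<tau> n / K ^ 3 * \<rho>\<^sup>2 \<le> measure lebesgue (exit_set n \<inter> cball z \<rho>)"
        using \<rho> by (intro exI[of _ \<rho>]) auto
    qed (use open_exit_set in \<open>auto simp: A_def\<close>)
    have efin: "emeasure lebesgue X = ennreal (measure lebesgue X)" if "X \<subseteq> cball (0::complex) r" "r \<ge> 0" for X r
    proof -
      have "emeasure lebesgue X \<le> emeasure lebesgue (cball (0::complex) r)"
        using that by (intro emeasure_mono) auto
      also have "\<dots> < \<infinity>" using that by (subst emeasure_lebesgue_cball_complex) auto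
      finally show ?thesis by (intro emeasure_eq_ennreal_measure) auto
    qed
    define m where "m = measure lebesgue (A M)"
    have em: "emeasure lebesgue (A M) = ennreal m" unfolding m_def
      by (rule efin[of _ "real M"]) (auto simp: A_def)
    define C where "C = 25 * pi * K ^ 3 / 2"
    have step: "m * \<tau> n \<le> C * measure lebesgue (exit_set n \<inter> B)" for n
    proof -
      have "emeasure lebesgue (exit_set n \<inter> B) = ennreal (measure lebesgue (exit_set n \<inter> B))"
        by (rule efin[of _ "real M + K * real M"]) (use K in \<open>auto simp: B_def\<close>)
      hence "ennreal m \<le> ennreal (25 * pi / (2 * \<tau> n / K ^ 3) * measure lebesgue (exit_set n \<inter> B))"
        using key[of n] \<tau>[of n] K by (subst ennreal_mult) (auto simp: em)
      hence "m \<le> 25 * pi / (2 * \<tau> n / K ^ 3) * measure lebesgue (exit_set n \<inter> B)"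
        using \<tau>[of n] K by (subst (asm) ennreal_le_iff) auto
      hence "m * \<tau> n \<le> 25 * pi / (2 * \<tau> n / K ^ 3) * measure lebesgue (exit_set n \<inter> B) * \<tau> n"
        using \<tau>[of n] by (intro mult_right_mono) auto
      also have "\<dots> = C * measure lebesgue (exit_set n \<inter> B)" using \<tau>[of n] K by (simp add: C_def)
      finally show ?thesis .
    qed
    have bound: "m * (\<Sum>n<N. \<tau> n) \<le> C * measure lebesgue B" for N
    proof -
      have "m * (\<Sum>n<N. \<tau> n) \<le> (\<Sum>n<N. C * measure lebesgue (exit_set n \<inter> B))"
        unfolding sum_distrib_left by (intro sum_mono step)
      also have "\<dots> = C * (\<Sum>n<N. measure lebesgue (exit_set n \<inter> B))" by (simp add: sum_distrib_left)
      also have "\<dots> \<le> C * measure lebesgue B" unfolding B_def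
        using K open_exit_set disjoint_exit_set
        by (intro mult_left_mono sum_measure_disjoint_le) (auto simp: C_def)
      finally show ?thesis .
    qed
    have "m = 0"
    proof (rule ccontr)
      assume "m \<noteq> 0"
      hence m: "m > 0" by (simp add: m_def zero_less_measure_iff)
      obtain N where "(\<Sum>n<N. \<theta>0 ((exp ^^ (n + L)) 0)) > C * measure lebesgue B / m"
        using sum_shift_unbounded[OF div L] by blast
      hence "(\<Sum>n<N. \<tau> n) > C * measure lebesgue B / m" by (simp add: \<tau>_def T_def)
      hence "m * (\<Sum>n<N. \<tau> n) > C * measure lebesgue B" using m by (simp add: divide_less_eq mult.commute)
      thus False using bound[of N] by simp
    qed
    hence "emeasure lebesgue (A M) = 0" using em by simp
    \<comment> \<open>Vanishing of \<open>emeasure\<close> means a null set only once measurability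
      is known, since non-measurable sets have the default value 0.\<close>
    moreover have "A M \<in> sets lebesgue"
    proof -
      have "A M = (\<Inter>k. {z. norm ((f ^^ k) z) > R}) \<inter> cball 0 (real M)" by (auto simp: A_def)
      moreover have "open {z. norm ((f ^^ k) z) > R}" for k
        by (intro open_Collect_less continuous_intros continuous_on_funpow[OF holomorphic_on_imp_continuous_on[OF f]])
      ultimately show ?thesis by (auto intro!: sets.Int sets.countable_INT)
    qed
    ultimately show ?thesis by (simp add: negligible_iff_null_sets null_sets_def)
  qed
  hence "negligible (\<Union>M. A M)" by (rule negligible_Union_nat)
  moreover have "(\<Union>M. A M) = {z. \<forall>k. norm ((f ^^ k) z) > R}"
    by (auto simp: A_def) (meson real_arch_simple)
  ultimately show ?thesis by simp
qed

lemma escaping_set_null: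
  assumes null: "negligible {z. \<forall>k. norm ((f ^^ k) z) > R}" and nc: "deriv f z0 \<noteq> 0"
  shows "negligible (escaping_set f)"
proof -
  let ?A = "{z. \<forall>k. norm ((f ^^ k) z) > R}"
  have neg: "negligible ((f ^^ N) -` ?A)" for N
  proof (induction N)
    case (Suc N)
    have "(f ^^ Suc N) -` ?A = f -` ((f ^^ N) -` ?A)" by (simp only: funpow_Suc_right vimage_comp)
    thus ?case using negligible_vimage_holomorphic[OF f nc Suc] by simp
  qed (simp add: null vimage_def)
  have "escaping_set f \<subseteq> (\<Union>N. (f ^^ N) -` ?A)"
  proof
    fix z assume "z \<in> escaping_set f"
    hence "filterlim (\<lambda>n. (f ^^ n) z) at_infinity sequentially" by (simp add: escaping_set_def)
    hence "eventually (\<lambda>n. norm ((f ^^ n) z) > R) sequentially"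
      using filterlim_at_infinity_imp_norm_at_top[of "\<lambda>n. (f ^^ n) z"] by (simp add: filterlim_at_top_dense)
    then obtain N where N: "\<And>n. n \<ge> N \<Longrightarrow> norm ((f ^^ n) z) > R" unfolding eventually_sequentially by auto
    have "norm ((f ^^ k) ((f ^^ N) z)) > R" for k
      using N[of "k + N"] by (simp add: funpow_add)
    thus "z \<in> (\<Union>N. (f ^^ N) -` ?A)" by auto
  qed
  thus ?thesis using negligible_Union_nat[OF neg] by (rule negligible_subset[rotated])
qed

end

section \<open>Normal families\<close>

lemma normal_family_on_bounded:
  assumes U: "open U" and hol: "\<And>h. h \<in> F \<Longrightarrow> h holomorphic_on U"
    and B: "\<And>h z. h \<in> F \<Longrightarrow> z \<in> U \<Longrightarrow> norm (h z) \<le> B"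
  shows "normal_family_on U F"
  unfolding normal_family_on_def
proof (intro allI impI)
  fix s :: "nat \<Rightarrow> complex \<Rightarrow> complex" assume s: "range s \<subseteq> F"
  obtain g r where r: "strict_mono r"
    and lim: "\<And>K. compact K \<Longrightarrow> K \<subseteq> U \<Longrightarrow> uniform_limit K (s \<circ> r) g sequentially"
    by (rule Montel[OF U hol _ s]) (use B in blast)+
  show "\<exists>r. strict_mono r \<and>
    ((\<exists>g. \<forall>K. compact K \<and> K \<subseteq> U \<longrightarrow> uniform_limit K (\<lambda>j. s (r j)) g sequentially) \<or>
     (\<forall>K. compact K \<and> K \<subseteq> U \<longrightarrow> (\<forall>B. \<forall>\<^sub>F j in sequentially. \<forall>z\<in>K. B < norm (s (r j) z))))"
    using r lim by (intro exI[of _ r] conjI disjI1 exI[of _ g]) (auto simp: o_def)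
qed

text \<open>Montel's theorem applies to the bounded functions \<open>1 / (h - a)\<close>. By
  Hurwitz, a limit either vanishes identically, and then the original functions tend to infinity, or
  has no zeros, and then inversion gives a finite limit.\<close>

lemma normal_family_on_omitting_disc:
  assumes U: "open U" "connected U" and hol: "\<And>h. h \<in> F \<Longrightarrow> h holomorphic_on U"
    and e: "e > 0" and om: "\<And>h z. h \<in> F \<Longrightarrow> z \<in> U \<Longrightarrow> e \<le> norm (h z - a)"
  shows "normal_family_on U F"
  unfolding normal_family_on_def
proof (intro allI impI)
  fix s :: "nat \<Rightarrow> complex \<Rightarrow> complex" assume s: "range s \<subseteq> F"
  define H where "H n z = inverse (s n z - a)" for n z
  define \<H> where "\<H> = {h. h holomorphic_on U \<and> (\<forall>z\<in>U. norm (h z) \<le> 1 / e)}"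
  have sF: "s n \<in> F" for n using s by auto
  have nz: "s n z - a \<noteq> 0" if "z \<in> U" for n z using om[OF sF that, of n] e by auto
  have Hhol: "H n holomorphic_on U" for n
    unfolding H_def using nz hol[OF sF] by (intro holomorphic_intros) auto
  have "norm (H n z) \<le> 1 / e" if "z \<in> U" for n z
    using le_imp_inverse_le[OF om[OF sF that, of n] e] unfolding H_def norm_inverse by (simp add: inverse_eq_divide)
  hence rH: "range H \<subseteq> \<H>" using Hhol by (auto simp: \<H>_def)
  have bd: "\<exists>B. \<forall>h\<in>\<H>. \<forall>z\<in>K. norm (h z) \<le> B" if "K \<subseteq> U" for K
    using that unfolding \<H>_def by blast
  have Hh: "h holomorphic_on U" if "h \<in> \<H>" for h using that by (simp add: \<H>_def)
  obtain g r where g: "g holomorphic_on U" and r: "strict_mono r"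
    and lim: "\<And>K. compact K \<Longrightarrow> K \<subseteq> U \<Longrightarrow> uniform_limit K (H \<circ> r) g sequentially"
    by (rule Montel[OF U(1) Hh bd rH]) auto
  have s_eq: "s n z = inverse (H n z) + a" if "z \<in> U" for n z by (simp add: H_def)
  show "\<exists>r. strict_mono r \<and>
    ((\<exists>g. \<forall>K. compact K \<and> K \<subseteq> U \<longrightarrow> uniform_limit K (\<lambda>j. s (r j)) g sequentially) \<or>
     (\<forall>K. compact K \<and> K \<subseteq> U \<longrightarrow> (\<forall>B. \<forall>\<^sub>F j in sequentially. \<forall>z\<in>K. B < norm (s (r j) z))))"
  proof (cases "\<forall>z\<in>U. g z = 0")
    case True
    have "\<forall>\<^sub>F j in sequentially. \<forall>z\<in>K. B < norm (s (r j) z)" if K: "compact K" "K \<subseteq> U" for K B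
    proof -
      define b where "b = \<bar>B\<bar> + norm a + 1"
      have b: "b > 0" by (simp add: b_def add_nonneg_pos)
      have "\<forall>\<^sub>F j in sequentially. \<forall>z\<in>K. dist ((H \<circ> r) j z) (g z) < 1 / b"
        using uniform_limitD[OF lim[OF K], of "1 / b"] b by simp
      thus ?thesis
      proof eventually_elim
        case (elim j)
        show ?case
        proof
          fix z assume z: "z \<in> K"
          hence zU: "z \<in> U" using K by auto
          have "norm (inverse (s (r j) z - a)) < 1 / b" using elim z True zU by (auto simp: H_def)
          hence "inverse (norm (s (r j) z - a)) < inverse b" by (simp only: norm_inverse inverse_eq_divide[of b])
          hence "b < norm (s (r j) z - a)" using nz[OF zU, of "r j"] by (intro inverse_less_imp_less[of _ b]) auto
          also have "\<dots> \<le> norm (s (r j) z) + norm a" by (rule norm_triangle_ineq4)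
          finally show "B < norm (s (r j) z)" by (simp add: b_def)
        qed
      qed
    qed
    thus ?thesis using r by blast
  next
    case False
    have gnz: "g z \<noteq> 0" if z: "z \<in> U" for z
    proof (cases "g constant_on U")
      case True thus ?thesis using False z by (auto simp: constant_on_def)
    next
      case nonconst: False
      show ?thesis
        by (rule Hurwitz_no_zeros[OF U, of "H \<circ> r" g]) (use Hhol g lim nonconst nz z in \<open>auto simp: H_def\<close>)
    qed
    have "uniform_limit K (\<lambda>j. s (r j)) (\<lambda>z. inverse (g z) + a) sequentially" if K: "compact K" "K \<subseteq> U" for K
    proof (cases "K = {}")
      case True thus ?thesis by simp
    next
      case False
      have "continuous_on K (\<lambda>z. norm (g z))"
        using g K by (intro continuous_intros holomorphic_on_imp_continuous_on) (rule holomorphic_on_subset)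
      then obtain z0 where z0: "z0 \<in> K" "\<And>z. z \<in> K \<Longrightarrow> norm (g z0) \<le> norm (g z)"
        using continuous_attains_inf[OF K(1) False] by blast
      have "uniform_limit K (\<lambda>j z. inverse ((H \<circ> r) j z)) (inverse \<circ> g) sequentially"
        by (rule uniform_lim_inverse[OF lim[OF K], of "norm (g z0)"]) (use z0 gnz K in auto)
      hence "uniform_limit K (\<lambda>j z. inverse ((H \<circ> r) j z) + a) (\<lambda>z. (inverse \<circ> g) z + a) sequentially"
        by (intro uniform_limit_add uniform_limit_const)
      thus ?thesis by (simp add: H_def o_def)
    qed
    thus ?thesis using r by (intro exI[of _ r] conjI disjI1 exI[of _ "\<lambda>z. inverse (g z) + a"]) auto
  qed
qed

text \<open>The image of the unit disc contains a neighbourhood of \<open>f 0\<close>, which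
  injectivity forbids \<open>f\<close> to enter outside that disc. Hence
  \<open>1 / (f - f 0)\<close> is bounded near infinity and extends there, and \<open>f\<close> is a
  polynomial.\<close>

lemma injective_entire_not_transcendental:
  assumes f: "f holomorphic_on UNIV" and inj: "inj f"
  shows "\<not> transcendental_entire f"
proof -
  have "open (f ` ball 0 1)"
    by (rule open_mapping_thm3[OF holomorphic_on_subset[OF f subset_UNIV] open_ball inj_on_subset[OF inj subset_UNIV]])
  moreover have "f 0 \<in> f ` ball 0 1" by (rule imageI) simp
  ultimately obtain e where e: "e > 0" "ball (f 0) e \<subseteq> f ` ball 0 1" using openE by blast
  define h where "h z = f z - f 0" for z
  have h: "h holomorphic_on UNIV" unfolding h_def by (intro holomorphic_intros f)
  have big: "norm (h z) \<ge> e" if "norm z \<ge> 1" for z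
  proof (rule ccontr)
    assume "\<not> ?thesis"
    hence "f z \<in> f ` ball 0 1" using e(2) by (auto simp: h_def dist_norm norm_minus_commute)
    then obtain x where "f z = f x" "x \<in> ball 0 1" by blast
    moreover from this(1) have "z = x" using inj by (rule injD[rotated])
    ultimately show False using that by simp
  qed
  define k where "k w = inverse (h (inverse w))" for w
  have "k holomorphic_on ball 0 1 - {0}" unfolding k_def
  proof (intro holomorphic_intros holomorphic_on_compose_gen[OF _ h, unfolded o_def])
    fix w :: complex assume "w \<in> ball 0 1 - {0}"
    hence "norm (inverse w) \<ge> 1" unfolding norm_inverse by (intro one_le_inverse) auto
    thus "h (inverse w) \<noteq> 0" using big e by force
  qed auto
  moreover have "eventually (\<lambda>w. norm (k w) \<le> 1 / e) (at 0)"
    unfolding eventually_at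
  proof (intro exI[of _ 1] conjI ballI impI)
    fix w :: complex assume "w \<noteq> 0 \<and> dist w 0 < 1"
    hence "norm (inverse w) \<ge> 1" unfolding norm_inverse by (intro one_le_inverse) auto
    from le_imp_inverse_le[OF big[OF this] e(1)] show "norm (k w) \<le> 1 / e"
      unfolding k_def norm_inverse by (simp add: inverse_eq_divide)
  qed simp
  ultimately obtain k' where k': "k' holomorphic_on ball 0 1" "\<And>w. w \<in> ball 0 1 - {0} \<Longrightarrow> k' w = k w"
    using holomorphic_on_extend_bounded[of k "ball 0 1" 0] by auto
  have "isCont k' 0" using k'(1) by (meson centre_in_ball continuous_on_eq_continuous_at holomorphic_on_imp_continuous_on open_ball zero_less_one)
  hence "(k' \<longlongrightarrow> k' 0) (at 0)" by (simp add: isCont_def)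
  hence "(k \<longlongrightarrow> k' 0) (at 0)"
    by (rule Lim_transform_within_open[of _ _ _ _ "ball 0 1"]) (use k' in auto)
  hence "((inverse \<circ> h) \<longlongrightarrow> k' 0) at_infinity"
    unfolding lim_at_infinity_0 by (simp add: k_def[abs_def] o_def)
  then obtain c n where c: "\<And>z. h z = (\<Sum>i\<le>n. c i * z ^ i)" using pole_at_infinity[OF h] by metis
  have "f z = (\<Sum>i\<le>n. (c i + (if i = 0 then f 0 else 0)) * z ^ i)" for z
  proof -
    have "(\<Sum>i\<le>n. (if i = 0 then f 0 else 0) * z ^ i) = (\<Sum>i\<in>{0}. (if i = 0 then f 0 else 0) * z ^ i)"
      by (rule sum.mono_neutral_right) auto
    hence "(\<Sum>i\<le>n. (c i + (if i = 0 then f 0 else 0)) * z ^ i) = h z + f 0"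
      unfolding distrib_right sum.distrib c by simp
    thus ?thesis by (simp add: h_def)
  qed
  hence "\<exists>n c. \<forall>z. f z = (\<Sum>k\<le>n. c k * z ^ k)"
    by (intro exI[of _ n] exI[of _ "\<lambda>i. c i + (if i = 0 then f 0 else 0)"]) blast
  thus ?thesis unfolding transcendental_entire_def by blast
qed

text \<open>Without singular values the identity lifts through \<open>f\<close> over arbitrarily
  large discs, and by uniqueness the lift is a left inverse of \<open>f\<close>, so \<open>f\<close>
  would be injective. It guarantees that a hyperbolic function has an attracting cycle, as the
  condition on singular values is then not vacuous.\<close>

lemma singular_values_nonempty:
  assumes tr: "transcendental_entire f" shows "singular_values f \<noteq> {}"
proof
  assume S: "singular_values f = {}"
  have f: "f holomorphic_on UNIV" using tr by (simp add: transcendental_entire_def)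
  have dnz: "deriv f z \<noteq> 0" for z using deriv_nonzero_off_singular_values S by blast
  have "inj f"
  proof (rule injI)
    fix a b assume ab: "f a = f b"
    define r where "r = 1 + norm a + norm b"
    have r: "a \<in> ball 0 r" "b \<in> ball 0 r" by (auto simp: r_def add_nonneg_pos add_pos_nonneg)
    have "bounded (f ` cball 0 r)"
      by (intro compact_imp_bounded compact_continuous_image holomorphic_on_imp_continuous_on
          holomorphic_on_subset[OF f]) auto
    then obtain d where d: "d > 0" "f ` cball 0 r \<subseteq> ball (f a) d"
      using bounded_subset_ballD by blast
    obtain g where g: "g holomorphic_on ball (f a) d" "g (f a) = a" "\<And>w. w \<in> ball (f a) d \<Longrightarrow> f (g w) = w"
    proof (rule lift_on_ball[OF f holomorphic_on_ident d(1), of "f a" a])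
      show "w \<notin> singular_values f" for w using S by simp
    qed auto
    have im: "f z \<in> ball (f a) d" if "z \<in> ball 0 r" for z
      using d(2) that ball_subset_cball by blast
    have gf: "(\<lambda>z. g (f z)) holomorphic_on ball 0 r"
      by (rule holomorphic_on_compose_gen[OF holomorphic_on_subset[OF f] g(1), unfolded o_def]) (use im in auto)
    have ga: "g (f a) = a" "deriv f (g (f a)) \<noteq> 0" using g(2) dnz by auto
    have "f (g (f w)) = f w" if "w \<in> ball 0 r" for w using g(3)[OF im[OF that]] .
    hence "g (f b) = b"
      by (intro lift_unique[where k = "\<lambda>z. g (f z)" and l = "\<lambda>z. z" and U = "ball 0 r" and f = f and a = a and w = b])
         (rule open_ball connected_ball gf holomorphic_on_ident f r ga | assumption)+
    thus "a = b" using ab g(2) by metis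
  qed
  from injective_entire_not_transcendental[OF f this] tr show False ..
qed

section \<open>Attracting cycles and the postsingular set\<close>

lemma funpow_add_apply: "(f ^^ (m + n)) x = (f ^^ m) ((f ^^ n) x)"
  by (simp add: funpow_add)

lemma isCont_entire: "f holomorphic_on UNIV \<Longrightarrow> isCont f z"
  by (meson UNIV_I continuous_on_eq_continuous_at holomorphic_on_imp_continuous_on open_UNIV)

text \<open>An attracting cycle is used only through such a disc, which is mapped strictly inside
  itself after one period.\<close>

definition trap :: "(complex \<Rightarrow> complex) \<Rightarrow> complex \<Rightarrow> nat \<Rightarrow> real \<Rightarrow> bool" where
  "trap f z p e \<longleftrightarrow> p \<ge> 1 \<and> e > 0 \<and> (f ^^ p) ` cball z e \<subseteq> ball z e"

text \<open>Collecting the images over one period turns invariance under the \<open>p\<close>-th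
  iterate into invariance under \<open>f\<close>, and keeps compactness.\<close>

definition trap_hull :: "(complex \<Rightarrow> complex) \<Rightarrow> complex \<Rightarrow> nat \<Rightarrow> real \<Rightarrow> complex set" where
  "trap_hull f z p e = (\<Union>j<p. (f ^^ j) ` cball z e)"

text \<open>Plays the role of the union of all attracting basins. In this form it is open and
  completely invariant by inspection.\<close>

definition captured :: "(complex \<Rightarrow> complex) \<Rightarrow> complex set" where
  "captured f = {v. \<exists>z p e m. trap f z p e \<and> (f ^^ m) v \<in> ball z e}"

lemma attracting_trap:
  assumes f: "f holomorphic_on UNIV" and att: "attracting_periodic f z p"
  obtains e where "trap f z p e"
proof -
  define g where "g = f ^^ p"
  define c where "c = norm (deriv g z)"
  have p: "p \<ge> 1" and gz: "g z = z" and c: "c < 1" "c \<ge> 0"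
    using att by (auto simp: attracting_periodic_def g_def c_def)
  have "g holomorphic_on UNIV" unfolding g_def by (rule holomorphic_on_funpow[OF f])
  hence d: "(g has_field_derivative deriv g z) (at z)" by (rule holomorphic_derivI) auto
  define b where "b = (1 - c) / 2"
  have b: "b > 0" "c + b < 1" using c by (auto simp: b_def field_simps)
  obtain \<delta> where \<delta>: "\<delta> > 0" "\<And>y. norm (y - z) < \<delta> \<Longrightarrow> norm (g y - g z - deriv g z * (y - z)) \<le> b * norm (y - z)"
    using d b(1) unfolding has_field_derivative_def has_derivative_at_alt by metis
  define e where "e = \<delta> / 2"
  have e: "e > 0" "e < \<delta>" using \<delta> by (auto simp: e_def)
  have "g y \<in> ball z e" if y: "y \<in> cball z e" for y
  proof -
    have ny: "norm (y - z) \<le> e" using y by (simp add: dist_norm norm_minus_commute)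
    have "norm (g y - z) \<le> norm (g y - g z - deriv g z * (y - z)) + norm (deriv g z * (y - z))"
      using norm_triangle_ineq[of "g y - g z - deriv g z * (y - z)" "deriv g z * (y - z)"] gz by simp
    also have "\<dots> \<le> b * norm (y - z) + c * norm (y - z)"
      using \<delta>(2)[of y] ny e by (simp add: norm_mult c_def)
    also have "\<dots> = (c + b) * norm (y - z)" by (simp add: algebra_simps)
    also have "\<dots> \<le> (c + b) * e" using ny c b by (intro mult_left_mono) auto
    also have "\<dots> < e" using b e by simp
    finally show ?thesis by (simp add: dist_norm norm_minus_commute)
  qed
  hence "trap f z p e" using p e unfolding trap_def g_def by blast
  thus ?thesis by (rule that)
qed

lemma trap_hull_invariant:
  assumes t: "trap f z p e" and v: "v \<in> trap_hull f z p e"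
  shows "f v \<in> trap_hull f z p e"
proof -
  obtain j x where j: "j < p" "x \<in> cball z e" "v = (f ^^ j) x" using v by (auto simp: trap_hull_def)
  show ?thesis
  proof (cases "Suc j < p")
    case True
    hence "f v = (f ^^ Suc j) x" "Suc j \<in> {..<p}" using j by simp_all
    thus ?thesis unfolding trap_hull_def using j(2) by blast
  next
    case False
    hence "p = Suc j" using j by simp
    hence "f v = (f ^^ p) x" using j by simp
    hence "f v \<in> cball z e" using t j(2) ball_subset_cball unfolding trap_def by blast
    hence "f v \<in> (f ^^ 0) ` cball z e" by simp
    moreover have "0 < p" using j by simp
    ultimately show ?thesis unfolding trap_hull_def by blast
  qed
qed

lemma trap_hull_funpow_invariant:
  assumes t: "trap f z p e" and v: "v \<in> trap_hull f z p e"
  shows "(f ^^ k) v \<in> trap_hull f z p e"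
  by (induction k) (use v trap_hull_invariant[OF t] in simp_all)

lemma cball_subset_trap_hull: "trap f z p e \<Longrightarrow> cball z e \<subseteq> trap_hull f z p e"
proof -
  assume "trap f z p e"
  hence "0 \<in> {..<p}" by (simp add: trap_def)
  moreover have "cball z e = (f ^^ 0) ` cball z e" by simp
  ultimately show ?thesis unfolding trap_hull_def by blast
qed

lemma compact_funpow_image:
  assumes "f holomorphic_on UNIV" "compact C" shows "compact ((f ^^ j) ` C)"
  by (intro compact_continuous_image holomorphic_on_imp_continuous_on
      holomorphic_on_subset[OF holomorphic_on_funpow[OF assms(1)]] assms(2)) auto

lemma compact_trap_hull: "f holomorphic_on UNIV \<Longrightarrow> compact (trap_hull f z p e)"
  unfolding trap_hull_def by (intro compact_UN compact_funpow_image) auto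

lemma open_funpow_vimage:
  assumes "f holomorphic_on UNIV" "open B" shows "open ((f ^^ m) -` B)"
  by (rule open_vimage[OF assms(2) holomorphic_on_imp_continuous_on[OF holomorphic_on_funpow[OF assms(1)]]])

lemma open_captured:
  assumes "f holomorphic_on UNIV" shows "open (captured f)"
proof -
  have "captured f = \<Union>{(f ^^ m) -` ball z e |z p e m. trap f z p e}"
    unfolding captured_def by blast
  moreover have "open \<dots>" using open_funpow_vimage[OF assms open_ball] by blast
  ultimately show ?thesis by simp
qed

lemma captured_image_iff:
  assumes "f holomorphic_on UNIV"
  shows "f v \<in> captured f \<longleftrightarrow> v \<in> captured f"
proof
  assume "f v \<in> captured f"
  then obtain z p e m where "trap f z p e" "(f ^^ m) (f v) \<in> ball z e" by (auto simp: captured_def)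
  hence "trap f z p e" "(f ^^ Suc m) v \<in> ball z e" by (auto simp: funpow_Suc_right simp del: funpow.simps)
  thus "v \<in> captured f" unfolding captured_def by blast
next
  assume "v \<in> captured f"
  then obtain z p e m where t: "trap f z p e" and m: "(f ^^ m) v \<in> ball z e" by (auto simp: captured_def)
  have "\<exists>m. (f ^^ m) (f v) \<in> ball z e"
  proof (cases m)
    \<comment> \<open>There is no iterate to drop; the orbit is followed once more around the period
      instead.\<close>
    case 0
    then obtain p' where p': "p = Suc p'" using t by (cases p) (auto simp: trap_def)
    have "(f ^^ p) v \<in> ball z e" using t m 0 ball_subset_cball unfolding trap_def by (metis funpow_0 image_subset_iff subsetD)
    thus ?thesis unfolding p' by (intro exI[of _ p']) (simp add: funpow_Suc_right del: funpow.simps)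
  next
    case (Suc m')
    thus ?thesis using m by (intro exI[of _ m']) (simp add: funpow_Suc_right del: funpow.simps)
  qed
  thus "f v \<in> captured f" using t unfolding captured_def by blast
qed

lemma captured_funpow_iff:
  assumes "f holomorphic_on UNIV"
  shows "(f ^^ n) v \<in> captured f \<longleftrightarrow> v \<in> captured f"
  by (induction n) (simp_all add: captured_image_iff[OF assms])

lemma trap_hull_subset_captured:
  assumes f: "f holomorphic_on UNIV" and t: "trap f z p e"
  shows "trap_hull f z p e \<subseteq> captured f"
proof
  fix v assume "v \<in> trap_hull f z p e"
  then obtain j x where "x \<in> cball z e" "v = (f ^^ j) x" by (auto simp: trap_hull_def)
  moreover from this(1) have "(f ^^ p) x \<in> ball z e" using t unfolding trap_def by blast
  hence "x \<in> captured f" using t unfolding captured_def by blast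
  ultimately show "v \<in> captured f" using captured_funpow_iff[OF f] by simp
qed

text \<open>Finitely many images before the capture, and the trap hull afterwards, contain the
  entire orbit of a neighbourhood. One compact set for all times serves both normality and the bound
  on the postsingular set.\<close>

lemma captured_orbit_compact:
  assumes f: "f holomorphic_on UNIV" and v: "v \<in> captured f"
  obtains r C where "r > 0" "compact C" "C \<subseteq> captured f" "\<And>k. (f ^^ k) ` ball v r \<subseteq> C"
proof -
  obtain z p e m where t: "trap f z p e" and m: "(f ^^ m) v \<in> ball z e" using v by (auto simp: captured_def)
  have "open ((f ^^ m) -` ball z e)" by (rule open_funpow_vimage[OF f open_ball])
  moreover have "v \<in> (f ^^ m) -` ball z e" using m by simp
  ultimately obtain r where r: "r > 0" "cball v r \<subseteq> (f ^^ m) -` ball z e"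
    using open_contains_cball by blast
  define C where "C = (\<Union>k<m. (f ^^ k) ` cball v r) \<union> trap_hull f z p e"
  have "compact C" unfolding C_def
    by (intro compact_Un compact_UN compact_funpow_image[OF f] compact_trap_hull[OF f]) auto
  moreover have "C \<subseteq> captured f"
  proof -
    have "cball v r \<subseteq> captured f" using r(2) t unfolding captured_def by blast
    hence "(f ^^ k) ` cball v r \<subseteq> captured f" for k using captured_funpow_iff[OF f] by blast
    thus ?thesis unfolding C_def using trap_hull_subset_captured[OF f t] by blast
  qed
  moreover have "(f ^^ k) ` ball v r \<subseteq> C" for k
  proof (cases "k < m")
    case True
    have "(f ^^ k) ` ball v r \<subseteq> (f ^^ k) ` cball v r" by (intro image_mono ball_subset_cball)
    thus ?thesis unfolding C_def using True by blast
  next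
    case False
    show ?thesis
    proof
      fix y assume "y \<in> (f ^^ k) ` ball v r"
      then obtain x where x: "x \<in> ball v r" "y = (f ^^ k) x" by blast
      have "x \<in> cball v r" using x(1) ball_subset_cball by blast
      hence "(f ^^ m) x \<in> ball z e" using r(2) by blast
      hence "(f ^^ m) x \<in> trap_hull f z p e" using cball_subset_trap_hull[OF t] ball_subset_cball by blast
      hence "(f ^^ (k - m)) ((f ^^ m) x) \<in> trap_hull f z p e" by (rule trap_hull_funpow_invariant[OF t])
      moreover have "(f ^^ (k - m)) ((f ^^ m) x) = y"
        using funpow_add_apply[of "k - m" m f x] False x(2) by simp
      ultimately show "y \<in> C" unfolding C_def by simp
    qed
  qed
  ultimately show ?thesis using r(1) that by blast
qed

lemma captured_subset_fatou:
  assumes f: "f holomorphic_on UNIV" shows "captured f \<subseteq> fatou_set f"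
proof
  fix v assume "v \<in> captured f"
  then obtain r C where r: "r > 0" and C: "compact C" "\<And>k. (f ^^ k) ` ball v r \<subseteq> C"
    using captured_orbit_compact[OF f] by metis
  obtain B where B: "\<And>x. x \<in> C \<Longrightarrow> norm x \<le> B" using compact_imp_bounded[OF C(1)] unfolding bounded_iff by blast
  have "normal_family_on (ball v r) (range (\<lambda>n. f ^^ n))"
  proof (rule normal_family_on_bounded[OF open_ball])
    fix h assume "h \<in> range (\<lambda>n. f ^^ n)"
    then obtain n where n: "h = f ^^ n" by blast
    show "h holomorphic_on ball v r" unfolding n
      by (rule holomorphic_on_subset[OF holomorphic_on_funpow[OF f]]) simp
    show "norm (h z) \<le> B" if "z \<in> ball v r" for z using that C(2)[of n] B unfolding n by blast
  qed
  thus "v \<in> fatou_set f" unfolding fatou_set_def using r by (intro CollectI exI[of _ "ball v r"]) auto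
qed

text \<open>Near a point outside this closure all iterates omit the disc around \<open>a\<close>,
  hence form a normal family.\<close>

lemma julia_subset_closure_basin:
  assumes f: "f holomorphic_on UNIV" and t: "trap f a p e"
  shows "julia_set f \<subseteq> closure {v. \<exists>m. (f ^^ m) v \<in> ball a e} - captured f"
proof
  fix z assume z: "z \<in> julia_set f"
  let ?O = "{v. \<exists>m. (f ^^ m) v \<in> ball a e}"
  have e: "e > 0" using t by (simp add: trap_def)
  have "z \<notin> captured f" using z captured_subset_fatou[OF f] by (auto simp: julia_set_def)
  moreover have "z \<in> closure ?O"
  proof (rule ccontr)
    assume "z \<notin> closure ?O"
    then obtain r where r: "r > 0" "ball z r \<inter> ?O = {}"
      unfolding closure_approachable disjoint_iff by (metis mem_ball dist_commute)
    have "normal_family_on (ball z r) (range (\<lambda>n. f ^^ n))"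
    proof (rule normal_family_on_omitting_disc[OF open_ball connected_ball _ e])
      fix h assume "h \<in> range (\<lambda>n. f ^^ n)"
      then obtain n where n: "h = f ^^ n" by blast
      show "h holomorphic_on ball z r" unfolding n
        by (rule holomorphic_on_subset[OF holomorphic_on_funpow[OF f]]) simp
      show "e \<le> norm (h x - a)" if "x \<in> ball z r" for x
      proof (rule ccontr)
        assume "\<not> ?thesis"
        hence "(f ^^ n) x \<in> ball a e" by (simp add: n dist_norm norm_minus_commute)
        thus False using r(2) that by blast
      qed
    qed
    hence "z \<in> fatou_set f" unfolding fatou_set_def using r by (intro CollectI exI[of _ "ball z r"]) auto
    thus False using z by (simp add: julia_set_def)
  qed
  ultimately show "z \<in> closure ?O - captured f" by blast
qed

lemma basin_captured:
  assumes f: "f holomorphic_on UNIV" and att: "attracting_periodic f z p" and s: "s \<in> basin f z p"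
  shows "s \<in> captured f"
proof -
  obtain e where t: "trap f z p e" using attracting_trap[OF f att] .
  have e: "e > 0" and p: "p \<ge> 1" using t by (auto simp: trap_def)
  have pz: "(f ^^ p) z = z" using att by (simp add: attracting_periodic_def)
  \<comment> \<open>The iterate \<open>f ^^ (p - j)\<close> completes the period from the
    \<open>j\<close>-th point of the cycle to \<open>z\<close>; an orbit point close to any point of
    the cycle is thus brought into the trap disc.\<close>
  have "\<exists>d>0. \<forall>x. dist x ((f ^^ j) z) < d \<longrightarrow> dist ((f ^^ (p - j)) x) z < e" if "j < p" for j
  proof -
    have "isCont (f ^^ (p - j)) ((f ^^ j) z)" by (rule isCont_entire[OF holomorphic_on_funpow[OF f]])
    moreover have "(f ^^ (p - j)) ((f ^^ j) z) = z"
      using funpow_add_apply[of "p - j" j f z] that pz by simp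
    ultimately show ?thesis using e unfolding continuous_at_eps_delta by metis
  qed
  then obtain d where d: "\<And>j. j < p \<Longrightarrow> d j > 0"
    "\<And>j x. j < p \<Longrightarrow> dist x ((f ^^ j) z) < d j \<Longrightarrow> dist ((f ^^ (p - j)) x) z < e" by metis
  define \<delta> where "\<delta> = Min (d ` {..<p})"
  have "0 \<in> {..<p}" using p by simp
  hence ne: "finite (d ` {..<p})" "d ` {..<p} \<noteq> {}" by blast+
  have "\<delta> \<in> d ` {..<p}" unfolding \<delta>_def by (rule Min_in[OF ne])
  hence \<delta>: "\<delta> > 0" using d(1) by auto
  have \<delta>le: "\<delta> \<le> d j" if "j < p" for j unfolding \<delta>_def by (rule Min_le[OF ne(1)]) (use that in auto)
  have "(\<lambda>n. infdist ((f ^^ n) s) (cycle_of f z p)) \<longlonglongrightarrow> 0" using s by (simp add: basin_def)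
  hence "eventually (\<lambda>n. infdist ((f ^^ n) s) (cycle_of f z p) < \<delta>) sequentially"
    using \<delta> by (rule order_tendstoD)
  then obtain n where n: "infdist ((f ^^ n) s) (cycle_of f z p) < \<delta>"
    unfolding eventually_sequentially by blast
  have "cycle_of f z p \<noteq> {}" using p unfolding cycle_of_def by force
  with n obtain y where y: "y \<in> cycle_of f z p" "dist ((f ^^ n) s) y < \<delta>"
    unfolding infdist_def using cINF_less_iff[of "cycle_of f z p" "dist ((f ^^ n) s)" \<delta>]
    by (auto intro: bdd_belowI[of _ 0])
  then obtain j where j: "j < p" "y = (f ^^ j) z" unfolding cycle_of_def by blast
  have "dist ((f ^^ (p - j)) ((f ^^ n) s)) z < e"
    using d(2)[OF j(1)] y(2) j \<delta>le[OF j(1)] by (meson less_le_trans)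
  hence "(f ^^ (p - j + n)) s \<in> ball z e" by (simp add: funpow_add_apply dist_commute)
  thus ?thesis using t unfolding captured_def by blast
qed

text \<open>The singular set is compact, so finitely many of the neighbourhoods with compactly
  confined orbits cover it.\<close>

lemma hyperbolic_postsingular_compact:
  assumes h: "hyperbolic f" and f: "f holomorphic_on UNIV"
  obtains C where "compact C" "C \<subseteq> captured f" "\<And>k s. s \<in> singular_values f \<Longrightarrow> (f ^^ k) s \<in> C"
proof -
  let ?S = "singular_values f"
  have "bounded ?S" using h by (simp add: hyperbolic_def class_B_def)
  moreover have "closed ?S" unfolding singular_values_def by (rule closed_closure)
  ultimately have "compact ?S" by (simp add: compact_eq_bounded_closed)
  have "s \<in> captured f" if "s \<in> ?S" for s
    using h that basin_captured[OF f] unfolding hyperbolic_def by blast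
  hence "\<exists>r C. r > 0 \<and> compact C \<and> C \<subseteq> captured f \<and> (\<forall>k. (f ^^ k) ` ball s r \<subseteq> C)" if "s \<in> ?S" for s
    using captured_orbit_compact[OF f] that by metis
  then obtain r C where r: "\<And>s. s \<in> ?S \<Longrightarrow> r s > 0" and C: "\<And>s. s \<in> ?S \<Longrightarrow> compact (C s)"
    "\<And>s. s \<in> ?S \<Longrightarrow> C s \<subseteq> captured f" "\<And>s k. s \<in> ?S \<Longrightarrow> (f ^^ k) ` ball s (r s) \<subseteq> C s"
    by metis
  have cov: "?S \<subseteq> (\<Union>s\<in>?S. ball s (r s))" using r by force
  obtain P where P: "P \<subseteq> ?S" "finite P" "?S \<subseteq> (\<Union>s\<in>P. ball s (r s))"
    by (rule compactE_image[OF \<open>compact ?S\<close> open_ball cov])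
  show ?thesis
  proof (rule that[of "\<Union>s\<in>P. C s"])
    show "compact (\<Union>s\<in>P. C s)" using P C(1) by (intro compact_UN) auto
    show "(\<Union>s\<in>P. C s) \<subseteq> captured f" using P C(2) by blast
    show "(f ^^ k) s \<in> (\<Union>s\<in>P. C s)" if s: "s \<in> ?S" for k s
    proof -
      obtain s' where "s' \<in> P" "s \<in> ball s' (r s')" using P(3) s by blast
      thus ?thesis using C(3)[of s' k] P(1) by blast
    qed
  qed
qed

text \<open>A branch for the remaining iterates never takes a singular value: a singular
  \<open>g w\<close> would place \<open>w = (f ^^ n) (g w)\<close> in \<open>C\<close>. So it lifts
  once more through \<open>f\<close>, on the same disc.\<close>

lemma inverse_branch:
  assumes f: "f holomorphic_on UNIV" and C: "\<And>k s. s \<in> singular_values f \<Longrightarrow> (f ^^ k) s \<in> C"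
    and d: "d > 0" and away: "ball ((f ^^ n) z) d \<inter> C = {}"
  shows "\<exists>g. g holomorphic_on ball ((f ^^ n) z) d \<and> g ((f ^^ n) z) = z \<and>
    (\<forall>w\<in>ball ((f ^^ n) z) d. (f ^^ n) (g w) = w)"
  using away
proof (induction n arbitrary: z)
  case 0
  thus ?case by (intro exI[of _ "\<lambda>w. w"]) (simp add: holomorphic_on_ident)
next
  case (Suc n)
  have eq: "(f ^^ Suc n) z = (f ^^ n) (f z)" by (simp add: funpow_Suc_right del: funpow.simps)
  let ?B = "ball ((f ^^ n) (f z)) d"
  have "?B \<inter> C = {}" using Suc.prems unfolding eq .
  from Suc.IH[OF this] obtain g where g: "g holomorphic_on ?B" "g ((f ^^ n) (f z)) = f z"
    "\<And>w. w \<in> ?B \<Longrightarrow> (f ^^ n) (g w) = w" by blast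
  have ns: "g w \<notin> singular_values f" if "w \<in> ?B" for w
    using C[of "g w" n] g(3)[OF that] that \<open>?B \<inter> C = {}\<close> by force
  obtain k where k: "k holomorphic_on ?B" "k ((f ^^ n) (f z)) = z" "\<And>w. w \<in> ?B \<Longrightarrow> f (k w) = g w"
    using lift_on_ball[OF f g(1) d ns g(2)[symmetric]] by metis
  have "(f ^^ Suc n) (k w) = w" if "w \<in> ?B" for w
  proof -
    have "(f ^^ Suc n) (k w) = (f ^^ n) (f (k w))" by (simp add: funpow_Suc_right del: funpow.simps)
    thus ?thesis using k(3)[OF that] g(3)[OF that] by simp
  qed
  thus ?case unfolding eq using k by blast
qed

section \<open>Points returning to a bounded region\<close>

text \<open>\<open>Q\<close> abstracts a closed, forward invariant set containing the Julia set. The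
  distance \<open>d\<close> to both the postsingular set and the trap hull yields inverse branches
  on discs of one size that have not yet been trapped.\<close>

locale basin_boundary =
  fixes f :: "complex \<Rightarrow> complex" and a :: complex and p :: nat and e :: real
    and C Q :: "complex set" and d :: real
  assumes f: "f holomorphic_on UNIV" and t: "trap f a p e"
    and C: "\<And>k s. s \<in> singular_values f \<Longrightarrow> (f ^^ k) s \<in> C"
    and Q: "closed Q" "\<And>z. z \<in> Q \<Longrightarrow> f z \<in> Q" "Q \<subseteq> closure {v. \<exists>m. (f ^^ m) v \<in> ball a e}"
    and d: "d > 0" and away: "\<And>y. y \<in> Q \<Longrightarrow> ball y d \<inter> (C \<union> trap_hull f a p e) = {}"
begin

abbreviation X :: "complex set" where "X \<equiv> trap_hull f a p e"

definition entry :: "nat \<Rightarrow> complex set" where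
  "entry i = {v. (f ^^ i) v \<in> X \<and> (\<forall>j<i. (f ^^ j) v \<notin> X)}"

lemma closed_funpow_vimage: "closed S \<Longrightarrow> closed ((f ^^ n) -` S)"
  by (rule closed_vimage[OF _ holomorphic_on_imp_continuous_on[OF holomorphic_on_funpow[OF f]]])

lemma closed_X: "closed X"
  by (rule compact_imp_closed[OF compact_trap_hull[OF f]])

lemma entry_sets: "entry i \<in> sets lebesgue"
proof -
  have "(f ^^ n) -` X \<in> sets lebesgue" for n using closed_funpow_vimage[OF closed_X] by simp
  moreover have "entry i = (f ^^ i) -` X - (\<Union>j\<in>{..<i}. (f ^^ j) -` X)" unfolding entry_def by blast
  ultimately show ?thesis by (simp only:) (intro sets.Diff sets.finite_UN, auto)
qed

lemma disjoint_entry: "disjoint_family entry"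
  unfolding disjoint_family_on_def
proof (intro ballI impI)
  have "entry m \<inter> entry n = {}" if "m < n" for m n using that unfolding entry_def by blast
  thus "entry m \<inter> entry n = {}" if "m \<noteq> n" for m n
    using that by (metis Int_commute linorder_neqE_nat)
qed

lemma funpow_Q: "z \<in> Q \<Longrightarrow> (f ^^ n) z \<in> Q"
  by (induction n) (simp_all add: Q(2))

text \<open>Each point of \<open>Q\<close> is a limit of captured points, and compactness makes size
  and time uniform. The largest capture time serves for all discs because the trap hull is forward
  invariant.\<close>

lemma uniform_capture:
  obtains \<eta> m where "\<eta> > 0" "m \<ge> 1"
    "\<And>y. y \<in> Q \<Longrightarrow> norm y \<le> r \<Longrightarrow> \<exists>q. ball q \<eta> \<subseteq> ball y (d / 4) \<and> (\<forall>v\<in>ball q \<eta>. (f ^^ m) v \<in> X)"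
proof -
  have "\<exists>q \<eta> m. \<eta> > 0 \<and> ball q \<eta> \<subseteq> ball y (d / 8) \<and> (\<forall>v\<in>ball q \<eta>. (f ^^ m) v \<in> ball a e)" if y: "y \<in> Q" for y
  proof -
    have "y \<in> closure {v. \<exists>m. (f ^^ m) v \<in> ball a e}" using Q(3) y by blast
    moreover have "d / 8 > 0" using d by simp
    ultimately obtain q where q: "q \<in> {v. \<exists>m. (f ^^ m) v \<in> ball a e}" "dist q y < d / 8"
      unfolding closure_approachable by blast
    then obtain m where m: "(f ^^ m) q \<in> ball a e" by blast
    have "open (ball y (d / 8) \<inter> (f ^^ m) -` ball a e)"
      by (intro open_Int open_ball open_funpow_vimage[OF f])
    moreover have "q \<in> ball y (d / 8) \<inter> (f ^^ m) -` ball a e" using q m by (simp add: dist_commute)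
    ultimately obtain \<eta> where "\<eta> > 0" "ball q \<eta> \<subseteq> ball y (d / 8) \<inter> (f ^^ m) -` ball a e"
      using openE by blast
    thus ?thesis by (intro exI[of _ q] exI[of _ \<eta>] exI[of _ m]) blast
  qed
  then obtain q \<eta> m where \<eta>: "\<And>y. y \<in> Q \<Longrightarrow> \<eta> y > 0"
    and qb: "\<And>y. y \<in> Q \<Longrightarrow> ball (q y) (\<eta> y) \<subseteq> ball y (d / 8)"
    and cap: "\<And>y v. y \<in> Q \<Longrightarrow> v \<in> ball (q y) (\<eta> y) \<Longrightarrow> (f ^^ m y) v \<in> ball a e" by metis
  have "compact (Q \<inter> cball 0 r)" using Q(1) by (intro closed_Int_compact) auto
  moreover have "Q \<inter> cball 0 r \<subseteq> (\<Union>y\<in>Q \<inter> cball 0 r. ball y (d / 8))" using d by force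
  ultimately obtain P where P: "P \<subseteq> Q \<inter> cball 0 r" "finite P" "Q \<inter> cball 0 r \<subseteq> (\<Union>y\<in>P. ball y (d / 8))"
    by (metis compactE_image open_ball)
  \<comment> \<open>The inserted 1 provides a default when \<open>P\<close> is empty, and makes the
    time positive.\<close>
  define \<eta>' where "\<eta>' = Min (insert 1 (\<eta> ` P))"
  define m' where "m' = Max (insert 1 (m ` P))"
  have fin: "finite (insert 1 (\<eta> ` P))" "finite (insert 1 (m ` P))" using P(2) by simp_all
  have "\<eta>' \<in> insert 1 (\<eta> ` P)" unfolding \<eta>'_def by (rule Min_in[OF fin(1)]) simp
  hence "\<eta>' > 0" using \<eta> P(1) by auto
  moreover have "m' \<ge> 1" unfolding m'_def by (rule Max_ge[OF fin(2)]) simp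
  moreover have "\<exists>q. ball q \<eta>' \<subseteq> ball y (d / 4) \<and> (\<forall>v\<in>ball q \<eta>'. (f ^^ m') v \<in> X)"
    if y: "y \<in> Q" "norm y \<le> r" for y
  proof -
    have "y \<in> Q \<inter> cball 0 r" using y by simp
    then obtain x where x: "x \<in> P" "y \<in> ball x (d / 8)" using P(3) by blast
    have xQ: "x \<in> Q" using x P(1) by blast
    have \<eta>x: "\<eta>' \<le> \<eta> x" unfolding \<eta>'_def by (rule Min_le[OF fin(1)]) (use x in simp)
    have mx: "m x \<le> m'" unfolding m'_def by (rule Max_ge[OF fin(2)]) (use x in simp)
    have sub: "ball (q x) \<eta>' \<subseteq> ball (q x) (\<eta> x)" by (rule subset_ball[OF \<eta>x])
    have "ball (q x) \<eta>' \<subseteq> ball y (d / 4)"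
    proof
      fix v assume "v \<in> ball (q x) \<eta>'"
      hence "v \<in> ball x (d / 8)" using sub qb[OF xQ] by blast
      thus "v \<in> ball y (d / 4)" using x(2) dist_triangle[of y v x] by (simp add: dist_commute)
    qed
    moreover have "(f ^^ m') v \<in> X" if "v \<in> ball (q x) \<eta>'" for v
    proof -
      have "(f ^^ m x) v \<in> ball a e" using cap[OF xQ] sub that by blast
      hence "(f ^^ m x) v \<in> X" using cball_subset_trap_hull[OF t] ball_subset_cball by blast
      hence "(f ^^ (m' - m x)) ((f ^^ m x) v) \<in> X" by (rule trap_hull_funpow_invariant[OF t])
      thus ?thesis using funpow_add_apply[of "m' - m x" "m x" f v] mx by simp
    qed
    ultimately show ?thesis by blast
  qed
  ultimately show thesis by (rule that)
qed

text \<open>The branch itself is not known to be bounded, but \<open>1 / (g - a)\<close> is, by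
  \<open>1 / e\<close>. Cauchy's estimate on half the radius bounds its derivative, and the factor
  \<open>norm (g y - a)\<close> squared translates back to \<open>g\<close>. This keeps the radii of
  the pulled-back discs bounded.\<close>

lemma inverse_branch_deriv_bound:
  assumes g: "g holomorphic_on ball y d" and om: "\<And>w. w \<in> ball y d \<Longrightarrow> e \<le> norm (g w - a)" and e: "e > 0"
  shows "norm (deriv g y) \<le> (norm (g y - a))\<^sup>2 * (2 / (e * d))"
proof -
  define k where "k w = inverse (g w - a)" for w
  have nz: "g w - a \<noteq> 0" if "w \<in> ball y d" for w using om[OF that] e by auto
  have k: "k holomorphic_on ball y d" unfolding k_def using nz by (intro holomorphic_intros g) auto
  have kb: "norm (k w) \<le> 1 / e" if "w \<in> ball y d" for w
    using le_imp_inverse_le[OF om[OF that] e] unfolding k_def norm_inverse by (simp add: inverse_eq_divide)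
  have sub: "cball y (d / 2) \<subseteq> ball y d" using d by (simp add: cball_subset_ball_iff)
  have "norm ((deriv ^^ 1) k y) \<le> fact 1 * (1 / e) / (d / 2) ^ 1"
  proof (rule Cauchy_inequality)
    show "k holomorphic_on ball y (d / 2)" using sub ball_subset_cball by (blast intro: holomorphic_on_subset[OF k])
    show "continuous_on (cball y (d / 2)) k"
      by (rule holomorphic_on_imp_continuous_on[OF holomorphic_on_subset[OF k sub]])
    show "norm (k x) \<le> 1 / e" if "norm (y - x) = d / 2" for x
      by (rule kb) (use that d in \<open>simp add: dist_norm\<close>)
  qed (use d in simp)
  hence kd: "norm (deriv k y) \<le> 2 / (e * d)" by simp
  have yb: "y \<in> ball y d" using d by simp
  have "((\<lambda>w. g w - a) has_field_derivative deriv g y) (at y)"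
    using holomorphic_derivI[OF g open_ball yb] by (auto intro!: derivative_eq_intros)
  hence "(k has_field_derivative - (deriv g y * inverse ((g y - a)\<^sup>2))) (at y)"
    unfolding k_def using nz[OF yb] DERIV_inverse_fun[of "\<lambda>w. g w - a" "deriv g y" y UNIV]
    by (simp add: eval_nat_numeral)
  hence "deriv k y = - (deriv g y * inverse ((g y - a)\<^sup>2))" by (rule DERIV_imp_deriv)
  hence "deriv g y = - deriv k y * (g y - a)\<^sup>2" using nz[OF yb] by simp
  hence "norm (deriv g y) = norm (deriv k y) * (norm (g y - a))\<^sup>2" by (simp add: norm_mult norm_power)
  also have "\<dots> \<le> 2 / (e * d) * (norm (g y - a))\<^sup>2" using kd by (intro mult_right_mono) auto
  finally show ?thesis by (simp add: mult.commute)
qed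

text \<open>A disc near \<open>(f ^^ n) z\<close> that lies in the hull \<open>m\<close> steps later
  is pulled back to \<open>z\<close>. Since \<open>c\<close>, \<open>m\<close> and \<open>B\<close>
  do not depend on \<open>n\<close>, summing over \<open>n\<close> counts each entry set at most
  \<open>m\<close> times.\<close>

lemma visits_measure_bound:
  "\<exists>c>0. \<exists>m B. \<forall>n. measure lebesgue {z \<in> Q \<inter> cball 0 M. norm ((f ^^ n) z) \<le> r}
      \<le> c * (\<Sum>i\<in>{1..m}. measure lebesgue (entry (i + n) \<inter> cball 0 B))"
proof -
  obtain \<eta> m where \<eta>: "\<eta> > 0" and m: "m \<ge> 1"
    and cap: "\<And>y. y \<in> Q \<Longrightarrow> norm y \<le> r \<Longrightarrow> \<exists>q. ball q \<eta> \<subseteq> ball y (d / 4) \<and> (\<forall>v\<in>ball q \<eta>. (f ^^ m) v \<in> X)"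
    using uniform_capture by metis
  have e: "e > 0" using t by (simp add: trap_def)
  have d2: "0 < d / 2" "d / 2 < d" using d by auto
  obtain K :: real where K: "K \<ge> 1" and im': "\<forall>c g S G. g holomorphic_on ball c d \<longrightarrow>
      (\<forall>w\<in>ball c (d - d / 2). inj_on g (ball w (d / 2))) \<longrightarrow> open S \<longrightarrow> S \<subseteq> ball c (d - d / 2) \<longrightarrow>
      G \<in> sets lebesgue \<longrightarrow> g ` S \<subseteq> G \<longrightarrow>
      (norm (deriv g c))\<^sup>2 * measure lebesgue S
        \<le> K * measure lebesgue (G \<inter> cball (g c) (K * norm (deriv g c)))"
    using locally_injective_image_measure[OF d2] by blast
  note im = im'[rule_format]
  define D where "D = K * ((\<bar>M\<bar> + norm a)\<^sup>2 * (2 / (e * d)))"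
  define B where "B = M + D"
  \<comment> \<open>The factor \<open>1 / K ^ 3\<close> consists of one \<open>K\<close> from the
    area comparison and two from the radius \<open>K * norm (deriv g ?y)\<close>.\<close>
  define c where "c = pi * \<eta>\<^sup>2 / K ^ 3"
  have c: "c > 0" using \<eta> K by (simp add: c_def)
  define A where "A n = {z \<in> Q \<inter> cball 0 M. norm ((f ^^ n) z) \<le> r}" for n
  define G where "G n = (\<Union>i\<in>{1..m}. entry (i + n))" for n
  have Gs: "G n \<in> sets lebesgue" for n unfolding G_def by (intro sets.finite_UN entry_sets) auto
  \<comment> \<open>By forward invariance of the hull, a point outside it at time \<open>n\<close>
    has not entered earlier, so its first entry falls between \<open>n + 1\<close> and
    \<open>n + m\<close>.\<close>
  have G: "v \<in> G n" if v: "(f ^^ n) v \<notin> X" "(f ^^ (m + n)) v \<in> X" for v n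
  proof -
    define T where "T = (LEAST i. (f ^^ i) v \<in> X)"
    have T: "(f ^^ T) v \<in> X" unfolding T_def by (rule LeastI[of _ "m + n"]) (rule v(2))
    have "T \<le> m + n" unfolding T_def by (rule Least_le) (rule v(2))
    moreover have "n < T"
    proof (rule ccontr)
      assume "\<not> n < T"
      hence "(f ^^ n) v = (f ^^ (n - T)) ((f ^^ T) v)" using funpow_add_apply[of "n - T" T f v] by simp
      thus False using trap_hull_funpow_invariant[OF t T, of "n - T"] v(1) by simp
    qed
    ultimately have "T - n \<in> {1..m}" "T = (T - n) + n" by auto
    moreover have "v \<in> entry T" using T not_less_Least unfolding entry_def T_def by blast
    ultimately show ?thesis unfolding G_def by (metis UN_iff)
  qed
  have key: "emeasure lebesgue (A n) \<le> ennreal (25 * pi / c) * emeasure lebesgue (G n \<inter> cball 0 B)" for n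
    unfolding B_def
  proof (rule emeasure_le_of_proportional_balls[OF _ Gs c])
    show "A n \<subseteq> cball 0 M" unfolding A_def by blast
    fix z assume "z \<in> A n"
    hence z: "z \<in> Q" "norm z \<le> M" "norm ((f ^^ n) z) \<le> r" by (auto simp: A_def)
    let ?y = "(f ^^ n) z"
    have yQ: "?y \<in> Q" by (rule funpow_Q[OF z(1)])
    have dis: "ball ?y d \<inter> C = {}" "ball ?y d \<inter> X = {}" using away[OF yQ] by blast+
    obtain g where g: "g holomorphic_on ball ?y d" "g ?y = z" "\<And>w. w \<in> ball ?y d \<Longrightarrow> (f ^^ n) (g w) = w"
      using inverse_branch[OF f C d dis(1)] by blast
    obtain q where q: "ball q \<eta> \<subseteq> ball ?y (d / 4)" "\<And>v. v \<in> ball q \<eta> \<Longrightarrow> (f ^^ m) v \<in> X"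
      using cap[OF yQ z(3)] by blast
    have injg: "inj_on g (ball ?y d)" using g(3) by (metis inj_onI)
    have inj: "inj_on g (ball w (d / 2))" if w: "w \<in> ball ?y (d - d / 2)" for w
    proof (rule inj_on_subset[OF injg])
      show "ball w (d / 2) \<subseteq> ball ?y d"
      proof
        fix x assume "x \<in> ball w (d / 2)"
        thus "x \<in> ball ?y d" using w dist_triangle[of ?y x w] by simp
      qed
    qed
    have q4: "ball q \<eta> \<subseteq> ball ?y (d - d / 2)" using q(1) subset_ball[of "d / 4" "d - d / 2" ?y] d by auto
    have qd: "ball q \<eta> \<subseteq> ball ?y d" using q(1) subset_ball[of "d / 4" d ?y] d by auto
    have gG: "g ` ball q \<eta> \<subseteq> G n"
    proof
      fix v assume "v \<in> g ` ball q \<eta>"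
      then obtain w where w: "w \<in> ball q \<eta>" "v = g w" by blast
      have wd: "w \<in> ball ?y d" using w qd by blast
      have "(f ^^ n) v = w" using g(3)[OF wd] w by simp
      moreover from this have "(f ^^ (m + n)) v \<in> X" using q(2)[OF w(1)] by (simp add: funpow_add_apply)
      moreover have "w \<notin> X" using dis wd by blast
      ultimately show "v \<in> G n" using G by simp
    qed
    have om: "e \<le> norm (g w - a)" if w: "w \<in> ball ?y d" for w
    proof (rule ccontr)
      assume "\<not> ?thesis"
      hence "g w \<in> cball a e" by (simp add: dist_norm norm_minus_commute)
      hence "g w \<in> X" using cball_subset_trap_hull[OF t] by blast
      hence "(f ^^ n) (g w) \<in> X" by (rule trap_hull_funpow_invariant[OF t])
      thus False using g(3)[OF w] w dis by auto
    qed
    define \<rho> where "\<rho> = K * norm (deriv g ?y)"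
    have "deriv g ?y \<noteq> 0"
      using holomorphic_injective_imp_regular[OF g(1) open_ball injg] d by simp
    hence \<rho>0: "\<rho> > 0" using K by (simp add: \<rho>_def)
    have "norm (deriv g ?y) \<le> (norm (z - a))\<^sup>2 * (2 / (e * d))"
      using inverse_branch_deriv_bound[OF g(1) om e] g(2) by simp
    also have "\<dots> \<le> (\<bar>M\<bar> + norm a)\<^sup>2 * (2 / (e * d))"
      using norm_triangle_ineq4[of z a] z(2) e d by (intro mult_right_mono power_mono) auto
    finally have \<rho>D: "\<rho> \<le> D" unfolding \<rho>_def D_def using K by (intro mult_left_mono) auto
    have "(norm (deriv g ?y))\<^sup>2 * measure lebesgue (ball q \<eta>) \<le> K * measure lebesgue (G n \<inter> cball z \<rho>)"
      using im[OF g(1) inj open_ball q4 Gs gG] unfolding g(2) \<rho>_def by blast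
    moreover have "measure lebesgue (ball q \<eta>) = pi * \<eta>\<^sup>2" using \<eta> by (simp add: content_ball unit_ball_vol_2)
    ultimately have "(norm (deriv g ?y))\<^sup>2 * (pi * \<eta>\<^sup>2) \<le> K * measure lebesgue (G n \<inter> cball z \<rho>)" by simp
    hence "(norm (deriv g ?y))\<^sup>2 * (pi * \<eta>\<^sup>2) / K \<le> measure lebesgue (G n \<inter> cball z \<rho>)"
      using K by (simp add: divide_le_eq mult.commute)
    moreover have "c * \<rho>\<^sup>2 = (norm (deriv g ?y))\<^sup>2 * (pi * \<eta>\<^sup>2) / K"
      using K by (simp add: c_def \<rho>_def power_mult_distrib eval_nat_numeral)
    ultimately show "\<exists>\<rho>. 0 < \<rho> \<and> \<rho> \<le> D \<and> c * \<rho>\<^sup>2 \<le> measure lebesgue (G n \<inter> cball z \<rho>)"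
      using \<rho>0 \<rho>D by (intro exI[of _ \<rho>]) simp
  qed
  have lm: "S \<inter> cball 0 B \<in> lmeasurable" if "S \<in> sets lebesgue" for S :: "complex set"
    using fmeasurable_Int_fmeasurable[OF lmeasurable_cball[of "0::complex" B] that] by (simp add: Int_commute)
  have "measure lebesgue (A n) \<le> 25 * pi / c * (\<Sum>i\<in>{1..m}. measure lebesgue (entry (i + n) \<inter> cball 0 B))" for n
  proof -
    have "emeasure lebesgue (A n) \<le> ennreal (25 * pi / c * measure lebesgue (G n \<inter> cball 0 B))"
      using key[of n] c emeasure_eq_measure2[OF lm[OF Gs]] by (subst ennreal_mult) auto
    hence "measure lebesgue (A n) \<le> 25 * pi / c * measure lebesgue (G n \<inter> cball 0 B)"
      unfolding measure_def[of _ "A n"] using c by (intro enn2real_leI) auto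
    also have "measure lebesgue (G n \<inter> cball 0 B) \<le> (\<Sum>i\<in>{1..m}. measure lebesgue (entry (i + n) \<inter> cball 0 B))"
      unfolding G_def Int_commute[of _ "cball 0 B"] Int_UN_distrib
      by (rule measure_UNION_le) (use entry_sets in auto)
    hence "25 * pi / c * measure lebesgue (G n \<inter> cball 0 B) \<le>
        25 * pi / c * (\<Sum>i\<in>{1..m}. measure lebesgue (entry (i + n) \<inter> cball 0 B))"
      using c by (intro mult_left_mono) auto
    finally show ?thesis .
  qed
  moreover have "25 * pi / c > 0" using c by simp
  ultimately show ?thesis unfolding A_def
    by (intro exI[of _ "25 * pi / c"] conjI exI[of _ m] exI[of _ B] allI)
qed

lemma summable_entry: "summable (\<lambda>i. measure lebesgue (entry i \<inter> cball 0 B))"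
  by (rule summableI_nonneg_bounded[where x = "measure lebesgue (cball (0::complex) B)"])
     (use sum_measure_disjoint_le[OF entry_sets disjoint_entry] in auto)

lemma recurrent_null: "negligible {z \<in> Q. \<exists>r. \<exists>\<^sub>\<infinity>n. norm ((f ^^ n) z) \<le> r}"
proof -
  \<comment> \<open>One integer bounds both the starting point and the returns, so countably many
    limsup sets suffice.\<close>
  define A where "A N n = {z \<in> Q \<inter> cball 0 (real N). norm ((f ^^ n) z) \<le> real N}" for N n
  have "negligible (limsup (A N))" for N
  proof -
    obtain c m B where c: "c > 0" and le: "\<And>n. measure lebesgue (A N n)
        \<le> c * (\<Sum>i\<in>{1..m}. measure lebesgue (entry (i + n) \<inter> cball 0 B))"
      using visits_measure_bound[of "real N" "real N"] unfolding A_def by blast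
    have Ac: "compact (A N n)" for n
    proof -
      have "A N n = (Q \<inter> (f ^^ n) -` cball 0 (real N)) \<inter> cball 0 (real N)" by (auto simp: A_def)
      moreover have "compact \<dots>"
        by (rule closed_Int_compact[OF closed_Int[OF Q(1) closed_funpow_vimage[OF closed_cball]] compact_cball])
      ultimately show ?thesis by simp
    qed
    have "summable (\<lambda>n. measure lebesgue (entry (i + n) \<inter> cball 0 B))" for i
      using summable_ignore_initial_segment[OF summable_entry[of B], of i] by (simp add: add.commute)
    hence "summable (\<lambda>n. c * (\<Sum>i\<in>{1..m}. measure lebesgue (entry (i + n) \<inter> cball 0 B)))"
      by (intro summable_mult summable_sum)
    hence "summable (\<lambda>n. measure lebesgue (A N n))"
      by (rule summable_comparison_test') (use le in \<open>simp add: measure_nonneg\<close>)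
    moreover have "A N n \<in> sets lebesgue" "emeasure lebesgue (A N n) < \<infinity>" for n
      using fmeasurableD[OF lmeasurable_compact[OF Ac]] fmeasurableD2[OF lmeasurable_compact[OF Ac], of n]
      by (simp_all only: infinity_ennreal_def less_top)
    ultimately have "limsup (A N) \<in> null_sets lebesgue" by (intro borel_cantelli_limsup1)
    thus ?thesis by (simp add: negligible_iff_null_sets)
  qed
  hence "negligible (\<Union>N. limsup (A N))" by (rule negligible_Union_nat)
  moreover have "{z \<in> Q. \<exists>r. \<exists>\<^sub>\<infinity>n. norm ((f ^^ n) z) \<le> r} \<subseteq> (\<Union>N. limsup (A N))"
  proof
    fix z assume "z \<in> {z \<in> Q. \<exists>r. \<exists>\<^sub>\<infinity>n. norm ((f ^^ n) z) \<le> r}"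
    then obtain r where z: "z \<in> Q" and inf: "\<exists>\<^sub>\<infinity>n. norm ((f ^^ n) z) \<le> r" by blast
    obtain N :: nat where N: "max r (norm z) \<le> real N" using real_arch_simple by blast
    have "z \<in> (\<Union>k\<in>{n..}. A N k)" for n
    proof -
      obtain k where "k \<ge> n" "norm ((f ^^ k) z) \<le> r" using inf unfolding INFM_nat_le by blast
      thus ?thesis using z N unfolding A_def by (intro UN_I[of k]) auto
    qed
    hence "z \<in> limsup (A N)" unfolding limsup_INF_SUP by blast
    thus "z \<in> (\<Union>N. limsup (A N))" by blast
  qed
  ultimately show ?thesis by (rule negligible_subset)
qed

end

lemma julia_minus_escaping_null:
  assumes h: "hyperbolic f"
  shows "negligible (julia_set f - escaping_set f)"
proof -
  have tr: "transcendental_entire f" using h by (simp add: hyperbolic_def class_B_def)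
  hence f: "f holomorphic_on UNIV" by (simp add: transcendental_entire_def)
  obtain s where "s \<in> singular_values f" using singular_values_nonempty[OF tr] by blast
  then obtain a p where "attracting_periodic f a p" using h unfolding hyperbolic_def by blast
  then obtain e where t: "trap f a p e" using attracting_trap[OF f] by blast
  obtain C where C: "compact C" "C \<subseteq> captured f" "\<And>k s. s \<in> singular_values f \<Longrightarrow> (f ^^ k) s \<in> C"
    using hyperbolic_postsingular_compact[OF h f] by metis
  let ?O = "{v. \<exists>m. (f ^^ m) v \<in> ball a e}"
  \<comment> \<open>Contains the Julia set; its closedness and forward invariance come directly from
    the basin \<open>?O\<close> and the open, completely invariant set
    \<open>captured f\<close>.\<close>
  define Q where "Q = closure ?O - captured f"
  have Qc: "closed Q" unfolding Q_def by (intro closed_Diff closed_closure open_captured[OF f])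
  have fO: "f ` ?O \<subseteq> closure ?O"
  proof -
    have "f v \<in> ?O" if v: "v \<in> ?O" for v
    proof -
      obtain m where m: "(f ^^ m) v \<in> ball a e" using v by blast
      obtain p' where p': "p = Suc p'" using t by (cases p) (auto simp: trap_def)
      have "(f ^^ p) ((f ^^ m) v) \<in> ball a e" using t m ball_subset_cball unfolding trap_def by blast
      moreover have "(f ^^ p) ((f ^^ m) v) = (f ^^ (p' + m)) (f v)"
      proof -
        have "(f ^^ p) ((f ^^ m) v) = (f ^^ (p + m)) v" by (rule funpow_add_apply[symmetric])
        also have "p + m = Suc (p' + m)" by (simp add: p')
        also have "(f ^^ Suc (p' + m)) v = (f ^^ (p' + m)) (f v)" by (simp only: funpow_Suc_right o_apply)
        finally show ?thesis .
      qed
      ultimately have "(f ^^ (p' + m)) (f v) \<in> ball a e" by (simp only:)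
      thus ?thesis by (intro CollectI exI)
    qed
    hence "f ` ?O \<subseteq> ?O" by (rule image_subsetI)
    thus ?thesis using closure_subset by (rule order_trans)
  qed
  have fcl: "f ` closure ?O \<subseteq> closure ?O"
    by (rule image_closure_subset[OF holomorphic_on_imp_continuous_on[OF holomorphic_on_subset[OF f subset_UNIV]]
          closed_closure fO])
  have Qf: "f z \<in> Q" if z: "z \<in> Q" for z
  proof -
    note z' = z[unfolded Q_def]
    have "f z \<in> closure ?O" by (rule subsetD[OF fcl imageI[OF DiffD1[OF z']]])
    moreover have "f z \<notin> captured f" 
      using Diff_iff[THEN iffD1, OF z', THEN conjunct2] captured_image_iff[OF f, of z] by (simp only: not_False_eq_True)
    ultimately show ?thesis unfolding Q_def by (rule DiffI)
  qed
  have K: "compact (C \<union> trap_hull f a p e)" "C \<union> trap_hull f a p e \<subseteq> captured f"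
    by (rule compact_Un[OF C(1) compact_trap_hull[OF f]])
      (rule Un_least[OF C(2) trap_hull_subset_captured[OF f t]])
  have "(C \<union> trap_hull f a p e) \<inter> Q = {}" using K(2) unfolding Q_def by blast
  then obtain d where d: "d > 0" "\<And>x y. x \<in> C \<union> trap_hull f a p e \<Longrightarrow> y \<in> Q \<Longrightarrow> d \<le> dist x y"
    using separate_compact_closed[OF K(1) Qc] by blast
  interpret basin_boundary f a p e C Q d
  proof
    show "ball y d \<inter> (C \<union> trap_hull f a p e) = {}" if y: "y \<in> Q" for y
    proof -
      have "x \<notin> ball y d" if "x \<in> C \<union> trap_hull f a p e" for x
        using d(2)[OF that y] by (simp add: dist_commute)
      thus ?thesis by blast
    qed
    show "Q \<subseteq> closure ?O" unfolding Q_def by blast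
  qed (rule f t C(3) Qc Qf d(1), assumption?)+
  have "julia_set f - escaping_set f \<subseteq> {z \<in> Q. \<exists>r. \<exists>\<^sub>\<infinity>n. norm ((f ^^ n) z) \<le> r}"
  proof
    fix z assume z: "z \<in> julia_set f - escaping_set f"
    have "z \<in> Q" unfolding Q_def by (rule subsetD[OF julia_subset_closure_basin[OF f t] DiffD1[OF z]])
    moreover have "\<exists>r. \<exists>\<^sub>\<infinity>n. norm ((f ^^ n) z) \<le> r"
    proof (rule ccontr)
      assume "\<not> ?thesis"
      hence "\<forall>r. eventually (\<lambda>n. \<not> norm ((f ^^ n) z) \<le> r) cofinite"
        unfolding not_frequently[symmetric] by blast
      hence "\<forall>r. eventually (\<lambda>n. r < norm ((f ^^ n) z)) sequentially"
        unfolding cofinite_eq_sequentially not_le .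
      hence "filterlim (\<lambda>n. norm ((f ^^ n) z)) at_top sequentially" by (simp add: filterlim_at_top_dense)
      hence "filterlim (\<lambda>n. (f ^^ n) z) at_infinity sequentially"
        by (rule filterlim_norm_at_top_imp_at_infinity)
      hence "z \<in> escaping_set f" unfolding escaping_set_def by (rule CollectI)
      thus False by (rule DiffD2[OF z])
    qed
    ultimately show "z \<in> {z \<in> Q. \<exists>r. \<exists>\<^sub>\<infinity>n. norm ((f ^^ n) z) \<le> r}" by blast
  qed
  thus ?thesis using recurrent_null by (rule negligible_subset[rotated])
qed

theorem theorem1p3:
  fixes f :: "complex \<Rightarrow> complex" and r0 :: real and \<theta>0 :: "real \<Rightarrow> real"
  assumes "class_B f" and "finite_order f"
    and "r0 > 0" and "singular_values f \<subseteq> ball 0 r0"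
    and "eventually (\<lambda>r. theta f r0 r \<ge> \<theta>0 r) at_top"
    and "\<forall>x y. 0 < x \<longrightarrow> x \<le> y \<longrightarrow> \<theta>0 y \<le> \<theta>0 x"
    and "filterlim (\<lambda>n. \<Sum>k=1..n. \<theta>0 ((exp ^^ k) 0)) at_top sequentially"
  shows "escaping_set f \<in> null_sets lebesgue \<and>
         (disjoint_type f \<longrightarrow> julia_set f \<in> null_sets lebesgue)"
proof -
  have tr: "transcendental_entire f" using assms(1) by (simp add: class_B_def)
  hence f: "f holomorphic_on UNIV" by (simp add: transcendental_entire_def)
  have mono: "\<theta>0 y \<le> \<theta>0 x" if "0 < x" "x \<le> y" for x y using assms(6) that by blast
  \<comment> \<open>If \<open>\<theta>0\<close> were not positive at \<open>x\<close>, monotonicity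
    would make all late terms nonpositive and the partial sums bounded above.\<close>
  have pos: "\<theta>0 x > 0" if x: "0 < x" for x
  proof (rule ccontr)
    assume neg: "\<not> \<theta>0 x > 0"
    obtain L :: nat where L: "max 1 x \<le> real L" using real_arch_simple by blast
    hence L1: "L \<ge> 1" by simp
    obtain N where N: "(\<Sum>n<N. \<theta>0 ((exp ^^ (n + L)) 0)) > 0"
      using sum_shift_unbounded[OF assms(7) L1] by blast
    have "\<theta>0 ((exp ^^ (n + L)) 0) \<le> 0" for n
    proof -
      have "x \<le> (exp ^^ (n + L)) 0" using L exp_tower_ge[of "n + L"] by linarith
      thus ?thesis using mono[OF x] neg by force
    qed
    hence "(\<Sum>n<N. \<theta>0 ((exp ^^ (n + L)) 0)) \<le> 0" by (intro sum_nonpos) auto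
    thus False using N by simp
  qed
  obtain R' where R': "\<And>r. r \<ge> R' \<Longrightarrow> \<theta>0 r \<le> theta f r0 r"
    using assms(5) unfolding eventually_at_top_linorder by blast
  define R0 where "R0 = max 1 R'"
  have R0: "R0 > 0" and ev: "\<And>r. r \<ge> R0 \<Longrightarrow> \<theta>0 r \<le> theta f r0 r" using R' by (auto simp: R0_def)
  have "bounded (f ` cball 0 R0)"
    by (intro compact_imp_bounded compact_continuous_image holomorphic_on_imp_continuous_on
        holomorphic_on_subset[OF f]) auto
  then obtain b where b: "\<And>z. norm z \<le> R0 \<Longrightarrow> norm (f z) \<le> b"
    unfolding bounded_iff by (metis imageI mem_cball_0)
  interpret thin_tracts f r0 R0 "max r0 b"
  proof
    fix r assume r: "R0 \<le> r"
    \<comment> \<open>A set of positive measure is nonempty, which gives a small value of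
      \<open>f\<close> on every circle of radius at least \<open>R0\<close>.\<close>
    have "theta f r0 r > 0" using ev[OF r] pos[of r] r R0 by linarith
    hence "{t \<in> {0..2*pi}. norm (f (of_real r * exp (\<i> * of_real t))) < r0} \<noteq> {}"
      unfolding theta_def by (metis less_irrefl measure_empty)
    then obtain u where u: "norm (f (of_real r * exp (\<i> * of_real u))) < r0" by blast
    moreover have "norm (of_real r * exp (\<i> * of_real u)) = r" using r R0 by (simp add: norm_mult)
    ultimately show "\<exists>z. norm z = r \<and> norm (f z) < r0" by blast
  next
    fix z :: complex assume "norm z \<le> R0"
    from b[OF this] show "norm (f z) \<le> max r0 b" by simp
  qed (use f R0 assms in auto)
  have "\<exists>z0. deriv f z0 \<noteq> 0"
  proof (rule ccontr)
    assume "\<not> ?thesis"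
    hence "(f has_field_derivative 0) (at z)" for z using holomorphic_derivI[OF f open_UNIV UNIV_I, of z] by simp
    hence "(f has_field_derivative 0) (at z within UNIV)" for z by simp
    then obtain c where "\<And>z. f z = c" 
      using has_field_derivative_zero_constant[OF convex_UNIV, of f] by auto
    hence "\<exists>n c. \<forall>z. f z = (\<Sum>k\<le>n. c k * z ^ k)" by (intro exI[of _ 0] exI[of _ "\<lambda>_. c"]) simp
    thus False using tr unfolding transcendental_entire_def by blast
  qed
  then obtain z0 where z0: "deriv f z0 \<noteq> 0" by blast
  have esc: "negligible (escaping_set f)"
    by (rule escaping_set_null[OF surviving_set_null[OF assms(2) ev mono pos assms(7)] z0])
  moreover have "negligible (julia_set f)" if "disjoint_type f"
  proof -
    have "hyperbolic f" using that by (simp add: disjoint_type_def)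
    from negligible_Un[OF esc julia_minus_escaping_null[OF this]] show ?thesis
      by (rule negligible_subset) blast
  qed
  ultimately show ?thesis by (simp add: negligible_iff_null_sets)
qed

end
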